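(* Let $\mathbb{A}$ be a connected graph of groups with finite underlying graph and finite edge groups, and let $u_0$ be a vertex. The following are equivalent: (1) $\pi_1(\mathbb{A},u_0)$ has the s.f.g.i.p. (2) Each vertex group of $\mathbb{A}$ has the s.f.g.i.p. and $\pi_1(\mathbb{A},u_0)$ does not contain any subgroup isomorphic to $\mathbb{Z}/k\mathbb{Z}\times\mathbb{Z}$ for any $k\ge 2$.
   Context: Conventions: $H^g=g^{-1}Hg$. A group $G$ has the f.g.i.p. if the intersection of any two finitely generated subgroups of $G$ is finitely generated. $G$ has the s.f.g.i.p. if it has the f.g.i.p. and for all finitely generated subgroups $H,K\le G$ there are only finitely many double cosets $HgK$ ($g\in G$) with $H^g\cap K\ne 1$. $\pi_1(\mathbb A,u_0)$ is the (Bass–Serre) fundamental group of the graph of groups $\mathbb A$ at $u_0$. *)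

theory Defs
  imports
    "HOL-Algebra.Elementary_Groups"
    "Graph_Theory.Bidirected_Digraph"
    "Graph_Theory.Digraph_Component"
begin

section \<open>Intersections of finitely generated subgroups\<close>

definition fin_gen_subgroup :: "'a set \<Rightarrow> ('a, 'm) monoid_scheme \<Rightarrow> bool" where
  "fin_gen_subgroup H G \<longleftrightarrow> (\<exists>S. finite S \<and> S \<subseteq> carrier G \<and> H = generate G S)"

definition fgip :: "('a, 'm) monoid_scheme \<Rightarrow> bool" where
  "fgip G \<longleftrightarrow>
     (\<forall>H K. fin_gen_subgroup H G \<longrightarrow> fin_gen_subgroup K G \<longrightarrow> fin_gen_subgroup (H \<inter> K) G)"

definition conj_subgroup :: "('a, 'm) monoid_scheme \<Rightarrow> 'a set \<Rightarrow> 'a \<Rightarrow> 'a set" where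
  "conj_subgroup G H g = (inv\<^bsub>G\<^esub> g <#\<^bsub>G\<^esub> H) #>\<^bsub>G\<^esub> g"

definition double_coset :: "('a, 'm) monoid_scheme \<Rightarrow> 'a set \<Rightarrow> 'a \<Rightarrow> 'a set \<Rightarrow> 'a set" where
  "double_coset G H g K = (H #>\<^bsub>G\<^esub> g) <#>\<^bsub>G\<^esub> K"

definition sfgip :: "('a, 'm) monoid_scheme \<Rightarrow> bool" where
  "sfgip G \<longleftrightarrow> fgip G \<and>
     (\<forall>H K. fin_gen_subgroup H G \<longrightarrow> fin_gen_subgroup K G \<longrightarrow>
        finite {double_coset G H g K | g. g \<in> carrier G \<and> conj_subgroup G H g \<inter> K \<noteq> {\<one>\<^bsub>G\<^esub>}})"


section \<open>Graphs of groups\<close>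

text \<open>
  The underlying graph is a graph in the sense of Serre: every arc \<open>e\<close> comes with an opposite
  arc \<open>arc_rev A e\<close>, different from \<open>e\<close>; loops and multiple edges are allowed. (That
  \<^locale>\<open>bidirected_digraph\<close> makes \<open>arc_rev A\<close> the identity off the arcs is a mere normalisation.)
  The map \<open>edge_map A e\<close> is the boundary monomorphism from the edge group of \<open>e\<close> into the group
  of the initial vertex of \<open>e\<close>. Since an arc and its opposite have the same edge group, the
  boundary monomorphism into the group of the terminal vertex is \<open>edge_map A (arc_rev A e)\<close>.
\<close>

record ('v, 'e, 'g, 'h) pre_graph_of_groups =
  ugraph :: "('v, 'e) pre_digraph"
  arc_rev :: "'e \<Rightarrow> 'e"
  vertex_group :: "'v \<Rightarrow> 'g monoid"
  edge_group :: "'e \<Rightarrow> 'h monoid"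
  edge_map :: "'e \<Rightarrow> 'h \<Rightarrow> 'g"

locale graph_of_groups =
  fixes A :: "('v, 'e, 'g, 'h) pre_graph_of_groups"
  assumes bidirected: "bidirected_digraph (ugraph A) (arc_rev A)"
    and group_vertex_group: "v \<in> verts (ugraph A) \<Longrightarrow> group (vertex_group A v)"
    and group_edge_group: "e \<in> arcs (ugraph A) \<Longrightarrow> group (edge_group A e)"
    and edge_group_rev: "e \<in> arcs (ugraph A) \<Longrightarrow> edge_group A (arc_rev A e) = edge_group A e"
    and edge_map_mon: "e \<in> arcs (ugraph A) \<Longrightarrow>
          edge_map A e \<in> mon (edge_group A e) (vertex_group A (tail (ugraph A) e))"


section \<open>The fundamental group of a graph of groups\<close>

text \<open>
  A path \<open>a\<^sub>0, e\<^sub>1, a\<^sub>1, \<dots>, e\<^sub>n, a\<^sub>n\<close> from \<open>u\<close> to \<open>v\<close> consists of a walk \<open>e\<^sub>1, \<dots>, e\<^sub>n\<close> from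
  \<open>u\<close> to \<open>v\<close>, an element \<open>a\<^sub>0\<close> of the group of \<open>u\<close> and, for \<open>i \<ge> 1\<close>, an element \<open>a\<^sub>i\<close> of the
  group of the terminal vertex of \<open>e\<^sub>i\<close>. It is encoded as \<open>(a\<^sub>0, [(e\<^sub>1, a\<^sub>1), \<dots>, (e\<^sub>n, a\<^sub>n)])\<close>.
\<close>

type_synonym ('e, 'g) gog_path = "'g \<times> ('e \<times> 'g) list"

definition is_gog_path ::
  "('v, 'e, 'g, 'h) pre_graph_of_groups \<Rightarrow> 'v \<Rightarrow> ('e, 'g) gog_path \<Rightarrow> 'v \<Rightarrow> bool" where
  "is_gog_path A u p v \<longleftrightarrow>
     pre_digraph.awalk (ugraph A) u (map fst (snd p)) v \<and>
     fst p \<in> carrier (vertex_group A u) \<and>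
     (\<forall>(e, a) \<in> set (snd p). a \<in> carrier (vertex_group A (head (ugraph A) e)))"

text \<open>
  Concatenation of paths, \<open>u\<close> being the initial vertex of the first one: the last group element
  of the first path is multiplied with the first group element of the second one.
\<close>

fun gog_path_comp ::
  "('v, 'e, 'g, 'h) pre_graph_of_groups \<Rightarrow> 'v \<Rightarrow>
   ('e, 'g) gog_path \<Rightarrow> ('e, 'g) gog_path \<Rightarrow> ('e, 'g) gog_path" where
  "gog_path_comp A u (a, []) q = (a \<otimes>\<^bsub>vertex_group A u\<^esub> fst q, snd q)"
| "gog_path_comp A u (a, (e, b) # es) q =
     (let r = gog_path_comp A (head (ugraph A) e) (b, es) q in (a, (e, fst r) # snd r))"

text \<open>
  The relations \<open>e e\<^sup>-\<^sup>1 = 1\<close> and \<open>\<alpha>\<^sub>e(c) e = e \<omega>\<^sub>e(c)\<close>, applied inside a path from \<open>u\<close> to \<open>v\<close>.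
\<close>

inductive gog_path_step ::
  "('v, 'e, 'g, 'h) pre_graph_of_groups \<Rightarrow> 'v \<Rightarrow> 'v \<Rightarrow>
   ('e, 'g) gog_path \<Rightarrow> ('e, 'g) gog_path \<Rightarrow> bool" for A u v where
  backtrack:
    "\<lbrakk>e \<in> arcs (ugraph A); x = tail (ugraph A) e; y = head (ugraph A) e;
      is_gog_path A u p x; is_gog_path A x q v\<rbrakk> \<Longrightarrow>
     gog_path_step A u v
       (gog_path_comp A u p (gog_path_comp A x
          (\<one>\<^bsub>vertex_group A x\<^esub>, [(e, \<one>\<^bsub>vertex_group A y\<^esub>), (arc_rev A e, \<one>\<^bsub>vertex_group A x\<^esub>)]) q))
       (gog_path_comp A u p q)"
| slide:
    "\<lbrakk>e \<in> arcs (ugraph A); x = tail (ugraph A) e; y = head (ugraph A) e;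
      c \<in> carrier (edge_group A e); is_gog_path A u p x; is_gog_path A y q v\<rbrakk> \<Longrightarrow>
     gog_path_step A u v
       (gog_path_comp A u p (gog_path_comp A x
          (edge_map A e c, [(e, \<one>\<^bsub>vertex_group A y\<^esub>)]) q))
       (gog_path_comp A u p (gog_path_comp A x
          (\<one>\<^bsub>vertex_group A x\<^esub>, [(e, edge_map A (arc_rev A e) c)]) q))"

definition gog_path_rel ::
  "('v, 'e, 'g, 'h) pre_graph_of_groups \<Rightarrow> 'v \<Rightarrow> 'v \<Rightarrow>
   (('e, 'g) gog_path \<times> ('e, 'g) gog_path) set" where
  "gog_path_rel A u v =
     {(p, q). is_gog_path A u p v \<and> is_gog_path A u q v \<and> equivclp (gog_path_step A u v) p q}"

definition fundamental_group ::
  "('v, 'e, 'g, 'h) pre_graph_of_groups \<Rightarrow> 'v \<Rightarrow> ('e, 'g) gog_path set monoid" where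
  "fundamental_group A u =
     \<lparr>carrier = {p. is_gog_path A u p u} // gog_path_rel A u u,
      monoid.mult = (\<lambda>X Y. \<Union>p\<in>X. \<Union>q\<in>Y. gog_path_rel A u u `` {gog_path_comp A u p q}),
      one = gog_path_rel A u u `` {(\<one>\<^bsub>vertex_group A u\<^esub>, [])}\<rparr>"


section \<open>The fundamental group is a group\<close>

context graph_of_groups
begin

interpretation B: bidirected_digraph "ugraph A" "arc_rev A"
  by (rule bidirected)

abbreviation "cmp \<equiv> gog_path_comp A"
abbreviation "ispath \<equiv> is_gog_path A"
abbreviation "V \<equiv> vertex_group A"

lemma ispath_Nil [simp]:
  "ispath u (a, []) v \<longleftrightarrow> u = v \<and> u \<in> verts (ugraph A) \<and> a \<in> carrier (V u)"
  by (auto simp: is_gog_path_def B.awalk_def)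

lemma ispath_Cons [simp]:
  "ispath u (a, (e, b) # es) v \<longleftrightarrow>
     e \<in> arcs (ugraph A) \<and> tail (ugraph A) e = u \<and> a \<in> carrier (V u) \<and>
     ispath (head (ugraph A) e) (b, es) v"
  by (auto simp: is_gog_path_def B.awalk_def)

lemma ispath_induct [consumes 1, case_names Nil Cons]:
  assumes "ispath u p v"
    and "\<And>u a. \<lbrakk>u \<in> verts (ugraph A); a \<in> carrier (V u); u = v\<rbrakk> \<Longrightarrow> P u (a, [])"
    and "\<And>u a e b es. \<lbrakk>u \<in> verts (ugraph A); e \<in> arcs (ugraph A); tail (ugraph A) e = u;
           a \<in> carrier (V u); ispath (head (ugraph A) e) (b, es) v;
           P (head (ugraph A) e) (b, es)\<rbrakk> \<Longrightarrow> P u (a, (e, b) # es)"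
  shows "P u p"
proof -
  obtain a es where p: "p = (a, es)" by (cases p)
  have "ispath u (a, es) v \<Longrightarrow> P u (a, es)"
  proof (induction es arbitrary: u a)
    case Nil then show ?case using assms(2) by auto
  next
    case (Cons x es)
    obtain e b where "x = (e, b)" by (cases x)
    with Cons show ?case using assms(3)[of u e a b es] by auto
  qed
  with assms(1) p show ?thesis by simp
qed

lemma ispath_ends: "ispath u p v \<Longrightarrow> u \<in> verts (ugraph A) \<and> v \<in> verts (ugraph A)"
  by (induction rule: ispath_induct) auto

lemma group_V: "v \<in> verts (ugraph A) \<Longrightarrow> group (V v)"
  by (rule group_vertex_group)

lemma one_V [simp]: "v \<in> verts (ugraph A) \<Longrightarrow> \<one>\<^bsub>V v\<^esub> \<in> carrier (V v)"
  by (simp add: group_V group.is_monoid monoid.one_closed)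

lemma mult_V [simp]:
  "\<lbrakk>v \<in> verts (ugraph A); a \<in> carrier (V v); b \<in> carrier (V v)\<rbrakk> \<Longrightarrow> a \<otimes>\<^bsub>V v\<^esub> b \<in> carrier (V v)"
  by (simp add: group_V group.is_monoid monoid.m_closed)

lemma ispath_fst: "ispath x q v \<Longrightarrow> fst q \<in> carrier (V x)"
  by (simp add: is_gog_path_def)

lemma ispath_change_fst: "\<lbrakk>ispath x q v; a \<in> carrier (V x)\<rbrakk> \<Longrightarrow> ispath x (a, snd q) v"
  by (simp add: is_gog_path_def)

lemma ispath_cmp: "\<lbrakk>ispath u p x; ispath x q v\<rbrakk> \<Longrightarrow> ispath u (cmp u p q) v"
  by (induction rule: ispath_induct)
     (auto simp: Let_def intro!: ispath_change_fst dest: ispath_fst)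

lemma cmp_assoc:
  "\<lbrakk>ispath u p x; ispath x q y; ispath y r v\<rbrakk> \<Longrightarrow> cmp u (cmp u p q) r = cmp u p (cmp x q r)"
proof (induction rule: ispath_induct)
  case (Nil u a)
  obtain b es where q: "q = (b, es)" by (cases q)
  from Nil have "group (V u)" "b \<in> carrier (V u)" "es = [] \<Longrightarrow> fst r \<in> carrier (V u)"
    by (auto simp: group_V q dest: ispath_fst)
  then show ?case using Nil
    by (cases es) (auto simp: q Let_def group.is_monoid monoid.m_assoc)
next
  case (Cons u a e b es)
  then show ?case by (simp add: Let_def)
qed

lemma cmp_one_left: "ispath u p v \<Longrightarrow> cmp u (\<one>\<^bsub>V u\<^esub>, []) p = p"
  using ispath_fst[of u p v] ispath_ends[of u p v]
  by (simp add: group_V group.is_monoid monoid.l_one)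

lemma cmp_one_right: "ispath u p v \<Longrightarrow> cmp u p (\<one>\<^bsub>V v\<^esub>, []) = p"
  by (induction rule: ispath_induct)
     (auto simp: Let_def group_V group.is_monoid monoid.r_one)

abbreviation "step \<equiv> gog_path_step A"

lemma edge_map_closed:
  "\<lbrakk>e \<in> arcs (ugraph A); c \<in> carrier (edge_group A e)\<rbrakk> \<Longrightarrow>
   edge_map A e c \<in> carrier (V (tail (ugraph A) e))"
  using edge_map_mon by (auto simp: mon_def hom_def)

lemma edge_map_rev_closed:
  "\<lbrakk>e \<in> arcs (ugraph A); c \<in> carrier (edge_group A e)\<rbrakk> \<Longrightarrow>
   edge_map A (arc_rev A e) c \<in> carrier (V (head (ugraph A) e))"
  using edge_map_closed[of "arc_rev A e" c] by (simp add: edge_group_rev)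

lemma step_ispath: "step u v p q \<Longrightarrow> ispath u p v \<and> ispath u q v"
proof (induction rule: gog_path_step.induct)
  case (backtrack e x y p q)
  then have "ispath x (\<one>\<^bsub>V x\<^esub>, [(e, \<one>\<^bsub>V y\<^esub>), (arc_rev A e, \<one>\<^bsub>V x\<^esub>)]) x" by simp
  with backtrack show ?case by (meson ispath_cmp)
next
  case (slide e x y c p q)
  then have "ispath x (edge_map A e c, [(e, \<one>\<^bsub>V y\<^esub>)]) y"
    "ispath x (\<one>\<^bsub>V x\<^esub>, [(e, edge_map A (arc_rev A e) c)]) y"
    by (auto simp: edge_map_closed edge_map_rev_closed)
  with slide show ?case by (meson ispath_cmp)
qed

lemma cmp_context_left:
  "\<lbrakk>ispath w r u; ispath u p x; ispath x m y; ispath y q v\<rbrakk> \<Longrightarrow>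
   cmp w r (cmp u p (cmp x m q)) = cmp w (cmp w r p) (cmp x m q)"
  using cmp_assoc[of w r u p x "cmp x m q" v] ispath_cmp[of x m y q v] by simp

lemma cmp_context_right:
  "\<lbrakk>ispath v r w; ispath u p x; ispath x m y; ispath y q v\<rbrakk> \<Longrightarrow>
   cmp u (cmp u p (cmp x m q)) r = cmp u p (cmp x m (cmp y q r))"
  using cmp_assoc[of u p x "cmp x m q" v r w] cmp_assoc[of x m y q v r w] ispath_cmp[of x m y q v]
  by simp

lemma step_cmp_left:
  assumes r: "ispath w r u" and "step u v p q"
  shows "step w v (cmp w r p) (cmp w r q)"
  using assms(2)
proof cases
  case (backtrack e x y p' q')
  have m: "ispath x (\<one>\<^bsub>V x\<^esub>, [(e, \<one>\<^bsub>V y\<^esub>), (arc_rev A e, \<one>\<^bsub>V x\<^esub>)]) x"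
    using backtrack by simp
  show ?thesis
    unfolding backtrack(1,2) cmp_context_left[OF r backtrack(6) m backtrack(7)]
      cmp_assoc[OF r backtrack(6,7), symmetric]
    by (rule gog_path_step.backtrack[OF backtrack(3-5) ispath_cmp[OF r backtrack(6)] backtrack(7)])
next
  case (slide e x y c p' q')
  have m: "ispath x (edge_map A e c, [(e, \<one>\<^bsub>V y\<^esub>)]) y"
    and n: "ispath x (\<one>\<^bsub>V x\<^esub>, [(e, edge_map A (arc_rev A e) c)]) y"
    using slide by (auto simp: edge_map_closed edge_map_rev_closed)
  show ?thesis
    unfolding slide(1,2) cmp_context_left[OF r slide(7) m slide(8)]
      cmp_context_left[OF r slide(7) n slide(8)]
    by (rule gog_path_step.slide[OF slide(3-6) ispath_cmp[OF r slide(7)] slide(8)])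
qed

lemma step_cmp_right:
  assumes r: "ispath v r w" and "step u v p q"
  shows "step u w (cmp u p r) (cmp u q r)"
  using assms(2)
proof cases
  case (backtrack e x y p' q')
  have m: "ispath x (\<one>\<^bsub>V x\<^esub>, [(e, \<one>\<^bsub>V y\<^esub>), (arc_rev A e, \<one>\<^bsub>V x\<^esub>)]) x"
    using backtrack by simp
  show ?thesis
    unfolding backtrack(1,2) cmp_context_right[OF r backtrack(6) m backtrack(7)]
      cmp_assoc[OF backtrack(6,7) r]
    by (rule gog_path_step.backtrack[OF backtrack(3-6) ispath_cmp[OF backtrack(7) r]])
next
  case (slide e x y c p' q')
  have m: "ispath x (edge_map A e c, [(e, \<one>\<^bsub>V y\<^esub>)]) y"
    and n: "ispath x (\<one>\<^bsub>V x\<^esub>, [(e, edge_map A (arc_rev A e) c)]) y"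
    using slide by (auto simp: edge_map_closed edge_map_rev_closed)
  show ?thesis
    unfolding slide(1,2) cmp_context_right[OF r slide(7) m slide(8)]
      cmp_context_right[OF r slide(7) n slide(8)]
    by (rule gog_path_step.slide[OF slide(3-7) ispath_cmp[OF slide(8) r]])
qed

lemma equivclp_map:
  assumes "\<And>x y. r x y \<Longrightarrow> s (f x) (f y)" "equivclp r x y"
  shows "equivclp s (f x) (f y)"
  using assms(2)
proof (induction rule: equivclp_induct)
  case (step y z)
  then have "s (f y) (f z) \<or> s (f z) (f y)" using assms(1) by blast
  then show ?case using step.IH by (meson equivclp_into_equivclp)
qed simp

lemma rel_cmp:
  assumes "(p, p') \<in> gog_path_rel A u x" "(q, q') \<in> gog_path_rel A x v"
  shows "(cmp u p q, cmp u p' q') \<in> gog_path_rel A u v"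
proof -
  have P: "ispath u p x" "ispath u p' x" "ispath x q v" "ispath x q' v"
    and E: "equivclp (step u x) p p'" "equivclp (step x v) q q'"
    using assms by (auto simp: gog_path_rel_def)
  have "equivclp (step u v) (cmp u p q) (cmp u p' q)"
    using equivclp_map[where f = "\<lambda>t. cmp u t q", OF _ E(1)] step_cmp_right[OF P(3)] by blast
  moreover have "equivclp (step u v) (cmp u p' q) (cmp u p' q')"
    using equivclp_map[where f = "cmp u p'", OF _ E(2)] step_cmp_left[OF P(2)] by blast
  ultimately show ?thesis
    using P ispath_cmp by (auto simp: gog_path_rel_def intro: equivclp_trans)
qed

lemma equiv_rel: "equiv {p. ispath u p v} (gog_path_rel A u v)"
  by (rule equivI)
     (auto simp: gog_path_rel_def refl_on_def sym_def trans_def intro: equivclp_sym equivclp_trans)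

lemma ispath_left_inverse:
  assumes "ispath u p v"
  shows "\<exists>q. ispath v q u \<and> (cmp v q p, (\<one>\<^bsub>V v\<^esub>, [])) \<in> gog_path_rel A v v"
  using assms
proof (induction rule: ispath_induct)
  case (Nil u a)
  then show ?case
    by (intro exI[of _ "(inv\<^bsub>V u\<^esub> a, [])"])
       (auto simp: gog_path_rel_def group_V group.l_inv group.inv_closed)
next
  case (Cons u a e b es)
  interpret VU: group "V u" using Cons by (simp add: group_V)
  let ?x = "head (ugraph A) e" and ?p = "(b, es)"
  let ?s = "(a, [(e, \<one>\<^bsub>V ?x\<^esub>)])" and ?t = "(\<one>\<^bsub>V ?x\<^esub>, [(arc_rev A e, inv\<^bsub>V u\<^esub> a)])"
  let ?m = "(\<one>\<^bsub>V ?x\<^esub>, [(arc_rev A e, \<one>\<^bsub>V u\<^esub>), (e, \<one>\<^bsub>V ?x\<^esub>)])"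
  obtain q where q: "ispath v q ?x" "(cmp v q ?p, (\<one>\<^bsub>V v\<^esub>, [])) \<in> gog_path_rel A v v"
    using Cons by blast
  have x: "?x \<in> verts (ugraph A)" using Cons by simp
  have s: "ispath u ?s ?x" and t: "ispath ?x ?t u" and m: "ispath ?x ?m ?x"
    using Cons by auto
  have b: "b \<in> carrier (V ?x)" using Cons(5) ispath_fst by fastforce
  have p: "(a, (e, b) # es) = cmp u ?s ?p"
    using b x by (simp add: Let_def group_V group.is_monoid monoid.l_one)
  have ts: "cmp ?x ?t ?s = ?m" using Cons by (simp add: Let_def)
  have "cmp v (cmp v q ?t) (cmp u ?s ?p) = cmp v q (cmp ?x ?m ?p)"
    using cmp_assoc[OF q(1) t ispath_cmp[OF s Cons(5)]] cmp_assoc[OF t s Cons(5)] ts by simp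
  moreover have st: "step v v (cmp v q (cmp ?x ?m ?p)) (cmp v q ?p)"
    using gog_path_step.backtrack[of "arc_rev A e" A ?x u v q ?p v, OF _ _ _ q(1) Cons(5)] Cons(2,3)
    by (simp del: gog_path_comp.simps)
  then have "(cmp v q (cmp ?x ?m ?p), cmp v q ?p) \<in> gog_path_rel A v v"
    using step_ispath[OF st] by (auto simp: gog_path_rel_def)
  then have "(cmp v q (cmp ?x ?m ?p), (\<one>\<^bsub>V v\<^esub>, [])) \<in> gog_path_rel A v v"
    using q(2) equiv_rel[of v v] by (blast elim: equivE dest: transD)
  ultimately have "(cmp v (cmp v q ?t) (a, (e, b) # es), (\<one>\<^bsub>V v\<^esub>, [])) \<in> gog_path_rel A v v"
    unfolding p by (simp only:)
  then show ?case using ispath_cmp[OF q(1) t] by blast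
qed

lemma fundamental_group_mult:
  assumes "ispath u p u" "ispath u q u"
  shows "gog_path_rel A u u `` {p} \<otimes>\<^bsub>fundamental_group A u\<^esub> gog_path_rel A u u `` {q} =
    gog_path_rel A u u `` {cmp u p q}"
proof -
  have "congruent2 (gog_path_rel A u u) (gog_path_rel A u u)
      (\<lambda>p q. gog_path_rel A u u `` {cmp u p q})"
    by (rule congruent2I') (auto intro!: equiv_class_eq[OF equiv_rel] rel_cmp)
  then show ?thesis
    using assms UN_equiv_class2[OF equiv_rel equiv_rel] by (simp add: fundamental_group_def)
qed

theorem group_fundamental_group:
  assumes u: "u \<in> verts (ugraph A)"
  shows "group (fundamental_group A u)"
proof -
  let ?R = "gog_path_rel A u u" and ?G = "fundamental_group A u"
  have car: "X \<in> carrier ?G \<longleftrightarrow> (\<exists>p. ispath u p u \<and> X = ?R `` {p})" for X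
    by (auto simp: fundamental_group_def quotient_def)
  have one: "\<one>\<^bsub>?G\<^esub> = ?R `` {(\<one>\<^bsub>V u\<^esub>, [])}"
    by (simp add: fundamental_group_def)
  have one_path: "ispath u (\<one>\<^bsub>V u\<^esub>, []) u" using u by simp
  note mult = fundamental_group_mult[of u]
  show ?thesis
  proof (rule groupI)
    fix X Y assume "X \<in> carrier ?G" "Y \<in> carrier ?G"
    then obtain p q where "ispath u p u" "X = ?R `` {p}" "ispath u q u" "Y = ?R `` {q}"
      unfolding car by blast
    then show "X \<otimes>\<^bsub>?G\<^esub> Y \<in> carrier ?G"
      unfolding car by (intro exI[of _ "cmp u p q"]) (simp add: mult ispath_cmp[of u _ u])
  next
    show "\<one>\<^bsub>?G\<^esub> \<in> carrier ?G" unfolding car one using one_path by blast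
  next
    fix X Y Z assume "X \<in> carrier ?G" "Y \<in> carrier ?G" "Z \<in> carrier ?G"
    then obtain p q r where "ispath u p u" "X = ?R `` {p}" "ispath u q u" "Y = ?R `` {q}"
      "ispath u r u" "Z = ?R `` {r}"
      unfolding car by blast
    then show "X \<otimes>\<^bsub>?G\<^esub> Y \<otimes>\<^bsub>?G\<^esub> Z = X \<otimes>\<^bsub>?G\<^esub> (Y \<otimes>\<^bsub>?G\<^esub> Z)"
      by (simp add: mult ispath_cmp[of u _ u] cmp_assoc[of u _ u _ u _ u])
  next
    fix X assume "X \<in> carrier ?G"
    then obtain p where "ispath u p u" "X = ?R `` {p}" unfolding car by blast
    then show "\<one>\<^bsub>?G\<^esub> \<otimes>\<^bsub>?G\<^esub> X = X"
      unfolding one by (simp only: mult[OF one_path] cmp_one_left)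
  next
    fix X assume "X \<in> carrier ?G"
    then obtain p where p: "ispath u p u" "X = ?R `` {p}" unfolding car by blast
    obtain q where q: "ispath u q u" "(cmp u q p, (\<one>\<^bsub>V u\<^esub>, [])) \<in> ?R"
      using ispath_left_inverse[OF p(1)] by blast
    then have "?R `` {q} \<otimes>\<^bsub>?G\<^esub> X = \<one>\<^bsub>?G\<^esub>"
      unfolding one p(2) mult[OF q(1) p(1)] by (intro equiv_class_eq[OF equiv_rel])
    then show "\<exists>Y\<in>carrier ?G. Y \<otimes>\<^bsub>?G\<^esub> X = \<one>\<^bsub>?G\<^esub>"
      using q(1) car by blast
  qed
qed

end

end

theory Submission
  imports Defs "HOL-Algebra.Multiplicative_Group"
begin

text \<open>
That the s.f.g.i.p. is inherited from the vertex groups is seen on the Bass--Serre tree. Let a group \<open>G\<close> act on a tree with finite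
edge stabilizers and finitely many orbits of edges, and let \<open>H\<close> and \<open>K\<close> be finitely generated subgroups.
The translates under \<open>H\<close> of a suitable finite subtree form an \<open>H\<close>-invariant subtree \<open>T\<^sub>H\<close>, and likewise
for \<open>K\<close>. For \<open>g\<close> in \<open>G\<close> the group \<open>H\<^sup>g \<inter> K\<close> acts on \<open>g\<^sup>-\<^sup>1T\<^sub>H \<inter> T\<^sub>K\<close>. Up to \<open>H\<close> and \<open>K\<close>, an edge of this
intersection is a pair of edges of the two finite subtrees together with an element of \<open>G\<close> that carries
one to the other, and finite edge stabilizers leave only finitely many such triples. This has two consequences.

\<^item> For \<open>g = 1\<close>, the group \<open>H \<inter> K\<close> acts on a subtree with finitely many orbits of edges. Its vertex
stabilizers are the intersections \<open>H\<^sub>x \<inter> K\<^sub>x\<close>; here \<open>H\<^sub>x\<close> and \<open>K\<^sub>x\<close> are finitely generated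
(\<open>stab_fin_gen\<close>), hence so is \<open>H\<^sub>x \<inter> K\<^sub>x\<close> by the hypothesis on the vertex groups. So \<open>H \<inter> K\<close> is finitely
generated (\<open>fin_gen_from_action\<close>, \<open>fin_gen_Int\<close>).

\<^item> Only finitely many double cosets \<open>HgK\<close> are such that \<open>g\<^sup>-\<^sup>1T\<^sub>H \<inter> T\<^sub>K\<close> contains an edge. If it is a
single vertex, then that vertex is fixed by \<open>H\<^sup>g \<inter> K\<close>, and the s.f.g.i.p. of the vertex group leaves finitely
many double cosets with \<open>H\<^sup>g \<inter> K \<noteq> 1\<close> (\<open>finite_double_cosets_at_vertex\<close>).

There remain the \<open>g\<close> for which \<open>g\<^sup>-\<^sup>1T\<^sub>H\<close> and \<open>T\<^sub>K\<close> are disjoint although \<open>H\<^sup>g \<inter> K\<close> contains some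
\<open>c \<noteq> 1\<close>. Such a \<open>c\<close> fixes the bridge between the two subtrees (\<open>fixed_bridge\<close>). A long path fixed by \<open>c\<close>
contains two edges in the same orbit whose difference \<open>t\<close> commutes with \<open>c\<close>; as \<open>t\<close> translates along the path
it has infinite order, and \<open>c\<close> and \<open>t\<close> generate a copy of \<open>\<int>/k \<times> \<int>\<close>. Hence bridges have bounded length
(\<open>fixed_path_bound\<close>). The s.f.g.i.p. of the vertex groups also shows that, up to \<open>K\<close>, only finitely many edges
leaving \<open>T\<^sub>K\<close> are fixed by a nontrivial element of \<open>K\<close>; so after boundedly many enlargements
\<open>T\<^sub>K\<close> contains all bridges (\<open>enlarge\<close>), and the disjoint case does not occur any more.

As vertices of the Bass--Serre tree one takes the normal forms of paths from the base vertex, without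
their final vertex group element; the neighbours of a normal form are obtained by removing or adding one
syllable. This is visibly a tree. The work lies in the action of the fundamental group: paths act on normal
forms as in van der Waerden's proof of the normal form theorem for free products.

For the other implication, the s.f.g.i.p. passes to subgroups (\<open>sfgip_inj_hom\<close>), vertex groups embed
(\<open>vertex_group_embeds\<close>), and in \<open>\<int>/k \<times> \<int>\<close> the finite factor is normal and has infinitely many
double cosets (\<open>not_sfgip_finite_cyclic_times_Z\<close>).
\<close>

section \<open>Trees\<close>

text \<open>
Unlike connectedness of an induced subgraph, \<open>joined r P x x\<close> also holds for \<open>x\<close> outside \<open>P\<close>.
That \<open>v\<close> does not separate two vertices is expressed with \<open>P = X - {v}\<close>.
\<close>

definition joined :: "('x \<Rightarrow> 'x \<Rightarrow> bool) \<Rightarrow> 'x set \<Rightarrow> 'x \<Rightarrow> 'x \<Rightarrow> bool" where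
  "joined r P = (\<lambda>a b. r a b \<and> a \<in> P \<and> b \<in> P)\<^sup>*\<^sup>*"

lemma joined_refl [simp]: "joined r P x x"
  by (simp add: joined_def)

lemma joined_trans: "joined r P x y \<Longrightarrow> joined r P y z \<Longrightarrow> joined r P x z"
  unfolding joined_def by (rule rtranclp_trans)

lemma joined_edge: "r x y \<Longrightarrow> x \<in> P \<Longrightarrow> y \<in> P \<Longrightarrow> joined r P x y"
  unfolding joined_def by (simp add: r_into_rtranclp)

lemma joined_mono: "joined r P x y \<Longrightarrow> (\<And>a b. r a b \<Longrightarrow> s a b) \<Longrightarrow> P \<subseteq> Q \<Longrightarrow> joined s Q x y"
  unfolding joined_def by (erule rtranclp_mono[THEN predicate2D, rotated]) auto

lemma joined_subset: "joined r P x y \<Longrightarrow> P \<subseteq> Q \<Longrightarrow> joined r Q x y"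
  by (rule joined_mono)

lemma joined_in: "joined r P x y \<Longrightarrow> x \<noteq> y \<Longrightarrow> x \<in> P \<and> y \<in> P"
  unfolding joined_def
  by (blast elim: converse_rtranclpE rtranclp.cases)

lemma joined_sym:
  assumes "joined r P x y" "\<And>a b. r a b \<Longrightarrow> r b a"
  shows "joined r P y x"
  using assms(1) unfolding joined_def
  by (rule rtranclp_induct) (auto intro: converse_rtranclp_into_rtranclp dest: assms(2))

lemma joined_image:
  assumes "joined r P x y" and "\<And>a b. r a b \<Longrightarrow> a \<in> P \<Longrightarrow> b \<in> P \<Longrightarrow> s (f a) (f b)"
  shows "joined s (f ` P) (f x) (f y)"
  using assms(1) unfolding joined_def
proof (induction rule: rtranclp_induct)
  case (step y z)
  then show ?case
    by (intro rtranclp.rtrancl_into_rtrancl[OF step.IH]) (auto intro: assms(2))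
qed simp

text \<open>
The path is cut at its last visit to \<open>C\<close>. With \<open>C = {x}\<close> this yields the direction in which \<open>y\<close> is seen
from \<open>x\<close>.
\<close>

lemma joined_exit:
  assumes "joined r P x y" "x \<in> C" "y \<notin> C"
  shows "\<exists>c\<in>C. \<exists>z. z \<notin> C \<and> r c z \<and> c \<in> P \<and> z \<in> P \<and> joined r (P - C) z y"
proof -
  let ?r = "\<lambda>a b. r a b \<and> a \<in> P \<and> b \<in> P"
  have "(w \<notin> C \<and> joined r (P - C) w y) \<or>
      (\<exists>c\<in>C. \<exists>z. z \<notin> C \<and> ?r c z \<and> joined r (P - C) z y)" if "?r\<^sup>*\<^sup>* w y" for w
    using that
  proof (induction rule: converse_rtranclp_induct)
    case base
    then show ?case using assms(3) by simp
  next
    case (step w w1)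
    show ?case
    proof (cases "w1 \<notin> C \<and> joined r (P - C) w1 y")
      case True
      then show ?thesis using step(1)
        by (cases "w \<in> C") (blast, meson DiffI joined_edge joined_trans)
    qed (use step.IH in blast)
  qed
  from this[OF assms(1)[unfolded joined_def]] assms(2) show ?thesis by blast
qed

text \<open>
A tree is a simple connected graph in which distinct neighbours of a vertex \<open>v\<close> lie in different
components after removal of \<open>v\<close>. This form of acyclicity avoids closed paths and their reductions.
\<close>

locale tree_graph =
  fixes X :: "'x set" and adj :: "'x \<Rightarrow> 'x \<Rightarrow> bool"
  assumes adj_in: "adj x y \<Longrightarrow> x \<in> X \<and> y \<in> X"
    and adj_sym: "adj x y \<Longrightarrow> adj y x"
    and adj_irrefl: "\<not> adj x x"
    and tree_connected: "x \<in> X \<Longrightarrow> y \<in> X \<Longrightarrow> joined adj X x y"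
    and acyclic: "adj v x \<Longrightarrow> adj v y \<Longrightarrow> joined adj (X - {v}) x y \<Longrightarrow> x = y"
begin

abbreviation "jn \<equiv> joined adj"

lemmas jn_sym = joined_sym[where r = adj, OF _ adj_sym]

definition subtree :: "'x set \<Rightarrow> bool" where
  "subtree P \<longleftrightarrow> P \<subseteq> X \<and> (\<forall>x\<in>P. \<forall>y\<in>P. jn P x y)"

lemma subtreeI_root:
  assumes "P \<subseteq> X" "\<And>x. x \<in> P \<Longrightarrow> jn P v x"
  shows "subtree P"
  unfolding subtree_def using assms by (meson joined_trans jn_sym)

lemma subtree_joined: "subtree P \<Longrightarrow> x \<in> P \<Longrightarrow> y \<in> P \<Longrightarrow> jn P x y"
  by (simp add: subtree_def)

lemma subtree_subset: "subtree P \<Longrightarrow> P \<subseteq> X"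
  by (simp add: subtree_def)

text \<open>
Suppose that \<open>x\<close> and \<open>y\<close> are not joined inside \<open>P \<inter> Q\<close>. A path in \<open>P\<close> leaves the component of
\<open>x\<close> in \<open>P \<inter> Q\<close> for the last time at some \<open>c\<close>, towards a vertex outside \<open>Q\<close>. But \<open>y\<close> is also seen
from \<open>c\<close> along a path in \<open>Q\<close>, and the two directions coincide.
\<close>

lemma subtree_Int:
  assumes P: "subtree P" and Q: "subtree Q"
  shows "subtree (P \<inter> Q)"
  unfolding subtree_def
proof (intro conjI ballI)
  show "P \<inter> Q \<subseteq> X" using P by (auto simp: subtree_def)
  fix x y assume x: "x \<in> P \<inter> Q" and y: "y \<in> P \<inter> Q"
  define C where "C = {z. jn (P \<inter> Q) x z}"
  show "jn (P \<inter> Q) x y"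
  proof (rule ccontr)
    assume "\<not> jn (P \<inter> Q) x y"
    then have C: "x \<in> C" "y \<notin> C" by (auto simp: C_def)
    obtain c z where c: "c \<in> C" "z \<notin> C" "adj c z" "z \<in> P" "jn (P - C) z y"
      using joined_exit[OF subtree_joined[OF P] C] x y by blast
    have cPQ: "c \<in> P \<inter> Q" using c(1) x joined_in[of adj "P \<inter> Q" x c] by (cases "c = x") (auto simp: C_def)
    have "c \<noteq> y" using c(1) C by blast
    then obtain z' where z': "adj c z'" "z' \<in> Q" "jn (Q - {c}) z' y"
      using joined_exit[OF subtree_joined[OF Q], of c y "{c}"] cPQ y by blast
    have "jn (X - {c}) z y" "jn (X - {c}) z' y"
      using joined_subset[OF c(5), of "X - {c}"] joined_subset[OF z'(3), of "X - {c}"] c(1)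
        subtree_subset[OF P] subtree_subset[OF Q] by blast+
    then have "z = z'" using acyclic[OF c(3) z'(1)] by (meson joined_trans jn_sym)
    then have "jn (P \<inter> Q) c z" using c cPQ z'(2) by (auto intro: joined_edge)
    then have "z \<in> C" using c(1) by (auto simp: C_def intro: joined_trans)
    then show False using c(2) by blast
  qed
qed

text \<open>
From outside, a subtree can be entered through one edge only. It follows that an automorphism which
preserves two disjoint subtrees fixes the first edge of the path between them.
\<close>

lemma gate_unique:
  assumes P: "subtree P" and x: "x \<in> P" "adj x y" "y \<notin> P" and x': "x' \<in> P" "adj x' y'" "y' \<notin> P"
    and j: "jn (X - P) y q" "jn (X - P) y' q"
  shows "x = x' \<and> y = y'"
proof -
  have yy: "jn (X - P) y y'" using j by (meson joined_trans jn_sym)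
  have xx: "x = x'"
  proof (rule ccontr)
    assume ne: "x \<noteq> x'"
    then obtain z where z: "adj x z" "z \<in> P" "jn (P - {x}) z x'"
      using joined_exit[OF subtree_joined[OF P x(1) x'(1)], of "{x}"] by blast
    have "jn (X - {x}) y y'" using joined_subset[OF yy, of "X - {x}"] x(1) by blast
    moreover have "jn (X - {x}) y' x'"
      using ne x' adj_in[OF x'(2)] x(1) by (intro joined_edge[of adj, OF adj_sym[OF x'(2)]]) auto
    moreover have "jn (X - {x}) x' z"
      using joined_subset[OF z(3), of "X - {x}"] subtree_subset[OF P] by (metis Diff_mono jn_sym subset_refl)
    ultimately have "y = z" using acyclic[OF x(2) z(1)] by (meson joined_trans)
    then show False using z x by blast
  qed
  moreover have "y = y'"
    using acyclic[OF x(2), of y'] x'(2) xx joined_subset[OF yy, of "X - {x}"] x(1) by blast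
  ultimately show ?thesis by blast
qed

lemma subtree_Un_nbrs:
  assumes "subtree P" "\<And>y. y \<in> N \<Longrightarrow> \<exists>x\<in>P. adj x y"
  shows "subtree (P \<union> N)"
proof (cases "P = {}")
  case True
  then have "N = {}" using assms(2) by blast
  then show ?thesis using assms(1) by simp
next
  case False
  then obtain v where v: "v \<in> P" by blast
  show ?thesis
  proof (rule subtreeI_root[of _ v])
    show "P \<union> N \<subseteq> X" using assms adj_in subtree_subset by blast
    fix x assume x: "x \<in> P \<union> N"
    have *: "jn (P \<union> N) v y" if "y \<in> P" for y
      by (rule joined_mono[OF subtree_joined[OF assms(1) v that]]) auto
    show "jn (P \<union> N) v x"
    proof (cases "x \<in> P")
      case False
      with x assms(2) obtain y where "y \<in> P" "adj y x" by blast
      then show ?thesis using *[of y] joined_edge[of adj y x "P \<union> N"] x by (meson UnI1 joined_trans)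
    qed (rule *)
  qed
qed

lemma subtree_Un:
  assumes "subtree P" "subtree Q" "v \<in> P" "v \<in> Q"
  shows "subtree (P \<union> Q)"
proof (rule subtreeI_root[of _ v])
  show "P \<union> Q \<subseteq> X" using assms subtree_subset by blast
  fix x assume "x \<in> P \<union> Q"
  then show "jn (P \<union> Q) v x"
    using joined_mono[OF subtree_joined[OF assms(1,3)], of x adj "P \<union> Q"]
      joined_mono[OF subtree_joined[OF assms(2,4)], of x adj "P \<union> Q"] by auto
qed

lemma finite_subtree_path:
  assumes "jn X v y" "v \<in> X"
  shows "\<exists>F. finite F \<and> subtree F \<and> v \<in> F \<and> y \<in> F"
  using assms(1) unfolding joined_def
proof (induction rule: rtranclp_induct)
  case base
  show ?case using assms(2) by (intro exI[of _ "{v}"]) (auto simp: subtree_def)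
next
  case (step y z)
  then obtain F where F: "finite F" "subtree F" "v \<in> F" "y \<in> F" by blast
  then show ?case using step(2) subtree_Un_nbrs[of F "{z}"]
    by (intro exI[of _ "F \<union> {z}"]) auto
qed

lemma finite_subtree:
  assumes "finite S" "S \<subseteq> X" "v \<in> X"
  shows "\<exists>F. finite F \<and> subtree F \<and> v \<in> F \<and> S \<subseteq> F"
  using assms(1,2)
proof (induction rule: finite_induct)
  case empty
  then show ?case using finite_subtree_path[of v v] assms(3) by auto
next
  case (insert s S)
  then obtain F where F: "finite F" "subtree F" "v \<in> F" "S \<subseteq> F" by auto
  obtain F' where F': "finite F'" "subtree F'" "v \<in> F'" "s \<in> F'"
    using finite_subtree_path[of v s] tree_connected insert.prems assms(3) by auto
  show ?case
    using F F' subtree_Un[OF F(2) F'(2) F(3) F'(3)] by (intro exI[of _ "F \<union> F'"]) auto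
qed

text \<open>
An edge of a tree is a bridge, so every subgraph that connects its ends contains it.
\<close>

lemma spanning_edge:
  assumes "joined r X x y" "\<And>a b. r a b \<Longrightarrow> adj a b" "adj x y"
  shows "r x y"
proof -
  have "x \<noteq> y" using assms(3) adj_irrefl by blast
  then obtain z where z: "r x z" "joined r (X - {x}) z y"
    using joined_exit[OF assms(1), of "{x}"] by blast
  then have "jn (X - {x}) z y" using joined_mono[OF z(2), of adj] assms(2) by blast
  then show ?thesis using acyclic[OF assms(2)[OF z(1)] assms(3)] z by simp
qed

lemma shortest_path:
  assumes "p \<in> P" "q \<in> Q" "P \<subseteq> X" "Q \<subseteq> X"
  obtains f :: "nat \<Rightarrow> 'x" and n where "f 0 \<in> P" "f n \<in> Q" "\<And>i. i < n \<Longrightarrow> adj (f i) (f (Suc i))"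
    "\<And>i. 0 < i \<Longrightarrow> i \<le> n \<Longrightarrow> f i \<notin> P" "\<And>i. i < n \<Longrightarrow> f i \<notin> Q" "inj_on f {..n}"
    "n > 0 \<Longrightarrow> P \<inter> Q = {}"
proof -
  have "joined adj X p q" using tree_connected assms by blast
  then have "adj\<^sup>*\<^sup>* p q"
    unfolding joined_def by (rule rtranclp_mono[THEN predicate2D, rotated]) auto
  then have ex: "\<exists>n. \<exists>x\<in>P. \<exists>y\<in>Q. (adj ^^ n) x y"
    using assms by (auto simp: rtranclp_is_Sup_relpowp)
  define n where "n = (LEAST n. \<exists>x\<in>P. \<exists>y\<in>Q. (adj ^^ n) x y)"
  have min: "n \<le> m" if "x \<in> P" "y \<in> Q" "(adj ^^ m) x y" for m x y
    unfolding n_def using that by (intro Least_le) blast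
  obtain x y where xy: "x \<in> P" "y \<in> Q" "(adj ^^ n) x y"
    using LeastI_ex[OF ex] unfolding n_def by blast
  then obtain f where f: "f 0 = x" "f n = y" "\<And>i. i < n \<Longrightarrow> adj (f i) (f (Suc i))"
    by (auto simp: relpowp_fun_conv)
  have sub: "(adj ^^ (j - i)) (f i) (f j)" if "i \<le> j" "j \<le> n" for i j
    unfolding relpowp_fun_conv using that f(3)
    by (intro exI[of _ "\<lambda>k. f (i + k)"]) auto
  show ?thesis
  proof (rule that[of f n])
    show "f 0 \<in> P" "f n \<in> Q" using f xy by auto
    show "\<And>i. i < n \<Longrightarrow> adj (f i) (f (Suc i))" by (rule f(3))
    show "f i \<notin> P" if "0 < i" "i \<le> n" for i
      using min[of "f i" "f n" "n - i"] sub[of i n] that f xy by auto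
    show "f i \<notin> Q" if "i < n" for i
      using min[of "f 0" "f i" i] sub[of 0 i] that f xy by auto
    show "P \<inter> Q = {}" if "n > 0"
      using min[of _ _ 0] that by auto
    show "inj_on f {..n}"
    proof (rule linorder_inj_onI')
      fix i j assume ij: "i \<in> {..n}" "j \<in> {..n}" "i < j"
      show "f i \<noteq> f j"
      proof
        assume "f i = f j"
        then have "(adj ^^ (i + (n - j))) (f 0) (f n)"
          using sub[of 0 i] sub[of j n] ij unfolding relpowp_add by auto
        then show False using min[of "f 0" "f n"] f xy ij by fastforce
      qed
    qed
  qed
qed

end

section \<open>Finitely generated subgroups and double cosets\<close>

context group
begin

lemma cancel_inv_left:
  "k \<in> carrier G \<Longrightarrow> x \<in> carrier G \<Longrightarrow> k \<otimes> (inv k \<otimes> x) = x"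
  "k \<in> carrier G \<Longrightarrow> x \<in> carrier G \<Longrightarrow> inv k \<otimes> (k \<otimes> x) = x"
  by (simp_all add: m_assoc[symmetric])

lemma fin_gen_imp_subgroup: "fin_gen_subgroup H G \<Longrightarrow> subgroup H G"
  unfolding fin_gen_subgroup_def using generate_is_subgroup by blast

lemma finite_imp_fin_gen: "finite H \<Longrightarrow> subgroup H G \<Longrightarrow> fin_gen_subgroup H G"
  unfolding fin_gen_subgroup_def
  by (intro exI[of _ H] conjI subgroup.subset generateI) auto

lemma fin_gen_subgroup_within:
  assumes "subgroup V G"
  shows "fin_gen_subgroup H (G\<lparr>carrier := V\<rparr>) \<longleftrightarrow> fin_gen_subgroup H G \<and> H \<subseteq> V"
proof -
  have "generate G S \<subseteq> V \<longleftrightarrow> S \<subseteq> V" if "S \<subseteq> carrier G" for S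
    using generate_subgroup_incl[OF _ assms] generate.incl by (metis subset_iff)
  then show ?thesis
    unfolding fin_gen_subgroup_def using generate_consistent[OF _ assms] subgroup.subset[OF assms]
    by simp (metis subset_trans)
qed

lemma fin_gen_subgroupI:
  assumes "finite S" "S \<subseteq> H" "subgroup H G" "H \<subseteq> generate G S"
  shows "fin_gen_subgroup H G"
  unfolding fin_gen_subgroup_def
  using assms generate_subgroup_incl[OF assms(2,3)] subgroup.subset[OF assms(3)]
  by (intro exI[of _ S]) auto

lemma mem_conj_subgroup:
  assumes "H \<subseteq> carrier G" "g \<in> carrier G"
  shows "x \<in> conj_subgroup G H g \<longleftrightarrow> x \<in> carrier G \<and> g \<otimes> x \<otimes> inv g \<in> H"
proof
  assume "x \<in> conj_subgroup G H g"
  then obtain h where h: "h \<in> H" "x = inv g \<otimes> h \<otimes> g"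
    by (auto simp: conj_subgroup_def l_coset_def r_coset_def)
  then have "g \<otimes> x \<otimes> inv g = h" using assms by (auto simp: m_assoc[symmetric] subset_iff) (simp add: m_assoc)
  then show "x \<in> carrier G \<and> g \<otimes> x \<otimes> inv g \<in> H" using h assms by auto
next
  assume x: "x \<in> carrier G \<and> g \<otimes> x \<otimes> inv g \<in> H"
  then have "x = inv g \<otimes> (g \<otimes> x \<otimes> inv g) \<otimes> g"
    using assms by (simp add: m_assoc inv_solve_left)
  then show "x \<in> conj_subgroup G H g"
    using x by (auto simp: conj_subgroup_def l_coset_def r_coset_def)
qed

lemma conj_subgroup_nontrivial:
  assumes "subgroup H G" "subgroup K G" "g \<in> carrier G"
  shows "conj_subgroup G H g \<inter> K \<noteq> {\<one>} \<longleftrightarrow> (\<exists>c\<in>K. c \<noteq> \<one> \<and> g \<otimes> c \<otimes> inv g \<in> H)"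
proof -
  have "\<one> \<in> conj_subgroup G H g \<inter> K"
    using assms by (simp add: mem_conj_subgroup subgroup.subset subgroup.one_closed)
  then have "conj_subgroup G H g \<inter> K \<noteq> {\<one>} \<longleftrightarrow> (\<exists>c\<in>K. c \<noteq> \<one> \<and> c \<in> conj_subgroup G H g)"
    by blast
  also have "\<dots> \<longleftrightarrow> (\<exists>c\<in>K. c \<noteq> \<one> \<and> g \<otimes> c \<otimes> inv g \<in> H)"
    unfolding mem_conj_subgroup[OF subgroup.subset[OF assms(1)] assms(3)]
    using subgroup.subset[OF assms(2)] by blast
  finally show ?thesis .
qed

lemma mem_double_coset: "x \<in> double_coset G H g K \<longleftrightarrow> (\<exists>h\<in>H. \<exists>k\<in>K. x = h \<otimes> g \<otimes> k)"
  by (auto simp: double_coset_def r_coset_def set_mult_def)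

lemma double_coset_translate:
  assumes H: "subgroup H G" and K: "subgroup K G" and "h \<in> H" "k \<in> K" "g \<in> carrier G"
  shows "double_coset G H (h \<otimes> g \<otimes> k) K = double_coset G H g K"
proof (intro equalityI subsetI)
  note c = subgroup.mem_carrier[OF H] subgroup.mem_carrier[OF K]
  fix x
  {
    assume "x \<in> double_coset G H (h \<otimes> g \<otimes> k) K"
    then obtain h' k' where h': "h' \<in> H" "k' \<in> K" "x = h' \<otimes> (h \<otimes> g \<otimes> k) \<otimes> k'"
      unfolding mem_double_coset by blast
    then have "x = (h' \<otimes> h) \<otimes> g \<otimes> (k \<otimes> k')" using assms(3-5) c by (simp add: m_assoc)
    then show "x \<in> double_coset G H g K"
      unfolding mem_double_coset
      using subgroup.m_closed[OF H h'(1) assms(3)] subgroup.m_closed[OF K assms(4) h'(2)] by blast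
  next
    assume "x \<in> double_coset G H g K"
    then obtain h' k' where h': "h' \<in> H" "k' \<in> K" "x = h' \<otimes> g \<otimes> k'"
      unfolding mem_double_coset by blast
    then have "x = (h' \<otimes> inv h) \<otimes> (h \<otimes> g \<otimes> k) \<otimes> (inv k \<otimes> k')"
      using assms(3-5) c by (simp add: m_assoc cancel_inv_left)
    then show "x \<in> double_coset G H (h \<otimes> g \<otimes> k) K"
      unfolding mem_double_coset
      using subgroup.m_closed[OF H h'(1) subgroup.m_inv_closed[OF H assms(3)]]
        subgroup.m_closed[OF K subgroup.m_inv_closed[OF K assms(4)] h'(2)] by blast
  }
qed

end

lemma sfgipD:
  assumes "sfgip G" "fin_gen_subgroup H G" "fin_gen_subgroup K G"
  shows "fin_gen_subgroup (H \<inter> K) G"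
    and "finite {double_coset G H g K | g. g \<in> carrier G \<and> conj_subgroup G H g \<inter> K \<noteq> {\<one>\<^bsub>G\<^esub>}}"
  using assms unfolding sfgip_def fgip_def by blast+

text \<open>
Images under an injective homomorphism preserve finite generation and intersections, and they carry double
cosets injectively to double cosets.
\<close>

lemma sfgip_inj_hom:
  assumes V: "group V" and G: "group G" and f: "f \<in> hom V G" "inj_on f (carrier V)" and sf: "sfgip G"
  shows "sfgip V"
proof -
  interpret V: group V by fact
  interpret G: group G by fact
  interpret f: group_hom V G f by unfold_locales fact
  have img: "fin_gen_subgroup (f ` H) G" if "fin_gen_subgroup H V" for H
    using that unfolding fin_gen_subgroup_def
    by (metis f.generate_img f.hom_closed finite_imageI image_subset_iff subset_iff)
  have inv_img: "f g \<otimes>\<^bsub>G\<^esub> f x \<otimes>\<^bsub>G\<^esub> inv\<^bsub>G\<^esub> (f g) = f (g \<otimes>\<^bsub>V\<^esub> x \<otimes>\<^bsub>V\<^esub> inv\<^bsub>V\<^esub> g)"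
    if "g \<in> carrier V" "x \<in> carrier V" for g x using that by simp
  show ?thesis
    unfolding sfgip_def fgip_def
  proof (intro conjI allI impI)
    fix H K assume fg: "fin_gen_subgroup H V" "fin_gen_subgroup K V"
    have HK: "subgroup H V" "subgroup K V"
      using fg V.fin_gen_imp_subgroup by auto
    have sub: "H \<subseteq> carrier V" "K \<subseteq> carrier V" using HK by (auto dest: subgroup.subset)
    have "fin_gen_subgroup (f ` (H \<inter> K)) G"
      using sfgipD(1)[OF sf img[OF fg(1)] img[OF fg(2)]] inj_on_image_Int[OF f(2) sub] by simp
    then obtain S where S: "finite S" "f ` (H \<inter> K) = generate G S"
      by (auto simp: fin_gen_subgroup_def)
    then have "S \<subseteq> f ` (H \<inter> K)" using generate.incl[of _ S G] by blast
    then obtain S' where S': "finite S'" "S' \<subseteq> H \<inter> K" "S = f ` S'"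
      using S(1) finite_subset_image by metis
    have "f ` (H \<inter> K) = f ` generate V S'"
      using S S' sub f.generate_img[of S'] by auto
    then have "H \<inter> K = generate V S'"
      using S'(2) sub f(2) V.generate_incl[of S']
      by (subst (asm) inj_on_image_eq_iff[OF f(2)]) auto
    then show "fin_gen_subgroup (H \<inter> K) V"
      using S' sub unfolding fin_gen_subgroup_def by blast
    show "finite {double_coset V H g K |g. g \<in> carrier V \<and> conj_subgroup V H g \<inter> K \<noteq> {\<one>\<^bsub>V\<^esub>}}"
      (is "finite ?D")
    proof (rule finite_imageD)
      have "f ` double_coset V H g K = double_coset G (f ` H) (f g) (f ` K)" if "g \<in> carrier V" for g
        using that sub
      proof (intro equalityI subsetI)
        fix x
        {
          assume "x \<in> f ` double_coset V H g K"
          then obtain h k where hk: "h \<in> H" "k \<in> K" "x = f (h \<otimes>\<^bsub>V\<^esub> g \<otimes>\<^bsub>V\<^esub> k)"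
            by (auto simp: V.mem_double_coset)
          then have "x = f h \<otimes>\<^bsub>G\<^esub> f g \<otimes>\<^bsub>G\<^esub> f k" using that sub by (simp add: subset_iff)
          then show "x \<in> double_coset G (f ` H) (f g) (f ` K)"
            using hk by (auto simp: G.mem_double_coset)
        next
          assume "x \<in> double_coset G (f ` H) (f g) (f ` K)"
          then obtain h k where hk: "h \<in> H" "k \<in> K" "x = f h \<otimes>\<^bsub>G\<^esub> f g \<otimes>\<^bsub>G\<^esub> f k"
            by (auto simp: G.mem_double_coset)
          then have "x = f (h \<otimes>\<^bsub>V\<^esub> g \<otimes>\<^bsub>V\<^esub> k)" using that sub by (simp add: subset_iff)
          then show "x \<in> f ` double_coset V H g K"
            using hk(1,2) by (metis V.mem_double_coset imageI)
        }
      qed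
      note dc = this
      have nt_img: "conj_subgroup G (f ` H) (f g) \<inter> f ` K \<noteq> {\<one>\<^bsub>G\<^esub>}"
        if g: "g \<in> carrier V" and nt: "conj_subgroup V H g \<inter> K \<noteq> {\<one>\<^bsub>V\<^esub>}" for g
      proof -
        obtain c where c: "c \<in> K" "c \<noteq> \<one>\<^bsub>V\<^esub>" "g \<otimes>\<^bsub>V\<^esub> c \<otimes>\<^bsub>V\<^esub> inv\<^bsub>V\<^esub> g \<in> H"
          using nt unfolding V.conj_subgroup_nontrivial[OF HK g] by (elim bexE conjE)
        then have "f c \<noteq> \<one>\<^bsub>G\<^esub>" "f c \<in> f ` K" "f g \<otimes>\<^bsub>G\<^esub> f c \<otimes>\<^bsub>G\<^esub> inv\<^bsub>G\<^esub> (f g) \<in> f ` H"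
          using inv_img[OF g, of c] sub inj_onD[OF f(2), of c "\<one>\<^bsub>V\<^esub>"] by auto
        then show ?thesis
          using G.conj_subgroup_nontrivial[OF f.subgroup_img_is_subgroup[OF HK(1)]
              f.subgroup_img_is_subgroup[OF HK(2)] f.hom_closed[OF g]] by (metis (no_types))
      qed
      have "(`) f ` ?D \<subseteq> {double_coset G (f ` H) g (f ` K) |g. g \<in> carrier G \<and>
          conj_subgroup G (f ` H) g \<inter> f ` K \<noteq> {\<one>\<^bsub>G\<^esub>}}"
      proof clarify
        fix g assume "g \<in> carrier V" "conj_subgroup V H g \<inter> K \<noteq> {\<one>\<^bsub>V\<^esub>}"
        then show "\<exists>g'. f ` double_coset V H g K = double_coset G (f ` H) g' (f ` K) \<and> g' \<in> carrier G \<and>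
          conj_subgroup G (f ` H) g' \<inter> f ` K \<noteq> {\<one>\<^bsub>G\<^esub>}"
          by (intro exI[of _ "f g"] conjI dc nt_img f.hom_closed)
      qed
      then show "finite ((`) f ` ?D)"
        by (rule finite_subset[OF _ sfgipD(2)[OF sf img[OF fg(1)] img[OF fg(2)]]])
      have "double_coset V H g K \<subseteq> carrier V" if "g \<in> carrier V" for g
        using that sub by (auto simp: V.mem_double_coset subset_iff)
      then have "?D \<subseteq> Pow (carrier V)" by auto
      then show "inj_on ((`) f) ?D"
        by (rule inj_on_subset[OF inj_on_image_Pow[OF f(2)]])
    qed
  qed
qed

text \<open>
The finite factor \<open>C\<close> equals all its conjugates, and the double cosets \<open>CgC\<close> are the fibres of the
projection to \<open>\<int>\<close>.
\<close>

lemma not_sfgip_finite_cyclic_times_Z: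
  assumes "k \<ge> 2"
  shows "\<not> sfgip (integer_mod_group k \<times>\<times> integer_group)"
proof
  let ?G = "integer_mod_group k \<times>\<times> integer_group" and ?C = "carrier (integer_mod_group k) \<times> {0::int}"
  assume sf: "sfgip ?G"
  interpret group ?G by (simp add: DirProd_group)
  have invk: "inv\<^bsub>?G\<^esub> (0, n) = (0, - n)" for n
    using assms by (simp add: inv_DirProd carrier_integer_mod_group)
  have "subgroup ?C ?G"
  proof (rule subgroupI)
    show "inv\<^bsub>?G\<^esub> a \<in> ?C" if "a \<in> ?C" for a
      using that by (cases a) (auto simp: inv_DirProd, auto simp: carrier_integer_mod_group)
  qed (use assms in \<open>auto simp: carrier_integer_mod_group\<close>)
  moreover have "finite ?C" using assms by (simp add: carrier_integer_mod_group)
  ultimately have fg: "fin_gen_subgroup ?C ?G" by (rule finite_imp_fin_gen[rotated])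
  let ?d = "\<lambda>n. double_coset ?G ?C (0, n) ?C"
  let ?D = "{double_coset ?G ?C g ?C |g. g \<in> carrier ?G \<and> conj_subgroup ?G ?C g \<inter> ?C \<noteq> {\<one>\<^bsub>?G\<^esub>}}"
  have "?d n \<in> ?D" for n
  proof -
    have "(1, 0) \<in> conj_subgroup ?G ?C (0, n) \<inter> ?C" 
      using assms by (subst Int_iff, subst mem_conj_subgroup) (auto simp: carrier_integer_mod_group invk)
    moreover have "(1, 0) \<noteq> \<one>\<^bsub>?G\<^esub>" by simp
    ultimately have "conj_subgroup ?G ?C (0, n) \<inter> ?C \<noteq> {\<one>\<^bsub>?G\<^esub>}" by blast
    moreover have "(0, n) \<in> carrier ?G" by simp
    ultimately show ?thesis by blast
  qed
  moreover have "inj ?d"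
  proof (rule injI)
    fix n m assume "?d n = ?d m"
    moreover have "(0, n) \<in> ?d n" unfolding mem_double_coset
      using assms by (auto simp: carrier_integer_mod_group intro!: bexI[of _ "(0, 0)"] bexI[of _ 0])
    ultimately show "n = m" by (auto simp: mem_double_coset)
  qed
  ultimately have "infinite ?D"
    using finite_imageD[of ?d UNIV] infinite_UNIV_int finite_subset[of "range ?d" ?D] by blast
  then show False using sfgipD(2)[OF sf fg fg] by blast
qed

text \<open>
The map \<open>(i, j) \<mapsto> c\<^sup>it\<^sup>j\<close> is the required embedding: if \<open>t\<^sup>j\<close> is a power of \<open>c\<close>, then it has finite
order and \<open>j = 0\<close>.
\<close>

lemma (in group) finite_cyclic_times_Z_subgroup:
  assumes c: "c \<in> carrier G" "c \<noteq> \<one>" "finite C" "subgroup C G" "c \<in> C"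
    and t: "t \<in> carrier G" "t \<otimes> c = c \<otimes> t" "\<And>n::nat. n > 0 \<Longrightarrow> t [^] n \<noteq> \<one>"
  shows "\<exists>k::nat. k \<ge> 2 \<and> (\<exists>H. subgroup H G \<and>
    G\<lparr>carrier := H\<rparr> \<cong> integer_mod_group k \<times>\<times> integer_group)"
proof -
  have ordt: "ord t = 0" using t(3)[of "ord t"] pow_ord_eq_1[OF t(1)] by blast
  define k where "k = ord c"
  have "range (\<lambda>n::int. c [^] n) \<subseteq> C"
    using subgroup_int_pow_closed[OF c(4,5)] by auto
  then have "\<not> inj (\<lambda>n::int. c [^] n)"
    using finite_imageD[of "\<lambda>n::int. c [^] n" UNIV] finite_subset[OF _ c(3)] infinite_UNIV_int by metis
  then obtain m n :: int where "m \<noteq> n" "c [^] m = c [^] n" unfolding inj_def by blast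
  then have k0: "k \<noteq> 0" using int_pow_eq[OF c(1), of m n] by (intro notI) (simp add: k_def)
  have "k \<noteq> 1" using ord_eq_1[OF c(1)] c(2) by (simp add: k_def)
  then have k2: "k \<ge> 2" using k0 by simp
  let ?Z = "integer_mod_group k \<times>\<times> integer_group"
  define \<phi> where "\<phi> = (\<lambda>(i::int, j::int). c [^] i \<otimes> t [^] j)"
  have comm_pow: "x [^] (i::int) \<otimes> y = y \<otimes> x [^] i"
    if "x \<otimes> y = y \<otimes> x" "x \<in> carrier G" "y \<in> carrier G" for x y i
  proof (cases "i < 0")
    case True
    let ?p = "x [^] nat (- i)"
    have "?p \<otimes> y = y \<otimes> ?p" by (rule group_commutes_pow[OF that])
    then have "inv ?p \<otimes> (?p \<otimes> y) \<otimes> inv ?p = inv ?p \<otimes> (y \<otimes> ?p) \<otimes> inv ?p" by simp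
    then have "inv ?p \<otimes> y = y \<otimes> inv ?p"
      using that(2,3) by (simp add: m_assoc cancel_inv_left)
    moreover have "x [^] i = inv ?p" using True by (simp only: int_pow_def2 if_True)
    ultimately show ?thesis by (simp only:)
  next
    case False
    then have "x [^] i = x [^] nat i" by (simp only: int_pow_def2 if_False)
    then show ?thesis using group_commutes_pow[OF that] by (simp only:)
  qed
  have comm: "t [^] (j::int) \<otimes> c [^] (i::int) = c [^] i \<otimes> t [^] j" for i j
    by (rule comm_pow[OF comm_pow[OF t(2)[symmetric] c(1) t(1), symmetric]]) (simp_all add: c(1) t(1))
  have cmod: "c [^] (i mod int k) = c [^] i" for i :: int
    using int_pow_eq[OF c(1)] by (simp add: k_def dvd_minus_mod)
  have hom: "\<phi> \<in> hom ?Z G"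
  proof (rule homI)
    fix x y assume "x \<in> carrier ?Z" "y \<in> carrier ?Z"
    obtain i j i' j' where xy: "x = (i, j)" "y = (i', j')" by (cases x, cases y)
    have "\<phi> x \<otimes> \<phi> y = c [^] i \<otimes> (t [^] j \<otimes> c [^] i') \<otimes> t [^] j'"
      using c(1) t(1) by (simp add: \<phi>_def xy m_assoc)
    also have "\<dots> = c [^] (i + i') \<otimes> t [^] (j + j')"
      using c(1) t(1) by (simp add: comm m_assoc int_pow_mult)
    finally show "\<phi> (x \<otimes>\<^bsub>?Z\<^esub> y) = \<phi> x \<otimes> \<phi> y"
      using cmod by (simp add: \<phi>_def xy integer_group_def)
  qed (use c(1) t(1) in \<open>auto simp: \<phi>_def\<close>)
  have inj: "inj_on \<phi> (carrier ?Z)"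
  proof (rule inj_onI)
    fix x y assume xy: "x \<in> carrier ?Z" "y \<in> carrier ?Z" "\<phi> x = \<phi> y"
    obtain i j i' j' where ij: "x = (i, j)" "y = (i', j')" by (cases x, cases y)
    have "t [^] (j - j') = c [^] (i' - i)"
    proof -
      have "c [^] i \<otimes> t [^] j = c [^] i' \<otimes> t [^] j'" using xy ij by (simp add: \<phi>_def)
      then have "inv (c [^] i) \<otimes> (c [^] i \<otimes> t [^] j) = inv (c [^] i) \<otimes> (c [^] i' \<otimes> t [^] j')"
        by simp
      moreover have "c [^] (i' - i) = inv (c [^] i) \<otimes> c [^] i'"
        using int_pow_mult[OF c(1), of "- i" i'] c(1) by (simp add: int_pow_neg)
      ultimately have "t [^] j = c [^] (i' - i) \<otimes> t [^] j'"
        using c(1) t(1) by (simp add: cancel_inv_left m_assoc)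
      then show ?thesis
        using c(1) t(1) by (simp add: int_pow_diff inv_solve_right m_assoc)
    qed
    then have "t [^] ((j - j') * int k) = c [^] ((i' - i) * int k)"
      using c(1) t(1) by (metis int_pow_pow)
    also have "\<dots> = \<one>" using c(1) by (simp add: int_pow_eq_id k_def)
    finally have "j = j'" using t(1) ordt k0 by (simp add: int_pow_eq_id)
    moreover from this have "c [^] i = c [^] i'" using xy ij c(1) t(1) by (simp add: \<phi>_def)
    then have "i' mod int k = i mod int k"
      using int_pow_eq[OF c(1)] by (simp add: k_def mod_eq_dvd_iff)
    then have "i = i'" using xy ij k0 by (simp add: carrier_integer_mod_group)
    ultimately show "x = y" using ij by simp
  qed
  interpret Z: group ?Z by (simp add: DirProd_group)
  interpret \<phi>: group_hom ?Z G \<phi> by unfold_locales fact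
  have "\<phi> \<in> iso ?Z (G\<lparr>carrier := \<phi> ` carrier ?Z\<rparr>)"
    using hom inj by (auto simp: iso_def bij_betw_def hom_def)
  then have "G\<lparr>carrier := \<phi> ` carrier ?Z\<rparr> \<cong> ?Z"
    using Z.iso_sym is_isoI by blast
  then show ?thesis using k2 \<phi>.img_is_subgroup by blast
qed

section \<open>Groups acting on trees\<close>

locale tree_action = group G + tree_graph X adj
  for G (structure) and X :: "'x set" and adj :: "'x \<Rightarrow> 'x \<Rightarrow> bool" +
  fixes act :: "'a \<Rightarrow> 'x \<Rightarrow> 'x" (infixr \<open>\<star>\<close> 75)
  assumes act_closed [simp]: "g \<in> carrier G \<Longrightarrow> x \<in> X \<Longrightarrow> g \<star> x \<in> X"
    and act_one [simp]: "x \<in> X \<Longrightarrow> \<one> \<star> x = x"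
    and act_mult: "g \<in> carrier G \<Longrightarrow> h \<in> carrier G \<Longrightarrow> x \<in> X \<Longrightarrow> (g \<otimes> h) \<star> x = g \<star> h \<star> x"
    and act_adj: "g \<in> carrier G \<Longrightarrow> adj x y \<Longrightarrow> adj (g \<star> x) (g \<star> y)"
begin

lemma act_inv [simp]:
  assumes "g \<in> carrier G" "x \<in> X"
  shows "inv g \<star> g \<star> x = x" "g \<star> inv g \<star> x = x"
  using assms act_mult[of "inv g" g x] act_mult[of g "inv g" x] by simp_all

lemma inv_mult_act:
  assumes "h \<star> x = g \<star> y" "g \<in> carrier G" "h \<in> carrier G" "x \<in> X" "y \<in> X"
  shows "(inv g \<otimes> h) \<star> x = y"
  using assms by (simp add: act_mult)

lemma act_inject:
  "g \<in> carrier G \<Longrightarrow> x \<in> X \<Longrightarrow> y \<in> X \<Longrightarrow> g \<star> x = g \<star> y \<longleftrightarrow> x = y"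
  using act_inv(1) by metis

lemma act_adj_iff:
  "g \<in> carrier G \<Longrightarrow> x \<in> X \<Longrightarrow> y \<in> X \<Longrightarrow> adj (g \<star> x) (g \<star> y) \<longleftrightarrow> adj x y"
  using act_adj[of g x y] act_adj[of "inv g" "g \<star> x" "g \<star> y"] by auto

lemma joined_act:
  assumes "g \<in> carrier G" "jn P x y"
  shows "jn ((\<star>) g ` P) (g \<star> x) (g \<star> y)"
  using joined_image[OF assms(2), of adj "(\<star>) g"] act_adj[OF assms(1)] by blast

lemma subtree_act:
  assumes "g \<in> carrier G" "subtree P"
  shows "subtree ((\<star>) g ` P)"
  using assms joined_act[OF assms(1)] act_closed[OF assms(1)] unfolding subtree_def by blast

definition stab :: "'x \<Rightarrow> 'a set" where
  "stab x = {g \<in> carrier G. g \<star> x = x}"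

lemma stabD: "g \<in> stab x \<Longrightarrow> g \<in> carrier G" "g \<in> stab x \<Longrightarrow> g \<star> x = x"
  by (auto simp: stab_def)

lemma subgroup_stab: "x \<in> X \<Longrightarrow> subgroup (stab x) G"
proof (rule subgroupI)
  assume x: "x \<in> X"
  show "stab x \<noteq> {}" using x one_closed by (auto simp: stab_def)
  show "inv g \<in> stab x" if "g \<in> stab x" for g
    using that act_inv(1)[of g x] x by (auto simp: stab_def)
  show "g \<otimes> h \<in> stab x" if "g \<in> stab x" "h \<in> stab x" for g h
    using that x by (auto simp: stab_def act_mult)
qed (auto simp: stab_def)

definition translates :: "'a set \<Rightarrow> 'x set \<Rightarrow> 'x set" where
  "translates H F = (\<Union>h\<in>H. (\<star>) h ` F)"

lemma mem_translates: "x \<in> translates H F \<longleftrightarrow> (\<exists>h\<in>H. \<exists>y\<in>F. x = h \<star> y)"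
  by (auto simp: translates_def)

lemma translates_act:
  assumes "subgroup H G" "F \<subseteq> X" "h \<in> H" "x \<in> X"
  shows "h \<star> x \<in> translates H F \<longleftrightarrow> x \<in> translates H F"
proof -
  have *: "h \<star> x \<in> translates H F" if x: "x \<in> translates H F" and h: "h \<in> H" for h x
  proof -
    obtain k y where k: "k \<in> H" "y \<in> F" "x = k \<star> y" using x by (auto simp: mem_translates)
    then have "h \<star> x = (h \<otimes> k) \<star> y"
      using h assms(2) subgroup.mem_carrier[OF assms(1)] by (subst act_mult) auto
    then show ?thesis using k h subgroup.m_closed[OF assms(1)] by (auto simp: mem_translates)
  qed
  have "inv h \<star> h \<star> x = x"
    using act_inv(1) subgroup.mem_carrier[OF assms(1,3)] assms(4) .
  then show ?thesis
    using *[of x h] *[of "h \<star> x" "inv h"] assms(3) subgroup.m_inv_closed[OF assms(1,3)] by metis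
qed

lemma translates_incl: "subgroup H G \<Longrightarrow> F \<subseteq> X \<Longrightarrow> F \<subseteq> translates H F"
  unfolding translates_def using act_one[symmetric] subgroup.one_closed[of H G] by blast

lemma translates_subset: "subgroup H G \<Longrightarrow> F \<subseteq> X \<Longrightarrow> translates H F \<subseteq> X"
  unfolding translates_def using subgroup.mem_carrier[of H G] act_closed by blast

subsection \<open>Translates of a finite subtree\<close>

text \<open>
Let \<open>F\<close> contain \<open>v\<close> and its images under the generators of \<open>H\<close>. Then neighbouring translates of \<open>F\<close>
overlap, so the translates form a subtree. The relation \<open>ch\<close> retains only those edges that lie in a single
translate; as these already connect everything, no other edges occur.
\<close>

context
  fixes S H F v
  assumes S: "S \<subseteq> carrier G" and H: "H = generate G S"
    and F: "subtree F" "v \<in> F" "\<And>s. s \<in> S \<Longrightarrow> s \<star> v \<in> F"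
begin

private definition "ch a b \<longleftrightarrow> adj a b \<and> (\<exists>h\<in>H. a \<in> (\<star>) h ` F \<and> b \<in> (\<star>) h ` F)"

private lemma H_sub: "subgroup H G"
  using H generate_is_subgroup S by simp

private lemma F_X: "F \<subseteq> X" using F(1) by (rule subtree_subset)

private lemma H_carrier: "h \<in> H \<Longrightarrow> h \<in> carrier G"
  using H_sub by (rule subgroup.mem_carrier)

private lemma ch_chunk:
  assumes "h \<in> H" "x \<in> F" "y \<in> F"
  shows "joined ch (translates H F) (h \<star> x) (h \<star> y)"
proof (rule joined_subset)
  show "joined ch ((\<star>) h ` F) (h \<star> x) (h \<star> y)"
  proof (rule joined_image[OF subtree_joined[OF F(1) assms(2,3)]])
    show "ch (h \<star> a) (h \<star> b)" if "adj a b" "a \<in> F" "b \<in> F" for a b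
      using that assms(1) H_carrier act_adj by (auto simp: ch_def)
  qed
  show "(\<star>) h ` F \<subseteq> translates H F" using assms(1) by (auto simp: translates_def)
qed

private lemma ch_sym: "joined ch P x y \<Longrightarrow> joined ch P y x"
  by (rule joined_sym) (auto simp: ch_def intro: adj_sym)

private lemma ch_orbit:
  assumes "k \<in> H" "h \<in> H"
  shows "joined ch (translates H F) (h \<star> v) ((h \<otimes> k) \<star> v)"
  using assms(1)[unfolded H] assms(2)
proof (induction arbitrary: h rule: generate.induct)
  case one
  then show ?case using H_carrier by simp
next
  case (incl s)
  then show ?case
    using ch_chunk[OF incl(2) F(2) F(3)[OF incl(1)]] H_carrier S F(2) F_X by (simp add: act_mult subset_iff)
next
  case (inv s)
  have s: "s \<in> carrier G" "s \<in> H" using inv S H by (auto intro: generate.incl)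
  have h': "h \<otimes> inv s \<in> H" "h \<in> carrier G"
    using inv s H_sub by (auto intro: subgroup.m_closed subgroup.m_inv_closed H_carrier)
  have "(h \<otimes> inv s) \<star> s \<star> v = h \<star> v"
    using s h'(2) F(2) F_X by (subst act_mult) (auto simp: subset_iff)
  then show ?case
    using ch_sym[OF ch_chunk[OF h'(1) F(2) F(3)[OF inv(1)]]] by simp
next
  case (eng k1 k2)
  have k: "k1 \<in> H" "k2 \<in> H" using eng H by auto
  then have "joined ch (translates H F) ((h \<otimes> k1) \<star> v) ((h \<otimes> k1 \<otimes> k2) \<star> v)"
    using eng H_sub by (intro eng(4)) (auto intro: subgroup.m_closed)
  moreover have "h \<otimes> k1 \<otimes> k2 = h \<otimes> (k1 \<otimes> k2)" using k eng(5) H_carrier by (simp add: m_assoc)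
  ultimately show ?case using eng(3)[OF eng(5)] by (metis joined_trans)
qed

private lemma ch_root:
  assumes "x \<in> translates H F"
  shows "joined ch (translates H F) v x"
proof -
  obtain h y where h: "h \<in> H" "y \<in> F" "x = h \<star> y" using assms by (auto simp: mem_translates)
  have "joined ch (translates H F) (\<one> \<star> v) ((\<one> \<otimes> h) \<star> v)"
    by (rule ch_orbit[OF h(1) subgroup.one_closed[OF H_sub]])
  then have "joined ch (translates H F) v (h \<star> v)"
    using h(1) H_carrier F(2) F_X by (simp add: subset_iff)
  then show ?thesis using ch_chunk[OF h(1) F(2) h(2)] h(3) by (metis joined_trans)
qed

lemma translates_subtree: "subtree (translates H F)"
proof (rule subtreeI_root[of _ v])
  show "translates H F \<subseteq> X" by (rule translates_subset[OF H_sub F_X])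
  show "jn (translates H F) v x" if "x \<in> translates H F" for x
    using ch_root[OF that] by (rule joined_mono) (auto simp: ch_def)
qed

lemma translates_edge:
  assumes "x \<in> translates H F" "y \<in> translates H F" "adj x y"
  shows "\<exists>h\<in>H. \<exists>a\<in>F. \<exists>b\<in>F. x = h \<star> a \<and> y = h \<star> b"
proof -
  have "joined ch (translates H F) x y"
    using ch_root[OF assms(1)] ch_root[OF assms(2)] by (meson joined_trans ch_sym)
  then have "joined ch X x y" by (rule joined_subset) (rule translates_subset[OF H_sub F_X])
  then have "ch x y" by (rule spanning_edge) (auto simp: ch_def assms)
  then show ?thesis by (auto simp: ch_def)
qed

end

subsection \<open>Finite generation from a cofinite action\<close>

text \<open>
Let \<open>W\<close> be a finite set of vertices that contains representatives of the edges. The elements of \<open>J\<close> which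
carry some vertex of \<open>W\<close> to a vertex of \<open>W\<close> generate a subgroup \<open>L\<close>, which is finitely generated since
\<open>W\<close> is finite and stabilizers are finitely generated. The \<open>L\<close>-translates of \<open>W\<close> are closed under adjacency,
so they exhaust \<open>Y\<close>; this forces \<open>L = J\<close>.
\<close>

lemma fin_gen_from_action:
  assumes J: "subgroup J G" and Y: "subtree Y" "v \<in> Y" "\<And>j y. j \<in> J \<Longrightarrow> y \<in> Y \<Longrightarrow> j \<star> y \<in> Y"
    and E: "finite E" "\<And>a b. (a, b) \<in> E \<Longrightarrow> a \<in> Y \<and> b \<in> Y"
      "\<And>x y. x \<in> Y \<Longrightarrow> y \<in> Y \<Longrightarrow> adj x y \<Longrightarrow> \<exists>j\<in>J. \<exists>(a, b)\<in>E. x = j \<star> a \<and> y = j \<star> b"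
    and st: "\<And>y. y \<in> Y \<Longrightarrow> fin_gen_subgroup (J \<inter> stab y) G"
  shows "fin_gen_subgroup J G"
proof -
  define W where "W = insert v (fst ` E \<union> snd ` E)"
  have W: "finite W" "W \<subseteq> Y" using E(1,2) Y(2) by (auto simp: W_def)
  have WX: "x \<in> W \<Longrightarrow> x \<in> X" for x using W(2) subtree_subset[OF Y(1)] by blast
  note Jc = subgroup.mem_carrier[OF J]
  have "\<forall>x\<in>W. \<exists>S. finite S \<and> J \<inter> stab x = generate G S"
    using st W(2) unfolding fin_gen_subgroup_def by blast
  then obtain S where S: "\<And>x. x \<in> W \<Longrightarrow> finite (S x) \<and> J \<inter> stab x = generate G (S x)"
    by metis
  have "\<exists>r. r \<in> J \<and> ((\<exists>j\<in>J. j \<star> x = x') \<longrightarrow> r \<star> x = x')" for x x'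
    using subgroup.one_closed[OF J] by blast
  then obtain r where r: "\<And>x x'. r x x' \<in> J" "\<And>x x' j. j \<in> J \<Longrightarrow> j \<star> x = x' \<Longrightarrow> r x x' \<star> x = x'"
    by metis
  define T where "T = (\<Union>x\<in>W. S x) \<union> (\<lambda>(x, x'). r x x') ` (W \<times> W)"
  define L where "L = generate G T"
  have "S x \<subseteq> J" if "x \<in> W" for x using S[OF that] generate.incl[of _ "S x" G] by blast
  then have T: "finite T" "T \<subseteq> J" using W(1) S r(1) by (auto simp: T_def)
  have L: "subgroup L G"
    unfolding L_def using T(2) subgroup.subset[OF J] by (intro generate_is_subgroup) blast
  have key: "j \<in> L" if j: "j \<in> J" "x \<in> W" "j \<star> x \<in> W" for j x
  proof -
    let ?r = "r x (j \<star> x)"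
    have "inv ?r \<otimes> j \<in> J \<inter> stab x"
    proof (intro IntI)
      show "inv ?r \<otimes> j \<in> J"
        by (intro subgroup.m_closed[OF J] subgroup.m_inv_closed[OF J] r(1) j(1))
      have "(inv ?r \<otimes> j) \<star> x = inv ?r \<star> j \<star> x"
        using Jc[OF j(1)] Jc[OF r(1)] WX[OF j(2)] by (intro act_mult) simp_all
      also have "\<dots> = inv ?r \<star> ?r \<star> x" using r(2)[OF j(1) refl, of x] by simp
      finally show "inv ?r \<otimes> j \<in> stab x"
        using Jc[OF j(1)] Jc[OF r(1)] WX[OF j(2)] by (simp add: stab_def)
    qed
    then have "inv ?r \<otimes> j \<in> L"
      using S[OF j(2)] mono_generate[of "S x" T] j(2) by (auto simp: L_def T_def)
    moreover have "?r \<in> L" unfolding L_def T_def using j by (intro generate.incl) auto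
    ultimately have "?r \<otimes> (inv ?r \<otimes> j) \<in> L" using L by (simp add: subgroup.m_closed)
    then show ?thesis using j(1) r(1) Jc by (simp add: cancel_inv_left)
  qed
  have LJ: "L \<subseteq> J" unfolding L_def using generate_subgroup_incl[OF T(2) J] .
  note Lc = subgroup.mem_carrier[OF L]
  have cover: "\<exists>l\<in>L. \<exists>x\<in>W. y = l \<star> x" if "y \<in> Y" for y
    using subtree_joined[OF Y(1,2) that] unfolding joined_def
  proof (induction rule: rtranclp_induct)
    case base
    show ?case using subgroup.one_closed[OF L] WX[of v] by (intro bexI[of _ \<one>] bexI[of _ v]) (auto simp: W_def)
  next
    case (step y z)
    obtain l x where l: "l \<in> L" "x \<in> W" "y = l \<star> x" using step by blast
    obtain j a b where j: "j \<in> J" "(a, b) \<in> E" "y = j \<star> a" "z = j \<star> b"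
      using E(3)[of y z] step by blast
    have ab: "a \<in> W" "b \<in> W" using j(2) by (force simp: W_def)+
    have "inv l \<otimes> j \<in> J" using l j LJ J by (auto intro: subgroup.m_closed subgroup.m_inv_closed)
    moreover have "(inv l \<otimes> j) \<star> a = x"
      using l j by (intro inv_mult_act Lc Jc WX ab) simp_all
    ultimately have "inv l \<otimes> j \<in> L" using key[of "inv l \<otimes> j" a] ab l by simp
    then have "l \<otimes> (inv l \<otimes> j) \<in> L" using L l by (simp add: subgroup.m_closed)
    then have "j \<in> L" using l j Jc Lc by (simp add: cancel_inv_left)
    then show ?case using j ab by blast
  qed
  have "J \<subseteq> L"
  proof
    fix j assume j: "j \<in> J"
    have v: "v \<in> W" by (simp add: W_def)
    obtain l x where l: "l \<in> L" "x \<in> W" "j \<star> v = l \<star> x" using cover[OF Y(3)[OF j Y(2)]] by blast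
    have "inv l \<otimes> j \<in> J" using l j LJ J by (auto intro: subgroup.m_closed subgroup.m_inv_closed)
    moreover have "(inv l \<otimes> j) \<star> v = x"
      using l j by (intro inv_mult_act Lc Jc WX v) simp_all
    ultimately have "inv l \<otimes> j \<in> L" using key[of "inv l \<otimes> j" v] v l by simp
    then have "l \<otimes> (inv l \<otimes> j) \<in> L" using L l by (simp add: subgroup.m_closed)
    then show "j \<in> L" using l j Jc Lc by (simp add: cancel_inv_left)
  qed
  then show ?thesis unfolding L_def by (rule fin_gen_subgroupI[OF T J])
qed

text \<open>
A shortest path from \<open>P\<close> to \<open>Q\<close> enters, edge by edge, the invariant subtrees obtained from \<open>P\<close> by
adjoining its initial segments; at each stage \<open>gate_unique\<close> shows that the next edge is fixed. A path of
length \<open>0\<close> means that \<open>P\<close> and \<open>Q\<close> meet, and then its vertex need not be fixed.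
\<close>

lemma fixed_bridge:
  assumes c: "c \<in> carrier G" and P: "subtree P" "p \<in> P" "\<And>x. x \<in> X \<Longrightarrow> c \<star> x \<in> P \<longleftrightarrow> x \<in> P"
    and Q: "subtree Q" "q \<in> Q" "\<And>x. x \<in> X \<Longrightarrow> c \<star> x \<in> Q \<longleftrightarrow> x \<in> Q"
  obtains f :: "nat \<Rightarrow> 'x" and n where "f 0 \<in> P" "f n \<in> Q" "\<And>i. i < n \<Longrightarrow> adj (f i) (f (Suc i))"
    "inj_on f {..n}" "\<And>i. n > 0 \<Longrightarrow> i \<le> n \<Longrightarrow> c \<star> f i = f i"
proof -
  obtain f :: "nat \<Rightarrow> 'x" and n where f: "f 0 \<in> P" "f n \<in> Q" "\<And>i. i < n \<Longrightarrow> adj (f i) (f (Suc i))"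
    "\<And>i. 0 < i \<Longrightarrow> i \<le> n \<Longrightarrow> f i \<notin> P" "\<And>i. i < n \<Longrightarrow> f i \<notin> Q" "inj_on f {..n}"
    "n > 0 \<Longrightarrow> P \<inter> Q = {}"
    using shortest_path[OF P(2) Q(2) subtree_subset[OF P(1)] subtree_subset[OF Q(1)]] by blast
  have fX: "f i \<in> X" if "i \<le> n" for i
    using that f(2) f(3)[of i] adj_in subtree_subset[OF Q(1)] by (cases "i = n") auto
  have main: "subtree (P \<union> f ` {1..i}) \<and> (\<forall>j\<le>i. i > 0 \<longrightarrow> c \<star> f j = f j)" if "i \<le> n" for i
    using that
  proof (induction i)
    case 0
    then show ?case using P(1) by simp
  next
    case (Suc i)
    define P' where "P' = P \<union> f ` {1..i}"
    have IH: "subtree P'" "\<And>j. i > 0 \<Longrightarrow> j \<le> i \<Longrightarrow> c \<star> f j = f j"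
      using Suc by (auto simp: P'_def)
    have cP': "c \<star> x \<in> P' \<longleftrightarrow> x \<in> P'" if x: "x \<in> X" for x
    proof -
      have "c \<star> x \<in> f ` {1..i} \<longleftrightarrow> x \<in> f ` {1..i}"
      proof -
        have "c \<star> x = f j \<longleftrightarrow> x = f j" if "j \<in> {1..i}" for j
          using IH(2)[of j] act_inject[OF c x fX[of j]] that Suc.prems by simp
        then show ?thesis unfolding image_iff by metis
      qed
      then show ?thesis using P(3)[OF x] by (auto simp: P'_def)
    qed
    have fi: "f i \<in> P'" using f(1) by (cases i) (auto simp: P'_def)
    have off: "f j \<notin> P'" if "Suc i \<le> j" "j \<le> n" for j
    proof -
      have "f j \<noteq> f k" if "k \<le> i" for k
        using inj_onD[OF f(6), of j k] that \<open>Suc i \<le> j\<close> \<open>j \<le> n\<close> by auto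
      then have "f j \<notin> f ` {1..i}" by fastforce
      then show ?thesis using that f(4)[of j] by (simp add: P'_def)
    qed
    have path: "jn (X - P') (f (Suc i)) (f j)" if "Suc i \<le> j" "j \<le> n" for j
      using that
    proof (induction j rule: dec_induct)
      case (step j)
      have "jn (X - P') (f j) (f (Suc j))"
        using step off[of j] off[of "Suc j"] f(3)[of j] fX by (intro joined_edge) auto
      then show ?case using step by (meson Suc_leD joined_trans)
    qed simp
    have QP': "Q \<subseteq> X - P'"
    proof
      fix y assume y: "y \<in> Q"
      have "y \<notin> P" using f(7) y Suc.prems by auto
      then show "y \<in> X - P'"
        using y f(5) Suc.prems subtree_subset[OF Q(1)] by (auto simp: P'_def)
    qed
    have adjs: "adj (f i) (f (Suc i))" using f(3) Suc.prems by simp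
    have j1: "jn (X - P') (f (Suc i)) (f n)" using path Suc.prems by simp
    have "jn ((\<star>) c ` (X - P')) (c \<star> f (Suc i)) (c \<star> f n)" using joined_act[OF c j1] .
    then have "jn (X - P') (c \<star> f (Suc i)) (c \<star> f n)"
      by (rule joined_subset) (use cP' c in auto)
    moreover have "jn (X - P') (c \<star> f n) (f n)"
      using joined_subset[OF subtree_joined[OF Q(1)] QP', of "c \<star> f n" "f n"] Q(3)[OF fX[of n]] f(2) by simp
    ultimately have j2: "jn (X - P') (c \<star> f (Suc i)) (f n)" by (rule joined_trans)
    have "f i = c \<star> f i \<and> f (Suc i) = c \<star> f (Suc i)"
      by (rule gate_unique[OF IH(1) fi adjs off _ act_adj[OF c adjs] _ j1 j2])
        (use Suc.prems fi cP' fX off in auto)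
    then have "c \<star> f j = f j" if "j \<le> Suc i" for j
      using IH(2)[of j] that by (cases "j = Suc i"; cases "j = i") auto
    then have "\<forall>j\<le>Suc i. c \<star> f j = f j" by blast
    moreover have "subtree (P' \<union> {f (Suc i)})"
      using adjs fi by (intro subtree_Un_nbrs[OF IH(1)]) auto
    moreover have "P' \<union> {f (Suc i)} = P \<union> f ` {1..Suc i}" by (auto simp: P'_def atLeastAtMostSuc_conv)
    ultimately show ?case by simp
  qed
  show ?thesis using that[of f n] f main[of n] by blast
qed

end

section \<open>Finite edge stabilizers\<close>

text \<open>
An edge is an ordered pair of adjacent vertices, and its stabilizer fixes both ends.
\<close>

locale tree_action_finite_edges = tree_action +
  assumes finite_edge_stab: "adj x y \<Longrightarrow> finite (stab x \<inter> stab y)"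
begin

lemma finite_movers:
  assumes "adj x y"
  shows "finite {g \<in> carrier G. g \<star> x = x' \<and> g \<star> y = y'}" (is "finite ?M")
proof (cases "?M = {}")
  case True
  then show ?thesis by (simp only: finite.emptyI)
next
  case False
  then obtain g0 where g0: "g0 \<in> carrier G" "g0 \<star> x = x'" "g0 \<star> y = y'" by blast
  have "?M \<subseteq> (\<lambda>u. g0 \<otimes> u) ` (stab x \<inter> stab y)"
  proof
    fix g assume g: "g \<in> ?M"
    have "inv g0 \<otimes> g \<in> stab x \<inter> stab y"
      using g g0 adj_in[OF assms] by (auto simp: stab_def intro: inv_mult_act)
    moreover have "g = g0 \<otimes> (inv g0 \<otimes> g)" using g g0 by (simp add: cancel_inv_left)
    ultimately show "g \<in> (\<lambda>u. g0 \<otimes> u) ` (stab x \<inter> stab y)" by blast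
  qed
  then show ?thesis using finite_edge_stab[OF assms] finite_surj by blast
qed

text \<open>
Let \<open>H = \<langle>S\<rangle>\<close> with \<open>S = S\<^sup>-\<^sup>1\<close>, and let \<open>F\<close> be a finite subtree containing \<open>v\<close> and \<open>Sv\<close>. Transporting
to \<open>v\<close> the edges of \<open>F\<close> that start in the orbit of \<open>v\<close> gives a finite set \<open>E\<close> of neighbours of \<open>v\<close>. Let
\<open>L\<close> be generated by the elements of \<open>H\<^sub>v\<close> that move some element of \<open>E\<close> into \<open>E\<close>, finitely many since edge
stabilizers are finite, and by the finitely many elements of \<open>H\<^sub>v\<close> which compare a generator \<open>s\<close> with the chosen
element carrying \<open>v\<close> to \<open>sv\<close>. Seen from \<open>v\<close>, the translates \<open>hF\<close> lie in directions
belonging to \<open>H\<^sub>vE\<close>, and the \<open>L\<close>-coset of the direction is the same for all points of \<open>hF\<close> and does not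
change when \<open>h\<close> is multiplied by a generator. So it is always the trivial coset, and for \<open>h\<close> in \<open>H\<^sub>v\<close> this says
\<open>h \<in> L\<close>.
\<close>

lemma stab_fin_gen:
  assumes fg: "fin_gen_subgroup H G" and v: "v \<in> X"
  shows "fin_gen_subgroup (H \<inter> stab v) G"
proof -
  obtain S0 where S0: "finite S0" "S0 \<subseteq> carrier G" "H = generate G S0"
    using fg by (auto simp: fin_gen_subgroup_def)
  define S where "S = S0 \<union> m_inv G ` S0"
  have "S \<subseteq> generate G S0" by (auto simp: S_def intro: generate.incl generate.inv)
  then have S: "finite S" "S \<subseteq> carrier G" "H = generate G S"
    using S0 generate_subgroup_incl[OF _ generate_is_subgroup[OF S0(2)], of S] mono_generate[of S0 S]
    by (auto simp: S_def)
  have S_inv: "inv s \<in> S" if "s \<in> S" for s using that S0(2) by (auto simp: S_def)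
  have H: "subgroup H G" using fg by (rule fin_gen_imp_subgroup)
  note Hc = subgroup.mem_carrier[OF H]
  have SH: "s \<in> H" if "s \<in> S" for s using that S(3) by (simp add: generate.incl)
  have "(\<lambda>s. s \<star> v) ` S \<subseteq> X" using S(2) v by auto
  then obtain F where F: "finite F" "subtree F" "v \<in> F" "(\<lambda>s. s \<star> v) ` S \<subseteq> F"
    using finite_subtree[OF finite_imageI[OF S(1)] _ v] by metis
  have FX: "x \<in> F \<Longrightarrow> x \<in> X" for x using F(2) subtree_subset by blast
  define r where "r u = (if u = v then \<one> else if \<exists>h\<in>H. h \<star> v = u then SOME h. h \<in> H \<and> h \<star> v = u else \<one>)" for u
  have rv: "r v = \<one>" by (simp add: r_def)
  have r2: "r (h \<star> v) \<in> H \<and> r (h \<star> v) \<star> v = h \<star> v" if "h \<in> H" for h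
  proof (cases "h \<star> v = v")
    case True
    then show ?thesis using v subgroup.one_closed[OF H] by (simp add: rv)
  next
    case False
    have "\<exists>k. k \<in> H \<and> k \<star> v = h \<star> v" using that by blast
    then have "(SOME k. k \<in> H \<and> k \<star> v = h \<star> v) \<in> H \<and> (SOME k. k \<in> H \<and> k \<star> v = h \<star> v) \<star> v = h \<star> v"
      by (rule someI_ex)
    moreover have "r (h \<star> v) = (SOME k. k \<in> H \<and> k \<star> v = h \<star> v)" using False that by (auto simp: r_def)
    ultimately show ?thesis by simp
  qed
  have rH: "r u \<in> H" for u
  proof (cases "\<exists>h\<in>H. h \<star> v = u")
    case True
    then show ?thesis using r2 by auto
  next
    case False
    then show ?thesis using subgroup.one_closed[OF H] by (simp add: r_def)
  qed
  define E where "E = {inv (r u) \<star> w | u w. u \<in> F \<and> w \<in> F \<and> adj u w \<and> r u \<star> v = u}"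
  have "E \<subseteq> (\<lambda>(u, w). inv (r u) \<star> w) ` (F \<times> F)" by (auto simp: E_def)
  then have E: "finite E" using F(1) by (meson finite_SigmaI finite_surj)
  have Eadj: "adj v e" if "e \<in> E" for e
  proof -
    obtain u w where u: "e = inv (r u) \<star> w" "u \<in> F" "w \<in> F" "adj u w" "r u \<star> v = u"
      using \<open>e \<in> E\<close> by (auto simp: E_def)
    have "inv (r u) \<star> u = v" using u(5) act_inv(1)[OF Hc[OF rH[of u]] v] by simp
    then show ?thesis using act_adj[OF inv_closed[OF Hc[OF rH[of u]]] u(4)] u(1) by simp
  qed
  define A where "A = {a \<in> H \<inter> stab v. \<exists>e\<in>E. a \<star> e \<in> E}"
  have "A \<subseteq> (\<Union>e\<in>E. \<Union>e'\<in>E. {g \<in> carrier G. g \<star> v = v \<and> g \<star> e = e'})"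
    by (auto simp: A_def stab_def)
  moreover have "finite (\<Union>e\<in>E. \<Union>e'\<in>E. {g \<in> carrier G. g \<star> v = v \<and> g \<star> e = e'})"
    using E Eadj by (intro finite_UN_I finite_movers)
  ultimately have A: "finite A" by (rule finite_subset)
  define T where "T = A \<union> (\<lambda>s. inv (r (s \<star> v)) \<otimes> s) ` S"
  have Hv: "subgroup (H \<inter> stab v) G" by (rule subgroups_Inter_pair[OF H subgroup_stab[OF v]])
  have T: "finite T" "T \<subseteq> H \<inter> stab v"
  proof -
    show "finite T" using A S(1) by (simp add: T_def)
    have "inv (r (s \<star> v)) \<otimes> s \<in> H \<inter> stab v" if "s \<in> S" for s
    proof (intro IntI)
      show "inv (r (s \<star> v)) \<otimes> s \<in> H"
        by (intro subgroup.m_closed[OF H] subgroup.m_inv_closed[OF H] rH SH that)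
      then show "inv (r (s \<star> v)) \<otimes> s \<in> stab v"
        using inv_mult_act[of s v "r (s \<star> v)" v] r2[OF SH[OF that]] Hc SH[OF that] v
        by (simp add: stab_def)
    qed
    then show "T \<subseteq> H \<inter> stab v" by (auto simp: T_def A_def)
  qed
  define L where "L = generate G T"
  have LHv: "L \<subseteq> H \<inter> stab v" unfolding L_def by (rule generate_subgroup_incl[OF T(2) Hv])
  have L: "subgroup L G" unfolding L_def using T(2) Hc by (intro generate_is_subgroup) blast
  note Lc = subgroup.mem_carrier[OF L]
  have TL: "t \<in> L" if "t \<in> T" for t using that by (simp add: L_def generate.incl)
  define D where "D w x \<longleftrightarrow> adj v w \<and> jn (X - {v}) w x" for w x
  \<comment> \<open>The invariant: seen from \<open>v\<close>, the point \<open>hx\<close> lies in a direction from \<open>LE\<close>; if \<open>hx\<close> is \<open>v\<close> itself, then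
    \<open>h\<close> followed by the chosen transport back to \<open>v\<close> lies in \<open>L\<close>.\<close>
  define good where "good h x \<longleftrightarrow> (if h \<star> x = v then h \<otimes> r x \<in> L else \<exists>l\<in>L. \<exists>e\<in>E. D (l \<star> e) (h \<star> x))" for h x
  \<comment> \<open>The invariant spreads over a translate. If \<open>hF\<close> misses \<open>v\<close> there is one direction only. Otherwise all
    directions belong to \<open>bE\<close> for one \<open>b\<close> in \<open>H\<^sub>v\<close>, and a single good point already gives \<open>b \<in> L\<close>.\<close>
  have spread: "good h y" if h: "h \<in> H" and x: "x \<in> F" "good h x" and y: "y \<in> F" for h x y
  proof (cases "\<exists>u\<in>F. h \<star> u = v")
    case False
    have "jn ((\<star>) h ` F) (h \<star> x) (h \<star> y)" by (rule joined_act[OF Hc[OF h] subtree_joined[OF F(2) x(1) y]])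
    then have "jn (X - {v}) (h \<star> x) (h \<star> y)"
      by (rule joined_subset) (use False FX Hc[OF h] in auto)
    then show ?thesis using False x y by (auto simp: good_def D_def intro: joined_trans)
  next
    case True
    then obtain u where u: "u \<in> F" "h \<star> u = v" by blast
    have "u = inv h \<star> v" using u FX Hc[OF h] by auto
    then have ru: "r u \<star> v = u" using r2[of "inv h"] subgroup.m_inv_closed[OF H h] by simp
    have only_u: "z = u" if "z \<in> F" "h \<star> z = v" for z
      using that u act_inject[OF Hc[OF h] FX FX, of z u] by simp
    define b where "b = h \<otimes> r u"
    have b: "b \<in> H \<inter> stab v"
      using subgroup.m_closed[OF H h rH[of u]] ru u(2) Hc[OF h] Hc[OF rH[of u]] v
      by (simp add: b_def stab_def act_mult)
    have dir: "\<exists>e\<in>E. D (b \<star> e) (h \<star> z)" if z: "z \<in> F" "h \<star> z \<noteq> v" for z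
    proof -
      have "z \<noteq> u" using z u by blast
      then obtain w where w: "adj u w" "w \<in> F" "jn (F - {u}) w z"
        using joined_exit[OF subtree_joined[OF F(2) u(1) z(1)], of "{u}"] by auto
      have e: "inv (r u) \<star> w \<in> E" using w u ru by (auto simp: E_def)
      have be: "b \<star> inv (r u) \<star> w = h \<star> w"
        using Hc[OF h] Hc[OF rH[of u]] FX[OF w(2)] by (simp add: b_def act_mult)
      have "jn ((\<star>) h ` (F - {u})) (h \<star> w) (h \<star> z)" by (rule joined_act[OF Hc[OF h] w(3)])
      then have "jn (X - {v}) (h \<star> w) (h \<star> z)"
        by (rule joined_subset) (use only_u FX Hc[OF h] in auto)
      moreover have "adj v (h \<star> w)" using act_adj[OF Hc[OF h] w(1)] u(2) by simp
      ultimately have "D (b \<star> inv (r u) \<star> w) (h \<star> z)" by (simp add: D_def be)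
      then show ?thesis using e by blast
    qed
    have "b \<in> L"
    proof (cases "h \<star> x = v")
      case True
      then have "x = u" using only_u x(1) by simp
      then show ?thesis using x(2) True by (simp add: good_def b_def)
    next
      case False
      obtain l e where l: "l \<in> L" "e \<in> E" "D (l \<star> e) (h \<star> x)" using x(2) False by (auto simp: good_def)
      obtain e' where e': "e' \<in> E" "D (b \<star> e') (h \<star> x)" using dir[OF x(1) False] by blast
      have "b \<star> e' = l \<star> e"
        using acyclic[of v "b \<star> e'" "l \<star> e"] e'(2) l(3) unfolding D_def by (meson joined_trans jn_sym)
      moreover have bc: "b \<in> carrier G" "e \<in> X" "e' \<in> X"
        using b Hc adj_in[OF Eadj[OF l(2)]] adj_in[OF Eadj[OF e'(1)]] by auto
      ultimately have "(inv l \<otimes> b) \<star> e' = e" using Lc[OF l(1)] by (intro inv_mult_act)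
      moreover have "inv l \<otimes> b \<in> H \<inter> stab v"
        using l(1) LHv b by (intro subgroup.m_closed[OF Hv] subgroup.m_inv_closed[OF Hv]) auto
      ultimately have "inv l \<otimes> b \<in> A" using e'(1) l(2) by (auto simp: A_def)
      then have "l \<otimes> (inv l \<otimes> b) \<in> L" by (intro subgroup.m_closed[OF L l(1)] TL) (simp add: T_def)
      then show ?thesis using bc(1) Lc[OF l(1)] by (simp add: cancel_inv_left)
    qed
    then show ?thesis using dir[OF y] only_u[OF y] by (auto simp: good_def b_def)
  qed
  \<comment> \<open>Consecutive translates \<open>hF\<close> and \<open>hsF\<close> share the point \<open>hsv\<close>.\<close>
  have gen: "\<forall>h\<in>H. (\<forall>x\<in>F. good h x) \<longrightarrow> (\<forall>x\<in>F. good (h \<otimes> s) x)" if s0: "s \<in> S" for s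
  proof -
    have s: "s \<in> carrier G" "s \<in> H" "s \<star> v \<in> F" using s0 S(2) SH F(4) by auto
    show ?thesis
    proof (intro ballI impI)
      fix h x assume h: "h \<in> H" "\<forall>x\<in>F. good h x" and x: "x \<in> F"
      have eq: "(h \<otimes> s) \<star> v = h \<star> s \<star> v" using Hc[OF h(1)] s v by (simp add: act_mult)
      have g: "good h (s \<star> v)" using h s by blast
      have "good (h \<otimes> s) v"
      proof (cases "h \<star> s \<star> v = v")
        case True
        have "inv (r (s \<star> v)) \<otimes> s \<in> L" by (rule TL) (use s0 in \<open>auto simp: T_def\<close>)
        moreover have "h \<otimes> r (s \<star> v) \<in> L" using g True by (simp add: good_def)
        ultimately have "h \<otimes> r (s \<star> v) \<otimes> (inv (r (s \<star> v)) \<otimes> s) \<in> L"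
          using subgroup.m_closed[OF L] by blast
        then have "h \<otimes> s \<in> L" using Hc[OF h(1)] Hc[OF rH[of "s \<star> v"]] s(1) by (simp add: m_assoc cancel_inv_left)
        then show ?thesis using True eq Hc[OF h(1)] s(1) by (simp add: good_def rv)
      next
        case False
        then show ?thesis using g by (simp add: good_def eq)
      qed
      then show "good (h \<otimes> s) x" using spread[OF subgroup.m_closed[OF H h(1) s(2)] F(3) _ x] by simp
    qed
  qed
  have step: "\<forall>h\<in>H. (\<forall>x\<in>F. good h x) \<longrightarrow> (\<forall>x\<in>F. good (h \<otimes> k) x)" if "k \<in> generate G S" for k
    using that
  proof (induction rule: generate.induct)
    case one
    then show ?case using Hc by simp
  next
    case (incl s)
    then show ?case by (rule gen)
  next
    case (inv s)
    then show ?case by (intro gen S_inv)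
  next
    case (eng k1 k2)
    show ?case
    proof (intro ballI impI)
      fix h x assume h: "h \<in> H" "\<forall>x\<in>F. good h x" and x: "x \<in> F"
      have k: "k1 \<in> H" "k2 \<in> H" using eng S(3) by auto
      have "\<forall>x\<in>F. good (h \<otimes> k1) x" using eng(3) h by blast
      then have "good (h \<otimes> k1 \<otimes> k2) x" using eng(4) subgroup.m_closed[OF H h(1) k(1)] x by blast
      then show "good (h \<otimes> (k1 \<otimes> k2)) x" using h(1) k Hc by (simp add: m_assoc)
    qed
  qed
  have "good \<one> v" using v subgroup.one_closed[OF L] by (simp add: good_def rv)
  then have g1: "\<forall>x\<in>F. good \<one> x" using spread[OF subgroup.one_closed[OF H] F(3)] by blast
  have "H \<inter> stab v \<subseteq> L"
  proof
    fix h assume h: "h \<in> H \<inter> stab v"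
    then have "good (\<one> \<otimes> h) v" using step[of h] S(3) g1 F(3) subgroup.one_closed[OF H] by blast
    then show "h \<in> L" using h Hc by (simp add: good_def stab_def rv)
  qed
  then show ?thesis unfolding L_def by (rule fin_gen_subgroupI[OF T Hv])
qed

end

context tree_action
begin

text \<open>
Let \<open>D a b\<close> be the half-tree beyond the edge from \<open>a\<close> to \<open>b\<close>. The half-tree beyond the later edge lies inside
the one beyond the earlier edge, and \<open>t\<close> maps the larger onto the smaller. So the positive powers of \<open>t\<close> move \<open>f j\<close>
into a half-tree that does not contain it.
\<close>

lemma translation_infinite_order:
  assumes t: "t \<in> carrier G" and f: "\<And>i. i \<le> j \<Longrightarrow> adj (f i) (f (Suc i))" "inj_on f {..Suc j}"
    and ij: "i < j" "t \<star> f i = f j" "t \<star> f (Suc i) = f (Suc j)" and n: "n > (0::nat)"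
  shows "t [^] n \<noteq> \<one>"
proof -
  define D where "D a b = {z. jn (X - {a}) b z}" for a b
  have fX: "f k \<in> X" if "k \<le> Suc j" for k
    using that f(1)[of k] f(1)[of j] adj_in by (cases "k = Suc j") auto
  have ne: "f k \<noteq> f l" if "k \<le> Suc j" "l \<le> Suc j" "k \<noteq> l" for k l
    using inj_onD[OF f(2), of k l] that by auto
  have path: "jn (X - {f m}) (f k) (f l)" if "k \<le> l" "l \<le> Suc j" "m \<le> Suc j" "m < k \<or> l < m" for k l m
    using that
  proof (induction l rule: dec_induct)
    case (step l)
    have "jn (X - {f m}) (f l) (f (Suc l))"
      using step f(1)[of l] fX[of l] fX[of "Suc l"] ne[of l m] ne[of "Suc l" m] by (intro joined_edge) auto
    then show ?case using step by (meson Suc_leD Suc_lessD joined_trans)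
  qed simp
  have a_notin: "f i \<notin> D (f j) (f (Suc j))"
  proof
    assume "f i \<in> D (f j) (f (Suc j))"
    then have "jn (X - {f j}) (f (Suc j)) (f i)" by (simp add: D_def)
    moreover have "jn (X - {f j}) (f i) (f (j - 1))" using path[of i "j - 1" j] ij by auto
    ultimately have "f (Suc j) = f (j - 1)"
      using acyclic[of "f j" "f (Suc j)" "f (j - 1)"] f(1)[of j] adj_sym[OF f(1)[of "j - 1"]] ij
      by (auto intro: joined_trans)
    moreover have "f (Suc j) \<noteq> f (j - 1)" by (rule ne) auto
    ultimately show False by contradiction
  qed
  have nested: "z \<in> D (f i) (f (Suc i))" if z: "z \<in> D (f j) (f (Suc j))" for z
  proof -
    have "jn (X - {f j}) (f (Suc j)) z" using z by (simp add: D_def)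
    then have "jn (X - {f i}) (f (Suc j)) z"
      unfolding joined_def[of adj "X - {f j}"]
    proof (induction rule: rtranclp_induct)
      case (step y z)
      have *: "jn (X - {f j}) (f (Suc j)) y" "jn (X - {f j}) (f (Suc j)) z"
        using step(1,2) rtranclp.rtrancl_into_rtrancl[OF step(1,2)] unfolding joined_def by auto
      then have "y \<noteq> f i" "z \<noteq> f i" using a_notin by (auto simp: D_def)
      then have "jn (X - {f i}) y z" using step(2) by (auto intro: joined_edge)
      then show ?case by (rule joined_trans[OF step.IH])
    qed simp
    moreover have "jn (X - {f i}) (f (Suc i)) (f (Suc j))" using path[of "Suc i" "Suc j" i] ij by simp
    ultimately show ?thesis by (auto simp: D_def intro: joined_trans)
  qed
  have tD: "t \<star> z \<in> D (f j) (f (Suc j))" if "z \<in> D (f i) (f (Suc i))" for z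
  proof -
    have "jn ((\<star>) t ` (X - {f i})) (t \<star> f (Suc i)) (t \<star> z)"
      using joined_act[OF t] that by (simp add: D_def)
    then have "jn (X - {f j}) (t \<star> f (Suc i)) (t \<star> z)"
    proof (rule joined_subset)
      have "t \<star> x \<noteq> f j" if "x \<in> X - {f i}" for x
        using act_inject[OF t, of x "f i"] fX[of i] ij(1,2) that by auto
      then show "(\<star>) t ` (X - {f i}) \<subseteq> X - {f j}" using t by auto
    qed
    then show ?thesis using ij(3) by (simp add: D_def)
  qed
  have fj: "f j \<in> D (f i) (f (Suc i))" using path[of "Suc i" j i] ij by (simp add: D_def)
  have pow: "(t [^] Suc m) \<star> f j \<in> D (f j) (f (Suc j))" for m
  proof (induction m)
    case 0
    then show ?case using tD[OF fj] t by simp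
  next
    case (Suc m)
    have "(t [^] Suc (Suc m)) \<star> f j = t \<star> (t [^] Suc m) \<star> f j"
      unfolding nat_pow_Suc2[OF t, of "Suc m"] using t fX[of j] by (intro act_mult) auto
    then show ?case using tD[OF nested[OF Suc]] by simp
  qed
  have "f j \<notin> D (f j) (f (Suc j))"
    using joined_in[of adj "X - {f j}" "f (Suc j)" "f j"] ne[of "Suc j" j] by (auto simp: D_def)
  then show ?thesis using pow[of "n - 1"] n fX[of j] by (cases n) auto
qed

end

section \<open>Paths fixed by nontrivial elements\<close>

text \<open>
Pigeonhole principle for infinitely many objects: objects with a common label are to be regarded as equivalent,
and finitely many labels leave finitely many classes.
\<close>

lemma finite_representatives:
  assumes "finite I" "\<And>p. p \<in> P \<Longrightarrow> \<exists>i\<in>I. \<rho> p i"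
  shows "\<exists>E. finite E \<and> E \<subseteq> P \<and> (\<forall>p\<in>P. \<exists>e\<in>E. \<exists>i\<in>I. \<rho> p i \<and> \<rho> e i)"
proof -
  let ?J = "{i \<in> I. \<exists>p\<in>P. \<rho> p i}"
  have "\<forall>i\<in>?J. \<exists>p. p \<in> P \<and> \<rho> p i" by blast
  then obtain s where s: "\<And>i. i \<in> ?J \<Longrightarrow> s i \<in> P \<and> \<rho> (s i) i" by metis
  show ?thesis
  proof (intro exI[of _ "s ` ?J"] conjI ballI)
    show "finite (s ` ?J)" using assms(1) by simp
    show "s ` ?J \<subseteq> P" using s by blast
    fix p assume p: "p \<in> P"
    then obtain i where i: "i \<in> I" "\<rho> p i" using assms(2) by blast
    then have "i \<in> ?J" using p by blast
    then show "\<exists>e\<in>s ` ?J. \<exists>i\<in>I. \<rho> p i \<and> \<rho> e i" using s i by blast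
  qed
qed

lemma (in group) fin_gen_conj:
  assumes "fin_gen_subgroup H G" "g \<in> carrier G"
  shows "fin_gen_subgroup ((\<lambda>h. inv g \<otimes> h \<otimes> g) ` H) G"
proof -
  let ?\<phi> = "\<lambda>h. inv g \<otimes> h \<otimes> g"
  have "?\<phi> \<in> hom G G"
    using assms(2) by (auto simp: hom_def m_assoc cancel_inv_left)
  then interpret \<phi>: group_hom G G ?\<phi> by unfold_locales
  obtain S where S: "finite S" "S \<subseteq> carrier G" "H = generate G S"
    using assms(1) by (auto simp: fin_gen_subgroup_def)
  then have "?\<phi> ` H = generate G (?\<phi> ` S)" using \<phi>.generate_img by simp
  moreover have "?\<phi> ` S \<subseteq> carrier G" using S(2) \<phi>.hom_closed by blast
  ultimately show ?thesis using S(1) unfolding fin_gen_subgroup_def by (intro exI[of _ "?\<phi> ` S"]) simp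
qed

text \<open>
This combines, for a group acting on a tree, the assumptions from which the s.f.g.i.p. will follow; \<open>R\<close> is a
finite set of representatives of the edges.
\<close>

locale tree_action_sfgip = tree_action_finite_edges G X adj act
  for G (structure) and X :: "'x set" and adj and act (infixr \<open>\<star>\<close> 75) +
  fixes R :: "('x \<times> 'x) set"
  assumes finite_R: "finite R"
    and R_adj: "(a, b) \<in> R \<Longrightarrow> adj a b"
    and edge_orbits: "adj x y \<Longrightarrow> \<exists>g\<in>carrier G. \<exists>(a, b)\<in>R. x = g \<star> a \<and> y = g \<star> b"
    and sfgip_stab: "x \<in> X \<Longrightarrow> sfgip (G\<lparr>carrier := stab x\<rparr>)"
    and no_cyclic_times_Z: "\<not> (\<exists>k::nat. k \<ge> 2 \<and> (\<exists>H. subgroup H G \<and>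
          G\<lparr>carrier := H\<rparr> \<cong> integer_mod_group k \<times>\<times> integer_group))"
begin

text \<open>
To each edge \<open>g\<^sub>ip\<^sub>i\<close> of a path fixed by \<open>c\<close> belong its representative \<open>p\<^sub>i\<close> and the conjugate
\<open>g\<^sub>i\<^sup>-\<^sup>1cg\<^sub>i\<close> in the finite stabilizer of \<open>p\<^sub>i\<close>. On a long path two of these pairs agree, and then
\<open>g\<^sub>jg\<^sub>i\<^sup>-\<^sup>1\<close> commutes with \<open>c\<close> and translates along the path.
\<close>

lemma fixed_path_bound:
  "\<exists>N. \<forall>(f :: nat \<Rightarrow> 'x) n c. (\<forall>i<n. adj (f i) (f (Suc i))) \<longrightarrow> inj_on f {..n} \<longrightarrow> c \<in> carrier G \<longrightarrow>
     c \<noteq> \<one> \<longrightarrow> (\<forall>i\<le>n. c \<star> f i = f i) \<longrightarrow> n \<le> N"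
proof -
  define B where "B = (SIGMA p:R. stab (fst p) \<inter> stab (snd p))"
  have B: "finite B"
    using finite_R R_adj finite_edge_stab unfolding B_def by (intro finite_SigmaI) auto
  show ?thesis
  proof (intro exI[of _ "card B"] allI impI, rule ccontr)
    fix f :: "nat \<Rightarrow> 'x" and n c
    assume f: "\<forall>i<n. adj (f i) (f (Suc i))" "inj_on f {..n}" and c: "c \<in> carrier G" "c \<noteq> \<one>"
      "\<forall>i\<le>n. c \<star> f i = f i" and n: "\<not> n \<le> card B"
    have fX: "f i \<in> X" "f (Suc i) \<in> X" if "i < n" for i using f(1) adj_in that by blast+
    have "\<forall>i\<in>{..<n}. \<exists>g p. g \<in> carrier G \<and> p \<in> R \<and> f i = g \<star> fst p \<and> f (Suc i) = g \<star> snd p"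
      using edge_orbits f(1) by fastforce
    then obtain g p where gp: "\<And>i. i < n \<Longrightarrow> g i \<in> carrier G \<and> p i \<in> R \<and> f i = g i \<star> fst (p i) \<and> f (Suc i) = g i \<star> snd (p i)"
      by (metis lessThan_iff)
    have pX: "fst (p i) \<in> X" "snd (p i) \<in> X" if "i < n" for i
      using gp[OF that] R_adj[of "fst (p i)" "snd (p i)"] adj_in by auto
    define m where "m i = (p i, inv (g i) \<otimes> c \<otimes> g i)" for i
    have m: "m i \<in> B" if i: "i < n" for i
    proof -
      have "(inv (g i) \<otimes> (c \<otimes> g i)) \<star> x = x" if x: "x \<in> X" "c \<star> g i \<star> x = g i \<star> x" for x
        using x gp[OF i] c(1) by (intro inv_mult_act) (simp_all add: act_mult)
      moreover have "c \<star> g i \<star> fst (p i) = g i \<star> fst (p i)" "c \<star> g i \<star> snd (p i) = g i \<star> snd (p i)"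
        using c(3)[rule_format, of i] c(3)[rule_format, of "Suc i"] gp[OF i] i by simp_all
      ultimately show ?thesis
        using gp[OF i] c(1) pX[OF i] by (simp add: m_def B_def stab_def m_assoc)
    qed
    have "\<not> inj_on m {..<n}"
      using card_inj_on_le[of m "{..<n}" B] m B n by auto
    then obtain i j where ij: "i < j" "j < n" "m i = m j"
      using linorder_inj_onI'[of "{..<n}" m] by (metis lessThan_iff)
    have i: "i < n" using ij by simp
    note gi = gp[OF i] and gj = gp[OF ij(2)]
    define t where "t = g j \<otimes> inv (g i)"
    have t: "t \<in> carrier G" using gi gj by (simp add: t_def)
    have pij: "p i = p j" "inv (g i) \<otimes> c \<otimes> g i = inv (g j) \<otimes> c \<otimes> g j" using ij(3) by (auto simp: m_def)
    have tf: "t \<star> f i = f j" "t \<star> f (Suc i) = f (Suc j)"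
      using gi gj pX[OF i] pij(1) by (simp_all add: t_def act_mult)
    have "t \<otimes> c = g j \<otimes> (inv (g i) \<otimes> c \<otimes> g i) \<otimes> inv (g i)"
      using gi gj c(1) by (simp add: t_def m_assoc)
    also have "\<dots> = c \<otimes> t" unfolding pij(2) using gi gj c(1) by (simp add: t_def m_assoc cancel_inv_left)
    finally have tc: "t \<otimes> c = c \<otimes> t" .
    have tn: "t [^] (k::nat) \<noteq> \<one>" if "k > 0" for k
      by (rule translation_infinite_order[OF t, of j f i])
        (use f(1) ij tf that inj_on_subset[OF f(2), of "{..Suc j}"] in auto)
    have "finite (stab (f i) \<inter> stab (f (Suc i)))" using f(1) i finite_edge_stab by blast
    moreover have "subgroup (stab (f i) \<inter> stab (f (Suc i))) G"
      by (intro subgroups_Inter_pair subgroup_stab fX[OF i])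
    moreover have "c \<in> stab (f i) \<inter> stab (f (Suc i))" using c i by (simp add: stab_def)
    ultimately show False
      using finite_cyclic_times_Z_subgroup[OF c(1,2) _ _ _ t tc tn] no_cyclic_times_Z by blast
  qed
qed

definition edge_fixed_by :: "'a set \<Rightarrow> 'x \<Rightarrow> 'x \<Rightarrow> bool" where
  "edge_fixed_by K x y \<longleftrightarrow> adj x y \<and> (\<exists>c\<in>K. c \<noteq> \<one> \<and> c \<star> x = x \<and> c \<star> y = y)"

text \<open>
If two edges from \<open>x\<close> to \<open>y\<^sub>0\<close> and to \<open>y\<close> are in the same orbit, then \<open>y = uy\<^sub>0\<close> with \<open>u\<close> in the stabilizer
\<open>G\<^sub>x\<close>. If \<open>c\<close> in \<open>K\<close> fixes \<open>x\<close> and \<open>y\<close>, then \<open>u\<^sup>-\<^sup>1cu\<close> lies in the finite stabilizer \<open>E\<^sub>0\<close> of the first edge. So the double coset of \<open>u\<close> with respect to \<open>K\<^sub>x\<close> and \<open>E\<^sub>0\<close> is one of finitely many by the s.f.g.i.p. of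
\<open>G\<^sub>x\<close>, and it determines \<open>y\<close> up to \<open>K\<^sub>x\<close>.
\<close>

lemma fixed_neighbours:
  assumes K: "fin_gen_subgroup K G" and x: "x \<in> X"
  shows "\<exists>M. finite M \<and> (\<forall>y\<in>M. adj x y) \<and>
    (\<forall>y. edge_fixed_by K x y \<longrightarrow> y \<in> translates K M)"
proof -
  have subK: "subgroup K G" using K by (rule fin_gen_imp_subgroup)
  note Kc = subgroup.mem_carrier[OF subK]
  let ?Gx = "G\<lparr>carrier := stab x\<rparr>" and ?Kx = "K \<inter> stab x"
  have stx: "subgroup (stab x) G" by (rule subgroup_stab[OF x])
  interpret Gx: group ?Gx by (rule subgroup_imp_group[OF stx])
  have subKx: "subgroup ?Kx ?Gx"
    using subgroup_incl[OF subgroups_Inter_pair[OF subK stx] stx] by simp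
  have one_orbit: "\<exists>M. finite M \<and> (\<forall>y\<in>M. adj x y) \<and>
    (\<forall>y. (\<exists>g\<in>carrier G. x = g \<star> fst p \<and> y = g \<star> snd p) \<longrightarrow> edge_fixed_by K x y \<longrightarrow> y \<in> translates K M)"
    (is "\<exists>M. ?P p M") if p: "p \<in> R" for p
  proof (cases "\<exists>g0\<in>carrier G. x = g0 \<star> fst p")
    case False
    then show ?thesis by (intro exI[of _ "{}"]) auto
  next
    case True
    then obtain g0 where g0: "g0 \<in> carrier G" "x = g0 \<star> fst p" by blast
    have pX: "adj (fst p) (snd p)" "fst p \<in> X" "snd p \<in> X" using R_adj[of "fst p" "snd p"] p adj_in by auto
    define y0 where "y0 = g0 \<star> snd p"
    have y0: "adj x y0" "y0 \<in> X" using act_adj[OF g0(1) pX(1)] adj_in g0(2) by (auto simp: y0_def)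
    define E0 where "E0 = stab x \<inter> stab y0"
    have subE0: "subgroup E0 G" unfolding E0_def by (rule subgroups_Inter_pair[OF stx subgroup_stab[OF y0(2)]])
    have subE0': "subgroup E0 ?Gx" using subgroup_incl[OF subE0 stx] by (simp add: E0_def)
    have "fin_gen_subgroup E0 ?Gx"
      using finite_imp_fin_gen[OF _ subE0] finite_edge_stab[OF y0(1)]
      by (simp add: fin_gen_subgroup_within[OF stx] E0_def)
    moreover have "fin_gen_subgroup ?Kx ?Gx"
      using stab_fin_gen[OF K x] by (simp add: fin_gen_subgroup_within[OF stx])
    ultimately have fin: "finite {double_coset ?Gx ?Kx u E0 | u. u \<in> carrier ?Gx \<and> conj_subgroup ?Gx ?Kx u \<inter> E0 \<noteq> {\<one>\<^bsub>?Gx\<^esub>}}"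
      by (intro sfgipD(2)[OF sfgip_stab[OF x]])
    define U where "U = {u \<in> stab x. conj_subgroup ?Gx ?Kx u \<inter> E0 \<noteq> {\<one>\<^bsub>?Gx\<^esub>}}"
    have "finite ((\<lambda>u. double_coset ?Gx ?Kx u E0) ` U)"
    proof -
      have "(\<lambda>u. double_coset ?Gx ?Kx u E0) ` U =
        {double_coset ?Gx ?Kx u E0 | u. u \<in> carrier ?Gx \<and> conj_subgroup ?Gx ?Kx u \<inter> E0 \<noteq> {\<one>\<^bsub>?Gx\<^esub>}}"
        unfolding U_def by auto
      then show ?thesis using fin by (simp only:)
    qed
    then obtain U' where U': "finite U'" "U' \<subseteq> U"
      "(\<lambda>u. double_coset ?Gx ?Kx u E0) ` U = (\<lambda>u. double_coset ?Gx ?Kx u E0) ` U'"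
      using finite_subset_image[OF _ subset_refl] by metis
    show ?thesis
    proof (intro exI[of _ "(\<lambda>u. u \<star> y0) ` U'"] conjI ballI allI impI)
      show "finite ((\<lambda>u. u \<star> y0) ` U')" using U'(1) by simp
      show "adj x y" if "y \<in> (\<lambda>u. u \<star> y0) ` U'" for y
      proof -
        obtain u where u: "u \<in> U'" "y = u \<star> y0" using \<open>y \<in> _\<close> by blast
        then have "u \<in> carrier G" "u \<star> x = x" using U'(2) by (auto simp: U_def stab_def)
        then show ?thesis using act_adj[OF _ y0(1), of u] u by simp
      qed
      fix y assume "\<exists>g\<in>carrier G. x = g \<star> fst p \<and> y = g \<star> snd p" "edge_fixed_by K x y"
      then obtain g c where g: "g \<in> carrier G" "x = g \<star> fst p" "y = g \<star> snd p"
        and c: "c \<in> K" "c \<noteq> \<one>" "c \<star> x = x" "c \<star> y = y" unfolding edge_fixed_by_def by blast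
      have y: "y \<in> X" using g pX by simp
      define u where "u = g \<otimes> inv g0"
      have uG: "u \<in> carrier G" using g g0 by (simp add: u_def)
      have "u \<star> x = g \<star> inv g0 \<star> x" using g g0 x by (simp add: u_def act_mult)
      also have "inv g0 \<star> x = fst p" using g0 pX by simp
      finally have u: "u \<in> stab x" using uG g(2) by (simp add: stab_def)
      have uy: "u \<star> y0 = y" using g g0 pX by (simp add: u_def y0_def act_mult)
      define e where "e = inv u \<otimes> (c \<otimes> u)"
      have cG: "c \<in> carrier G" using Kc c by simp
      have eG: "e \<in> carrier G" using cG uG by (simp add: e_def)
      have ux: "u \<star> x = x" using u by (simp add: stab_def)
      have "e \<star> x = x" unfolding e_def using ux c uG cG x by (intro inv_mult_act) (simp_all add: act_mult)
      moreover have "e \<star> y0 = y0" unfolding e_def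
        using uy c uG cG y0 by (intro inv_mult_act) (simp_all add: act_mult)
      ultimately have e: "e \<in> E0" using eG by (simp add: E0_def stab_def)
      have ec: "u \<otimes> e \<otimes> inv u = c" using uG cG by (simp add: e_def m_assoc cancel_inv_left)
      then have "e \<noteq> \<one>" using c(2) uG by auto
      moreover have "u \<otimes> e \<otimes> inv\<^bsub>?Gx\<^esub> u \<in> ?Kx"
        using ec c cG m_inv_consistent[OF stx u] by (simp add: stab_def)
      ultimately have "u \<in> U"
        using Gx.conj_subgroup_nontrivial[OF subKx subE0', of u] u e by (auto simp: U_def)
      then have "double_coset ?Gx ?Kx u E0 \<in> (\<lambda>u. double_coset ?Gx ?Kx u E0) ` U'" using U'(3) by blast
      then obtain w where w: "w \<in> U'" "double_coset ?Gx ?Kx u E0 = double_coset ?Gx ?Kx w E0" by blast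
      have "u = \<one> \<otimes> u \<otimes> \<one>" using uG by simp
      then have "u \<in> double_coset ?Gx ?Kx u E0"
        using subgroup.one_closed[OF subKx] subgroup.one_closed[OF subE0] unfolding Gx.mem_double_coset by auto
      then obtain k e' where k: "k \<in> ?Kx" "e' \<in> E0" "u = k \<otimes> w \<otimes> e'"
        unfolding w(2) Gx.mem_double_coset by auto
      have wG: "w \<in> carrier G" using w(1) U'(2) by (auto simp: U_def stab_def)
      have "y = k \<star> w \<star> y0"
        using k wG y0 Kc by (simp add: act_mult E0_def stab_def flip: uy)
      then show "y \<in> translates K ((\<lambda>u. u \<star> y0) ` U')" using k(1) w(1) by (auto simp: mem_translates)
    qed
  qed
  have "\<forall>p\<in>R. \<exists>M. ?P p M" using one_orbit by blast
  then obtain M where M: "\<And>p. p \<in> R \<Longrightarrow> ?P p (M p)" by metis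
  show ?thesis
  proof (intro exI[of _ "\<Union>p\<in>R. M p"] conjI ballI allI impI)
    show "finite (\<Union>p\<in>R. M p)" using finite_R M by blast
    show "adj x y" if "y \<in> (\<Union>p\<in>R. M p)" for y using that M by blast
    fix y assume y: "edge_fixed_by K x y"
    then obtain g p where "g \<in> carrier G" "p \<in> R" "x = g \<star> fst p" "y = g \<star> snd p"
      using edge_orbits[of x y] by (auto simp: edge_fixed_by_def)
    then have "y \<in> translates K (M p)" using M[of p] y by blast
    then show "y \<in> translates K (\<Union>p\<in>R. M p)" using \<open>p \<in> R\<close> by (auto simp: mem_translates)
  qed
qed

text \<open>
The neighbours provided by \<open>fixed_neighbours\<close> for the vertices of \<open>F\<close> are adjoined to \<open>F\<close>; conjugation by
\<open>k\<close> in \<open>K\<close> transfers the conclusion to the translate \<open>kF\<close>.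
\<close>

lemma enlarge_once:
  assumes K: "fin_gen_subgroup K G" and F: "finite F" "subtree F"
  shows "\<exists>F'. finite F' \<and> subtree F' \<and> F \<subseteq> F' \<and>
    (\<forall>x\<in>translates K F. \<forall>y. edge_fixed_by K x y \<longrightarrow> y \<in> translates K F')"
proof -
  have subK: "subgroup K G" using K by (rule fin_gen_imp_subgroup)
  note Kc = subgroup.mem_carrier[OF subK]
  have FX: "x \<in> F \<Longrightarrow> x \<in> X" for x using F(2) subtree_subset by blast
  have "\<forall>x\<in>F. \<exists>M. finite M \<and> (\<forall>y\<in>M. adj x y) \<and>
    (\<forall>y. edge_fixed_by K x y \<longrightarrow> y \<in> translates K M)" (is "\<forall>x\<in>F. \<exists>M. ?P x M")
    using fixed_neighbours[OF K FX] by blast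
  then obtain M where M: "\<And>x. x \<in> F \<Longrightarrow> ?P x (M x)" by metis
  let ?F' = "F \<union> (\<Union>x\<in>F. M x)"
  have F'X: "?F' \<subseteq> X" using FX M adj_in by blast
  show ?thesis
  proof (intro exI[of _ ?F'] conjI ballI allI impI)
    show "finite ?F'" using F(1) M by blast
    show "subtree ?F'" using M by (intro subtree_Un_nbrs[OF F(2)]) blast
    show "F \<subseteq> ?F'" by blast
    fix x y assume x: "x \<in> translates K F" and "edge_fixed_by K x y"
    then obtain c where y: "adj x y" and c: "c \<in> K" "c \<noteq> \<one>" "c \<star> x = x" "c \<star> y = y"
      unfolding edge_fixed_by_def by blast
    obtain k x0 where k: "k \<in> K" "x0 \<in> F" "x = k \<star> x0" using x by (auto simp: mem_translates)
    have kG: "k \<in> carrier G" "c \<in> carrier G" using k(1) c(1) Kc by auto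
    have yX: "y \<in> X" "x \<in> X" using y adj_in by auto
    define y' where "y' = inv k \<star> y"
    have y': "y' \<in> X" "k \<star> y' = y" using kG yX by (auto simp: y'_def)
    have "adj x0 y'" using act_adj[OF inv_closed[OF kG(1)] y] k FX kG by (simp add: y'_def)
    moreover have c': "inv k \<otimes> (c \<otimes> k) \<in> K"
      using k(1) c(1) by (intro subgroup.m_closed[OF subK] subgroup.m_inv_closed[OF subK])
    moreover have "inv k \<otimes> (c \<otimes> k) \<noteq> \<one>"
    proof
      assume "inv k \<otimes> (c \<otimes> k) = \<one>"
      then have "k \<otimes> (inv k \<otimes> (c \<otimes> k)) \<otimes> inv k = k \<otimes> \<one> \<otimes> inv k" by simp
      then show False using kG c(2) by (simp add: m_assoc cancel_inv_left)
    qed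
    moreover have "(inv k \<otimes> (c \<otimes> k)) \<star> x0 = x0"
      using kG FX[OF k(2)] c(3) k(3) by (intro inv_mult_act) (simp_all add: act_mult)
    moreover have "(inv k \<otimes> (c \<otimes> k)) \<star> y' = y'"
      using kG y' c(4) by (intro inv_mult_act) (simp_all add: act_mult)
    ultimately have "y' \<in> translates K (M x0)" using M[OF k(2)] unfolding edge_fixed_by_def by blast
    then have "y' \<in> translates K ?F'" using k(2) by (auto simp: mem_translates)
    then show "y \<in> translates K ?F'"
      using translates_act[OF subK F'X k(1) y'(1)] y'(2) by simp
  qed
qed

text \<open>
By induction, the vertex \<open>f i\<close> of a fixed path lies in the \<open>i\<close>-th enlargement.
\<close>

lemma enlarge:
  assumes K: "fin_gen_subgroup K G" and F: "finite F" "subtree F"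
  shows "\<exists>F'. finite F' \<and> subtree F' \<and> F \<subseteq> F' \<and>
    (\<forall>(f :: nat \<Rightarrow> 'x) n. n \<le> N \<longrightarrow> f 0 \<in> translates K F \<longrightarrow>
      (\<forall>i<n. edge_fixed_by K (f i) (f (Suc i))) \<longrightarrow> f n \<in> translates K F')"
proof (induction N)
  case 0
  show ?case using F by (intro exI[of _ F]) auto
next
  case (Suc N)
  then obtain F1 where F1: "finite F1" "subtree F1" "F \<subseteq> F1"
    "\<And>f n. n \<le> N \<Longrightarrow> f 0 \<in> translates K F \<Longrightarrow> \<forall>i<n. edge_fixed_by K (f i) (f (Suc i)) \<Longrightarrow> f n \<in> translates K F1"
    by blast
  obtain F2 where F2: "finite F2" "subtree F2" "F1 \<subseteq> F2"
    "\<And>x y. x \<in> translates K F1 \<Longrightarrow> edge_fixed_by K x y \<Longrightarrow> y \<in> translates K F2"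
    using enlarge_once[OF K F1(1,2)] by blast
  show ?case
  proof (intro exI[of _ F2] conjI allI impI)
    show "finite F2" "subtree F2" "F \<subseteq> F2" using F1 F2 by auto
    fix f :: "nat \<Rightarrow> 'x" and n
    assume f: "n \<le> Suc N" "f 0 \<in> translates K F" "\<forall>i<n. edge_fixed_by K (f i) (f (Suc i))"
    show "f n \<in> translates K F2"
    proof (cases "n = Suc N")
      case True
      have "f N \<in> translates K F1" using F1(4)[of N f] f True by simp
      then show ?thesis using F2(4)[of "f N" "f (Suc N)"] f True by simp
    next
      case False
      then have "f n \<in> translates K F1" using F1(4)[of n f] f by simp
      then show ?thesis using F2(3) by (auto simp: mem_translates)
    qed
  qed
qed

end

context tree_action_sfgip
begin

section \<open>The s.f.g.i.p. for groups acting on trees\<close>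

text \<open>
The property is required of all larger subtrees as well, since a core will have to be enlarged later.
\<close>

definition core :: "'a set \<Rightarrow> 'x set \<Rightarrow> bool" where
  "core H F \<longleftrightarrow> finite F \<and> subtree F \<and> (\<forall>F'. subtree F' \<longrightarrow> F \<subseteq> F' \<longrightarrow> subtree (translates H F') \<and>
    (\<forall>x y. x \<in> translates H F' \<longrightarrow> y \<in> translates H F' \<longrightarrow> adj x y \<longrightarrow>
      (\<exists>h\<in>H. \<exists>a\<in>F'. \<exists>b\<in>F'. x = h \<star> a \<and> y = h \<star> b)))"

lemma core_finite_subtree: "core H F \<Longrightarrow> finite F" "core H F \<Longrightarrow> subtree F"
  unfolding core_def by blast+

lemma core_translates:
  assumes "core H F" "subtree F'" "F \<subseteq> F'"
  shows "subtree (translates H F')"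
    and "x \<in> translates H F' \<Longrightarrow> y \<in> translates H F' \<Longrightarrow> adj x y \<Longrightarrow>
      \<exists>h\<in>H. \<exists>a\<in>F'. \<exists>b\<in>F'. x = h \<star> a \<and> y = h \<star> b"
  using assms unfolding core_def by simp_all

lemma core_exists:
  assumes H: "fin_gen_subgroup H G" and v: "v \<in> X"
  shows "\<exists>F. core H F \<and> v \<in> F"
proof -
  obtain S where S: "finite S" "S \<subseteq> carrier G" "H = generate G S"
    using H by (auto simp: fin_gen_subgroup_def)
  have "(\<lambda>s. s \<star> v) ` S \<subseteq> X" using S(2) v by auto
  then obtain F where F: "finite F" "subtree F" "v \<in> F" "(\<lambda>s. s \<star> v) ` S \<subseteq> F"
    using finite_subtree[OF finite_imageI[OF S(1)] _ v] by metis
  have "core H F"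
    unfolding core_def
  proof (intro conjI allI impI F(1,2))
    fix F' assume F': "subtree F'" "F \<subseteq> F'"
    have *: "v \<in> F'" "\<And>s. s \<in> S \<Longrightarrow> s \<star> v \<in> F'" using F F'(2) by auto
    show "subtree (translates H F')" by (rule translates_subtree[OF S(2,3) F'(1) *])
    show "\<exists>h\<in>H. \<exists>a\<in>F'. \<exists>b\<in>F'. x = h \<star> a \<and> y = h \<star> b"
      if "x \<in> translates H F'" "y \<in> translates H F'" "adj x y" for x y
      by (rule translates_edge[OF S(2,3) F'(1) * that])
  qed
  then show ?thesis using F(3) by blast
qed

text \<open>
An edge of \<open>T\<^sub>H \<inter> T\<^sub>K\<close> has the form \<open>k(a, b) = h(a', b')\<close> with edges \<open>(a, b)\<close> and \<open>(a', b')\<close> of the two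
cores. The edge \<open>(a, b)\<close> and the element \<open>m = h\<^sup>-\<^sup>1k\<close>, which sends it to \<open>(a', b')\<close>, serve as a label with
finitely many values. If two edges have the same label, then \<open>kk'\<^sup>-\<^sup>1 = hh'\<^sup>-\<^sup>1\<close> is an element of \<open>H \<inter> K\<close> that
carries one to the other.
\<close>

lemma fin_gen_Int:
  assumes H: "fin_gen_subgroup H G" and K: "fin_gen_subgroup K G" and v: "v \<in> X"
  shows "fin_gen_subgroup (H \<inter> K) G"
proof -
  have subH: "subgroup H G" and subK: "subgroup K G" using H K fin_gen_imp_subgroup by auto
  note Hc = subgroup.mem_carrier[OF subH] and Kc = subgroup.mem_carrier[OF subK]
  obtain F1 where F1': "core H F1" "v \<in> F1" using core_exists[OF H v] by blast
  note F1 = core_finite_subtree[OF F1'(1)] F1'(2)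
    core_translates[OF F1'(1) core_finite_subtree(2)[OF F1'(1)] subset_refl]
  obtain F2 where F2': "core K F2" "v \<in> F2" using core_exists[OF K v] by blast
  note F2 = core_finite_subtree[OF F2'(1)] F2'(2)
    core_translates[OF F2'(1) core_finite_subtree(2)[OF F2'(1)] subset_refl]
  note F1X = subtree_subset[OF F1(2)] and F2X = subtree_subset[OF F2(2)]
  let ?Y = "translates H F1 \<inter> translates K F2"
  have J: "subgroup (H \<inter> K) G" by (rule subgroups_Inter_pair[OF subH subK])
  have Y: "subtree ?Y" by (rule subtree_Int[OF F1(4) F2(4)])
  have YX: "x \<in> ?Y \<Longrightarrow> x \<in> X" for x using subtree_subset[OF Y] by blast
  have vY: "v \<in> ?Y" using translates_incl[OF subH F1X] translates_incl[OF subK F2X] F1(3) F2(3) by blast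
  have JY: "j \<star> y \<in> ?Y" if "j \<in> H \<inter> K" "y \<in> ?Y" for j y
    using that translates_act[OF subH F1X, of j y] translates_act[OF subK F2X, of j y] YX[OF that(2)] by simp
  define P where "P = {(x, y). x \<in> ?Y \<and> y \<in> ?Y \<and> adj x y}"
  define Q where "Q = {(a, b). a \<in> F2 \<and> b \<in> F2 \<and> adj a b}"
  define I where "I = (SIGMA p:Q. \<Union>q\<in>F1 \<times> F1. {m \<in> carrier G. m \<star> fst p = fst q \<and> m \<star> snd p = snd q})"
  define \<rho> where "\<rho> = (\<lambda>(x, y) ((a, b), m). \<exists>h\<in>H. \<exists>k\<in>K. m = inv h \<otimes> k \<and> x = k \<star> a \<and> y = k \<star> b)"
  have "finite Q" by (rule finite_subset[of _ "F2 \<times> F2"]) (use F2(1) in \<open>auto simp: Q_def\<close>)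
  then have I: "finite I"
    unfolding I_def using F1(1) by (intro finite_SigmaI finite_UN_I finite_movers) (auto simp: Q_def)
  have "\<exists>i\<in>I. \<rho> p i" if p: "p \<in> P" for p
  proof -
    obtain x y where xy: "p = (x, y)" "x \<in> ?Y" "y \<in> ?Y" "adj x y" using p by (auto simp: P_def)
    obtain h a' b' where h: "h \<in> H" "a' \<in> F1" "b' \<in> F1" "x = h \<star> a'" "y = h \<star> b'"
      using F1(5)[of x y] xy by blast
    obtain k a b where k: "k \<in> K" "a \<in> F2" "b \<in> F2" "x = k \<star> a" "y = k \<star> b"
      using F2(5)[of x y] xy by blast
    have X: "a \<in> X" "b \<in> X" "a' \<in> X" "b' \<in> X" using F1X F2X h k by auto
    have "adj a b" using act_adj_iff[OF Kc[OF k(1)] X(1,2)] k xy by simp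
    moreover have "(inv h \<otimes> k) \<star> a = a'" "(inv h \<otimes> k) \<star> b = b'"
      using h k X Hc Kc by (auto intro!: inv_mult_act)
    ultimately have "((a, b), inv h \<otimes> k) \<in> I" using h k Hc Kc by (auto simp: I_def Q_def)
    moreover have "\<rho> p ((a, b), inv h \<otimes> k)"
      unfolding xy(1) \<rho>_def prod.case using h(1) k(1,4,5) by blast
    ultimately show ?thesis by blast
  qed
  then obtain E where E: "finite E" "E \<subseteq> P" "\<And>p. p \<in> P \<Longrightarrow> \<exists>e\<in>E. \<exists>i\<in>I. \<rho> p i \<and> \<rho> e i"
    using finite_representatives[OF I, of P \<rho>] by metis
  show ?thesis
  proof (rule fin_gen_from_action[OF J Y vY JY E(1)])
    show "a \<in> ?Y \<and> b \<in> ?Y" if "(a, b) \<in> E" for a b using E(2) that by (auto simp: P_def)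
    show "\<exists>j\<in>H \<inter> K. \<exists>(a, b)\<in>E. x = j \<star> a \<and> y = j \<star> b" if "x \<in> ?Y" "y \<in> ?Y" "adj x y" for x y
    proof -
      have "(x, y) \<in> P" using that by (simp add: P_def)
      then obtain e i where ei: "e \<in> E" "i \<in> I" "\<rho> (x, y) i" "\<rho> e i" using E(3) by blast
      obtain x' y' a b m where e: "e = (x', y')" "i = ((a, b), m)" by (metis prod.exhaust)
      obtain h k where hk: "h \<in> H" "k \<in> K" "m = inv h \<otimes> k" "x = k \<star> a" "y = k \<star> b"
        using ei(3) by (auto simp: \<rho>_def e)
      obtain h' k' where hk': "h' \<in> H" "k' \<in> K" "m = inv h' \<otimes> k'" "x' = k' \<star> a" "y' = k' \<star> b"
        using ei(4) by (auto simp: \<rho>_def e)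
      have c: "h \<in> carrier G" "k \<in> carrier G" "h' \<in> carrier G" "k' \<in> carrier G" using hk hk' Hc Kc by auto
      have ab: "a \<in> X" "b \<in> X" using ei(2) F2X by (auto simp: I_def Q_def e)
      have "k \<otimes> inv k' = h \<otimes> (inv h \<otimes> k) \<otimes> inv k'" using c by (simp add: cancel_inv_left)
      also have "\<dots> = h \<otimes> (inv h' \<otimes> k') \<otimes> inv k'" using hk(3) hk'(3) by simp
      also have "\<dots> = h \<otimes> inv h'" using c by (simp add: m_assoc)
      finally have "k \<otimes> inv k' = h \<otimes> inv h'" .
      moreover have "h \<otimes> inv h' \<in> H"
        using subgroup.m_closed[OF subH hk(1) subgroup.m_inv_closed[OF subH hk'(1)]] .
      moreover have "k \<otimes> inv k' \<in> K"
        using subgroup.m_closed[OF subK hk(2) subgroup.m_inv_closed[OF subK hk'(2)]] .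
      ultimately have "k \<otimes> inv k' \<in> H \<inter> K" by simp
      moreover have "x = (k \<otimes> inv k') \<star> x'" "y = (k \<otimes> inv k') \<star> y'"
        using c ab hk hk' by (simp_all add: act_mult)
      ultimately show ?thesis using ei(1) e by blast
    qed
    show "fin_gen_subgroup (H \<inter> K \<inter> stab y) G" if "y \<in> ?Y" for y
    proof -
      have st: "subgroup (stab y) G" using subgroup_stab YX[OF that] .
      have "fin_gen_subgroup (H \<inter> stab y) (G\<lparr>carrier := stab y\<rparr>)" "fin_gen_subgroup (K \<inter> stab y) (G\<lparr>carrier := stab y\<rparr>)"
        using stab_fin_gen[OF H YX[OF that]] stab_fin_gen[OF K YX[OF that]]
        by (simp_all add: fin_gen_subgroup_within[OF st])
      from sfgipD(1)[OF sfgip_stab[OF YX[OF that]] this]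
      have "fin_gen_subgroup ((H \<inter> stab y) \<inter> (K \<inter> stab y)) G" by (simp add: fin_gen_subgroup_within[OF st])
      moreover have "(H \<inter> stab y) \<inter> (K \<inter> stab y) = H \<inter> K \<inter> stab y" by blast
      ultimately show ?thesis by simp
    qed
  qed
qed

text \<open>
Fix \<open>g\<^sub>0\<close> with \<open>g\<^sub>0a = a'\<close>. Every other such \<open>g\<close> is \<open>g\<^sub>0w\<close> with \<open>w\<close> in the stabilizer of \<open>a\<close>, and \<open>HgK\<close> is
determined by the double coset of \<open>w\<close> with respect to the subgroups \<open>H\<^sub>0 = g\<^sub>0\<^sup>-\<^sup>1(H \<inter> stab a')g\<^sub>0\<close> and \<open>K\<^sub>a\<close> of that
stabilizer.
\<close>

lemma finite_double_cosets_at_vertex: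
  assumes H: "fin_gen_subgroup H G" and K: "fin_gen_subgroup K G" and a: "a \<in> X"
  shows "finite {double_coset G H g K | g. g \<in> carrier G \<and> g \<star> a = a' \<and>
    (\<exists>c\<in>K. c \<noteq> \<one> \<and> c \<star> a = a \<and> g \<otimes> c \<otimes> inv g \<in> H)}" (is "finite ?D")
proof (cases "\<exists>g0\<in>carrier G. g0 \<star> a = a'")
  case False
  then have "?D = {}" by blast
  then show ?thesis by (simp only: finite.emptyI)
next
  case True
  then obtain g0 where g0: "g0 \<in> carrier G" "g0 \<star> a = a'" by blast
  have subH: "subgroup H G" and subK: "subgroup K G" using H K fin_gen_imp_subgroup by auto
  note Hc = subgroup.mem_carrier[OF subH] and Kc = subgroup.mem_carrier[OF subK]
  let ?Ga = "G\<lparr>carrier := stab a\<rparr>"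
  have st: "subgroup (stab a) G" by (rule subgroup_stab[OF a])
  interpret Ga: group ?Ga by (rule subgroup_imp_group[OF st])
  define H0 where "H0 = (\<lambda>h. inv g0 \<otimes> h \<otimes> g0) ` (H \<inter> stab a')"
  define K0 where "K0 = K \<inter> stab a"
  have a': "a' \<in> X" using g0 a by auto
  have H0: "fin_gen_subgroup H0 G"
    unfolding H0_def by (rule fin_gen_conj[OF stab_fin_gen[OF H a'] g0(1)])
  have H0st: "H0 \<subseteq> stab a"
  proof
    fix x assume "x \<in> H0"
    then obtain h where h: "h \<in> H" "h \<in> stab a'" "x = inv g0 \<otimes> h \<otimes> g0" by (auto simp: H0_def)
    have "(inv g0 \<otimes> (h \<otimes> g0)) \<star> a = a"
      using h g0 a Hc stabD by (intro inv_mult_act) (auto simp: act_mult)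
    then show "x \<in> stab a" using h g0 Hc by (simp add: stab_def m_assoc)
  qed
  have fg: "fin_gen_subgroup H0 ?Ga" "fin_gen_subgroup K0 ?Ga"
    using H0 H0st stab_fin_gen[OF K a] by (simp_all add: fin_gen_subgroup_within[OF st] K0_def)
  have sub: "subgroup H0 ?Ga" "subgroup K0 ?Ga" using fg Ga.fin_gen_imp_subgroup by auto
  define D0 where "D0 = {double_coset ?Ga H0 w K0 | w. w \<in> carrier ?Ga \<and> conj_subgroup ?Ga H0 w \<inter> K0 \<noteq> {\<one>\<^bsub>?Ga\<^esub>}}"
  have D0: "finite D0" unfolding D0_def by (rule sfgipD(2)[OF sfgip_stab[OF a] fg])
  define \<Psi> where "\<Psi> d = (\<Union>w\<in>d. double_coset G H (g0 \<otimes> w) K)" for d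
  have \<Psi>: "\<Psi> (double_coset ?Ga H0 w K0) = double_coset G H (g0 \<otimes> w) K" if w: "w \<in> stab a" for w
  proof -
    have "double_coset G H (g0 \<otimes> w') K = double_coset G H (g0 \<otimes> w) K"
      if w': "w' \<in> double_coset ?Ga H0 w K0" for w'
    proof -
      obtain h k where hk: "h \<in> H" "h \<in> stab a'" "k \<in> K0" "w' = (inv g0 \<otimes> h \<otimes> g0) \<otimes> w \<otimes> k"
        using w' by (auto simp: Ga.mem_double_coset H0_def)
      have c: "h \<in> carrier G" "k \<in> carrier G" "w \<in> carrier G" "k \<in> K"
        using hk w Hc Kc stabD by (auto simp: K0_def)
      have "g0 \<otimes> w' = h \<otimes> (g0 \<otimes> w) \<otimes> k" using c g0 hk(4) by (simp add: m_assoc cancel_inv_left)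
      then show ?thesis using double_coset_translate[OF subH subK hk(1) c(4), of "g0 \<otimes> w"] c g0 by simp
    qed
    moreover have "w \<in> double_coset ?Ga H0 w K0"
    proof -
      have "w = \<one> \<otimes> w \<otimes> \<one>" using stabD(1)[OF w] by simp
      then show ?thesis
        using subgroup.one_closed[OF sub(1)] subgroup.one_closed[OF sub(2)] unfolding Ga.mem_double_coset by auto
    qed
    ultimately show ?thesis unfolding \<Psi>_def by blast
  qed
  have "?D \<subseteq> \<Psi> ` D0"
  proof
    fix d assume "d \<in> ?D"
    then obtain g c where g: "d = double_coset G H g K" "g \<in> carrier G" "g \<star> a = a'"
      "c \<in> K" "c \<noteq> \<one>" "c \<star> a = a" "g \<otimes> c \<otimes> inv g \<in> H" by blast
    define w where "w = inv g0 \<otimes> g"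
    have cG: "c \<in> carrier G" using g Kc by simp
    have "w \<star> a = a" unfolding w_def using g g0 a by (intro inv_mult_act) auto
    then have w: "w \<in> stab a" "w \<in> carrier G" using g g0 by (simp_all add: stab_def w_def)
    have gw: "g0 \<otimes> w = g" using g g0 by (simp add: w_def cancel_inv_left)
    have cK0: "c \<in> K0" using g cG by (simp add: K0_def stab_def)
    have "g \<otimes> c \<otimes> inv g \<in> stab a'"
    proof -
      have "inv g \<star> a' = a" using g a by auto
      then show ?thesis using g cG a a' by (simp add: stab_def act_mult)
    qed
    moreover have "w \<otimes> c \<otimes> inv w = inv g0 \<otimes> (g \<otimes> c \<otimes> inv g) \<otimes> g0"
      using g g0 cG by (simp add: w_def m_assoc inv_mult_group)
    ultimately have "w \<otimes> c \<otimes> inv w \<in> H0" using g(7) by (auto simp: H0_def)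
    then have "w \<otimes> c \<otimes> inv\<^bsub>?Ga\<^esub> w \<in> H0" using m_inv_consistent[OF st w(1)] by simp
    then have "conj_subgroup ?Ga H0 w \<inter> K0 \<noteq> {\<one>\<^bsub>?Ga\<^esub>}"
      using Ga.conj_subgroup_nontrivial[OF sub, of w] w(1) cK0 g(5) by auto
    then have "double_coset ?Ga H0 w K0 \<in> D0" using w(1) by (auto simp: D0_def)
    then show "d \<in> \<Psi> ` D0" using \<Psi>[OF w(1)] g(1) gw by force
  qed
  then show ?thesis using D0 finite_surj by blast
qed

text \<open>
For \<open>c \<noteq> 1\<close> in \<open>H\<^sup>g \<inter> K\<close>, the bridge fixed by \<open>c\<close> lies in the enlarged subtree \<open>T\<^sub>2\<close> of \<open>K\<close>, which
therefore contains a vertex \<open>u\<close> of \<open>g\<^sup>-\<^sup>1T\<^sub>1\<close>. If \<open>c\<close> moves \<open>u\<close>, then \<open>g\<^sup>-\<^sup>1T\<^sub>1 \<inter> T\<^sub>2\<close> contains \<open>u\<close>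
and \<open>cu\<close>, hence an edge, and \<open>HgK\<close> has a representative in the finite set \<open>M\<close>. If \<open>c\<close> fixes \<open>u\<close>, then
\<open>HgK\<close> is one of the double cosets in \<open>V\<close>.
\<close>

theorem sfgip_of_tree_action:
  assumes v: "v \<in> X"
  shows "sfgip G"
  unfolding sfgip_def fgip_def
proof (intro conjI allI impI)
  fix H K assume H: "fin_gen_subgroup H G" and K: "fin_gen_subgroup K G"
  show "fin_gen_subgroup (H \<inter> K) G" by (rule fin_gen_Int[OF H K v])
  have subH: "subgroup H G" and subK: "subgroup K G" using H K fin_gen_imp_subgroup by auto
  note Hc = subgroup.mem_carrier[OF subH] and Kc = subgroup.mem_carrier[OF subK]
  obtain F1 where F1': "core H F1" "v \<in> F1" using core_exists[OF H v] by blast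
  note F1 = core_finite_subtree[OF F1'(1)] F1'(2)
    core_translates[OF F1'(1) core_finite_subtree(2)[OF F1'(1)] subset_refl]
  obtain F0 where F0': "core K F0" "v \<in> F0" using core_exists[OF K v] by blast
  note F0 = core_finite_subtree[OF F0'(1)] F0'(2) core_translates[OF F0'(1)]
  obtain N where N: "\<And>(f :: nat \<Rightarrow> 'x) n c. \<forall>i<n. adj (f i) (f (Suc i)) \<Longrightarrow> inj_on f {..n} \<Longrightarrow> c \<in> carrier G \<Longrightarrow>
     c \<noteq> \<one> \<Longrightarrow> \<forall>i\<le>n. c \<star> f i = f i \<Longrightarrow> n \<le> N"
    using fixed_path_bound by blast
  obtain F2 where F2: "finite F2" "subtree F2" "F0 \<subseteq> F2"
    "\<And>(f :: nat \<Rightarrow> 'x) n. n \<le> N \<Longrightarrow> f 0 \<in> translates K F0 \<Longrightarrow>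
      \<forall>i<n. edge_fixed_by K (f i) (f (Suc i)) \<Longrightarrow> f n \<in> translates K F2"
    using enlarge[OF K F0(1,2), of N] by blast
  note F1X = subtree_subset[OF F1(2)] and F0X = subtree_subset[OF F0(2)] and F2X = subtree_subset[OF F2(2)]
  let ?T1 = "translates H F1" and ?T0 = "translates K F0" and ?T2 = "translates K F2"
  have T2: "subtree ?T2" by (rule F0(4)[OF F2(2,3)])
  have T0: "subtree ?T0" by (rule F0(4)[OF F0(2) subset_refl])
  define M where "M = (\<Union>p\<in>{(a, b). a \<in> F2 \<and> b \<in> F2 \<and> adj a b}. \<Union>q\<in>F1 \<times> F1.
    {m \<in> carrier G. m \<star> fst p = fst q \<and> m \<star> snd p = snd q})"
  define V where "V = (\<Union>a\<in>F2. \<Union>a'\<in>F1. {double_coset G H g K | g. g \<in> carrier G \<and> g \<star> a = a' \<and>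
    (\<exists>c\<in>K. c \<noteq> \<one> \<and> c \<star> a = a \<and> g \<otimes> c \<otimes> inv g \<in> H)})"
  have "finite {(a, b). a \<in> F2 \<and> b \<in> F2 \<and> adj a b}"
    by (rule finite_subset[of _ "F2 \<times> F2"]) (use F2(1) in auto)
  then have "finite M"
    unfolding M_def using F1(1) by (intro finite_UN_I finite_movers) auto
  moreover have "finite V"
    unfolding V_def using F1(1) F2(1) F2X by (intro finite_UN_I finite_double_cosets_at_vertex[OF H K]) auto
  ultimately have fin: "finite ((\<lambda>m. double_coset G H m K) ` M \<union> V)" by simp
  have main: "double_coset G H g K \<in> (\<lambda>m. double_coset G H m K) ` M \<union> V"
    if g: "g \<in> carrier G" and c: "c \<in> K" "c \<noteq> \<one>" "g \<otimes> c \<otimes> inv g \<in> H" for g c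
  proof -
    let ?Q = "(\<star>) (inv g) ` ?T1"
    have cG: "c \<in> carrier G" using c Kc by simp
    have Q: "x \<in> ?Q \<longleftrightarrow> g \<star> x \<in> ?T1" if "x \<in> X" for x
    proof
      assume "x \<in> ?Q"
      then obtain y where "y \<in> ?T1" "x = inv g \<star> y" by blast
      then show "g \<star> x \<in> ?T1" using g subtree_subset[OF F1(4)] by auto
    next
      assume "g \<star> x \<in> ?T1"
      moreover have "x = inv g \<star> g \<star> x" using g that by simp
      ultimately show "x \<in> ?Q" by blast
    qed
    have subQ: "subtree ?Q" using subtree_act[OF _ F1(4)] g by simp
    have cQ: "c \<star> x \<in> ?Q \<longleftrightarrow> x \<in> ?Q" if x: "x \<in> X" for x
    proof -
      have "g \<star> c \<star> x = (g \<otimes> c \<otimes> inv g) \<star> g \<star> x" using g cG x by (simp add: act_mult)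
      then show ?thesis using translates_act[OF subH F1X c(3), of "g \<star> x"] Q g x cG by simp
    qed
    have vQ: "inv g \<star> v \<in> ?Q" using translates_incl[OF subH F1X] F1(3) by blast
    have vT: "v \<in> ?T0" using translates_incl[OF subK F0X] F0(3) by blast
    obtain f :: "nat \<Rightarrow> 'x" and n where f: "f 0 \<in> ?T0" "f n \<in> ?Q" "\<And>i. i < n \<Longrightarrow> adj (f i) (f (Suc i))"
      "inj_on f {..n}" "\<And>i. n > 0 \<Longrightarrow> i \<le> n \<Longrightarrow> c \<star> f i = f i"
      using fixed_bridge[OF cG T0 vT translates_act[OF subK F0X c(1)] subQ vQ cQ] by blast
    define u where "u = f n"
    have "f n \<in> ?T2"
    proof (cases "n > 0")
      case True
      then have "\<forall>i<n. edge_fixed_by K (f i) (f (Suc i))"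
        using f(3,5) c(1,2) unfolding edge_fixed_by_def by (metis Suc_leI less_imp_le)
      then show ?thesis using True F2(4)[of n f] N[of n f c] f c cG by auto
    next
      case False
      then show ?thesis using f(1) F2(3) by (auto simp: mem_translates)
    qed
    then have u: "u \<in> ?T2" "u \<in> ?Q" "u \<in> X" using f(2) subtree_subset[OF subQ] by (auto simp: u_def)
    \<comment> \<open>Changing \<open>g\<close> within its double coset moves \<open>u\<close> and \<open>gu\<close> into the finite subtrees \<open>F2\<close> and \<open>F1\<close>.\<close>
    have shift: "inv h \<otimes> g \<otimes> k \<in> carrier G" "(inv h \<otimes> g \<otimes> k) \<star> a = a'"
      "double_coset G H (inv h \<otimes> g \<otimes> k) K = double_coset G H g K"
      if hk: "h \<in> H" "k \<in> K" and a: "a \<in> F2" "a' \<in> F1" "g \<star> k \<star> a = h \<star> a'" for h k a a'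
    proof -
      have cc: "h \<in> carrier G" "k \<in> carrier G" "a \<in> X" "a' \<in> X" using hk a Hc Kc F1X F2X by auto
      have "(inv h \<otimes> (g \<otimes> k)) \<star> a = a'" using cc g a by (intro inv_mult_act) (simp_all add: act_mult)
      then show "inv h \<otimes> g \<otimes> k \<in> carrier G" "(inv h \<otimes> g \<otimes> k) \<star> a = a'" using cc g by (simp_all add: m_assoc)
      show "double_coset G H (inv h \<otimes> g \<otimes> k) K = double_coset G H g K"
        by (rule double_coset_translate[OF subH subK subgroup.m_inv_closed[OF subH hk(1)] hk(2) g])
    qed
    show ?thesis
    proof (cases "c \<star> u = u")
      case True
      obtain h a' where h: "h \<in> H" "a' \<in> F1" "g \<star> u = h \<star> a'" using u Q by (auto simp: mem_translates)
      obtain k a where k: "k \<in> K" "a \<in> F2" "u = k \<star> a" using u by (auto simp: mem_translates)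
      have cc: "h \<in> carrier G" "k \<in> carrier G" "a \<in> X" using h k Hc Kc F2X by auto
      define g' where "g' = inv h \<otimes> g \<otimes> k"
      define c' where "c' = inv k \<otimes> c \<otimes> k"
      note g' = shift[OF h(1) k(1,2) h(2,3)[unfolded k(3)], folded g'_def]
      have "c' \<in> K" unfolding c'_def
        using c k by (intro subgroup.m_closed[OF subK] subgroup.m_inv_closed[OF subK])
      moreover have "(inv k \<otimes> (c \<otimes> k)) \<star> a = a" using cc cG True k by (intro inv_mult_act) (simp_all add: act_mult)
      then have "c' \<star> a = a" using cc cG by (simp add: c'_def m_assoc)
      moreover have "c' \<noteq> \<one>"
      proof
        assume "c' = \<one>"
        then have "k \<otimes> c' \<otimes> inv k = k \<otimes> \<one> \<otimes> inv k" by simp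
        then show False using cc cG c(2) by (simp add: c'_def m_assoc cancel_inv_left)
      qed
      moreover have "g' \<otimes> c' \<otimes> inv g' = inv h \<otimes> (g \<otimes> c \<otimes> inv g) \<otimes> h"
        using cc cG g by (simp add: g'_def c'_def m_assoc inv_mult_group cancel_inv_left)
      then have "g' \<otimes> c' \<otimes> inv g' \<in> H"
        using subgroup.m_closed[OF subH subgroup.m_closed[OF subH subgroup.m_inv_closed[OF subH h(1)] c(3)] h(1)] by simp
      ultimately have "double_coset G H g' K \<in> V" using h k g'(1,2) unfolding V_def by blast
      then show ?thesis using g'(3) by simp
    next
      case False
      have Y: "subtree (?T2 \<inter> ?Q)" by (rule subtree_Int[OF T2 subQ])
      have "c \<star> u \<in> ?T2 \<inter> ?Q" using u cQ translates_act[OF subK F2X c(1)] by simp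
      then obtain w where w: "adj u w" "w \<in> ?T2" "w \<in> ?Q"
        using joined_exit[OF subtree_joined[OF Y], of u "c \<star> u" "{u}"] u False by blast
      obtain k a b where k: "k \<in> K" "a \<in> F2" "b \<in> F2" "u = k \<star> a" "w = k \<star> b"
        using F0(5)[OF F2(2,3) u(1) w(2,1)] by blast
      obtain h a' b' where h: "h \<in> H" "a' \<in> F1" "b' \<in> F1" "g \<star> u = h \<star> a'" "g \<star> w = h \<star> b'"
        using F1(5)[OF _ _ act_adj[OF g w(1)]] u w Q adj_in[OF w(1)] by blast
      note a = shift[OF h(1) k(1,2) h(2,4)[unfolded k(4)]] and b = shift(2)[OF h(1) k(1,3) h(3,5)[unfolded k(5)]]
      have "k \<in> carrier G" "a \<in> X" "b \<in> X" using k Kc F2X by auto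
      then have "adj a b" using act_adj_iff[of k a b] w(1) k(4,5) by simp
      then have "inv h \<otimes> g \<otimes> k \<in> M" using h k a(1,2) b by (force simp: M_def)
      then show ?thesis using a(3) by (metis UnI1 imageI)
    qed
  qed
  show "finite {double_coset G H g K |g. g \<in> carrier G \<and> conj_subgroup G H g \<inter> K \<noteq> {\<one>}}"
  proof (rule finite_subset[OF subsetI fin])
    fix d assume "d \<in> {double_coset G H g K |g. g \<in> carrier G \<and> conj_subgroup G H g \<inter> K \<noteq> {\<one>}}"
    then obtain g where g: "d = double_coset G H g K" "g \<in> carrier G" "conj_subgroup G H g \<inter> K \<noteq> {\<one>}" by blast
    obtain c where "c \<in> K" "c \<noteq> \<one>" "g \<otimes> c \<otimes> inv g \<in> H"
      using conj_subgroup_nontrivial[OF subH subK g(2)] g(3) by blast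
    then show "d \<in> (\<lambda>m. double_coset G H m K) ` M \<union> V" using main[OF g(2)] g(1) by blast
  qed
qed

end

section \<open>Normal forms for paths\<close>

locale based_graph_of_groups = graph_of_groups A
  for A :: "('v, 'e, 'g, 'h) pre_graph_of_groups" +
  fixes u0 :: 'v
  assumes u0: "u0 \<in> verts (ugraph A)"
begin

interpretation B: bidirected_digraph "ugraph A" "arc_rev A"
  by (rule bidirected)

abbreviation "tl_v \<equiv> tail (ugraph A)"
abbreviation "hd_v \<equiv> head (ugraph A)"
abbreviation "Vt e \<equiv> V (tl_v e)"
abbreviation "Vh e \<equiv> V (hd_v e)"
abbreviation "bar \<equiv> arc_rev A"
abbreviation "EG \<equiv> edge_group A"
abbreviation "\<alpha> \<equiv> edge_map A"
abbreviation "eqv u v p q \<equiv> (p, q) \<in> gog_path_rel A u v"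

lemma eqv_refl: "ispath u p v \<Longrightarrow> eqv u v p p"
  by (simp add: gog_path_rel_def)

lemma eqv_sym: "eqv u v p q \<Longrightarrow> eqv u v q p"
  by (auto simp: gog_path_rel_def intro: equivclp_sym)

lemma eqv_trans: "eqv u v p q \<Longrightarrow> eqv u v q r \<Longrightarrow> eqv u v p r"
  by (auto simp: gog_path_rel_def intro: equivclp_trans)

lemma eqv_step: "step u v p q \<Longrightarrow> eqv u v p q"
  using step_ispath by (auto simp: gog_path_rel_def)

lemma tl_v_verts [simp]: "e \<in> arcs (ugraph A) \<Longrightarrow> tl_v e \<in> verts (ugraph A)" and
  hd_v_verts [simp]: "e \<in> arcs (ugraph A) \<Longrightarrow> hd_v e \<in> verts (ugraph A)" and
  bar_arcs [simp]: "e \<in> arcs (ugraph A) \<Longrightarrow> bar e \<in> arcs (ugraph A)" and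
  tl_v_bar [simp]: "e \<in> arcs (ugraph A) \<Longrightarrow> tl_v (bar e) = hd_v e" and
  hd_v_bar [simp]: "e \<in> arcs (ugraph A) \<Longrightarrow> hd_v (bar e) = tl_v e" and
  bar_bar [simp]: "bar (bar e) = e"
  by simp_all

lemma one_mult_V [simp]:
  assumes "v \<in> verts (ugraph A)" "a \<in> carrier (V v)"
  shows "\<one>\<^bsub>V v\<^esub> \<otimes>\<^bsub>V v\<^esub> a = a" "a \<otimes>\<^bsub>V v\<^esub> \<one>\<^bsub>V v\<^esub> = a"
  using assms by (simp_all add: group_V group.is_monoid monoid.l_one monoid.r_one)

lemma assoc_V:
  assumes "v \<in> verts (ugraph A)" "a \<in> carrier (V v)" "b \<in> carrier (V v)" "c \<in> carrier (V v)"
  shows "a \<otimes>\<^bsub>V v\<^esub> b \<otimes>\<^bsub>V v\<^esub> c = a \<otimes>\<^bsub>V v\<^esub> (b \<otimes>\<^bsub>V v\<^esub> c)"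
  using assms by (simp add: group_V group.is_monoid monoid.m_assoc)

lemma \<alpha>_closed [simp]:
  "e \<in> arcs (ugraph A) \<Longrightarrow> c \<in> carrier (EG e) \<Longrightarrow> \<alpha> e c \<in> carrier (Vt e)"
  by (rule edge_map_closed)

lemma \<alpha>_bar_closed [simp]:
  "e \<in> arcs (ugraph A) \<Longrightarrow> c \<in> carrier (EG e) \<Longrightarrow> \<alpha> (bar e) c \<in> carrier (Vh e)"
  by (rule edge_map_rev_closed)

lemma EG_bar [simp]: "e \<in> arcs (ugraph A) \<Longrightarrow> EG (bar e) = EG e"
  by (rule edge_group_rev)

lemma group_hom_\<alpha>: "e \<in> arcs (ugraph A) \<Longrightarrow> group_hom (EG e) (Vt e) (\<alpha> e)"
  using edge_map_mon[of e] group_edge_group[of e] group_V[of "tl_v e"]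
  by (auto simp: group_hom_def group_hom_axioms_def mon_def)

lemma \<alpha>_inj: "e \<in> arcs (ugraph A) \<Longrightarrow> inj_on (\<alpha> e) (carrier (EG e))"
  using edge_map_mon[of e] by (simp add: mon_def)

lemma \<alpha>_mult:
  "e \<in> arcs (ugraph A) \<Longrightarrow> c \<in> carrier (EG e) \<Longrightarrow> d \<in> carrier (EG e) \<Longrightarrow>
   \<alpha> e (c \<otimes>\<^bsub>EG e\<^esub> d) = \<alpha> e c \<otimes>\<^bsub>Vt e\<^esub> \<alpha> e d"
  using group_hom.hom_mult[OF group_hom_\<alpha>] by blast

lemma \<alpha>_one [simp]: "e \<in> arcs (ugraph A) \<Longrightarrow> \<alpha> e \<one>\<^bsub>EG e\<^esub> = \<one>\<^bsub>Vt e\<^esub>"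
  using group_hom.hom_one[OF group_hom_\<alpha>] by blast

lemma EG_closed [simp]:
  assumes "e \<in> arcs (ugraph A)"
  shows "\<one>\<^bsub>EG e\<^esub> \<in> carrier (EG e)"
    and "c \<in> carrier (EG e) \<Longrightarrow> d \<in> carrier (EG e) \<Longrightarrow> c \<otimes>\<^bsub>EG e\<^esub> d \<in> carrier (EG e)"
  using group_edge_group[OF assms] by (simp_all add: group.is_monoid monoid.m_closed)

subsection \<open>Coset representatives\<close>

definition edge_coset :: "'e \<Rightarrow> 'g \<Rightarrow> 'g set" where
  "edge_coset e a = (\<lambda>c. a \<otimes>\<^bsub>Vt e\<^esub> \<alpha> e c) ` carrier (EG e)"

text \<open>
Representatives of the left cosets of the image of the edge group. The trivial coset must be represented by
\<open>1\<close>, because normal forms recognise backtracking by the representative \<open>1\<close>.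
\<close>

definition coset_rep :: "'e \<Rightarrow> 'g \<Rightarrow> 'g" where
  "coset_rep e a = (if \<one>\<^bsub>Vt e\<^esub> \<in> edge_coset e a then \<one>\<^bsub>Vt e\<^esub> else SOME s. s \<in> edge_coset e a)"

definition edge_part :: "'e \<Rightarrow> 'g \<Rightarrow> 'h" where
  "edge_part e a = (SOME c. c \<in> carrier (EG e) \<and> a = coset_rep e a \<otimes>\<^bsub>Vt e\<^esub> \<alpha> e c)"

context
  fixes e assumes e [simp]: "e \<in> arcs (ugraph A)"
begin

interpretation \<alpha>: group_hom "EG e" "Vt e" "\<alpha> e" by (rule group_hom_\<alpha>[OF e])

lemma coset_rep_in_coset: "a \<in> carrier (Vt e) \<Longrightarrow> coset_rep e a \<in> edge_coset e a"
proof -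
  assume "a \<in> carrier (Vt e)"
  then have "a \<otimes>\<^bsub>Vt e\<^esub> \<alpha> e \<one>\<^bsub>EG e\<^esub> \<in> edge_coset e a"
    unfolding edge_coset_def by (intro imageI) simp
  then have "(SOME s. s \<in> edge_coset e a) \<in> edge_coset e a" by (rule someI)
  then show ?thesis by (simp add: coset_rep_def)
qed

lemma edge_coset_mult:
  assumes "a \<in> carrier (Vt e)" "c \<in> carrier (EG e)"
  shows "edge_coset e (a \<otimes>\<^bsub>Vt e\<^esub> \<alpha> e c) = edge_coset e a"
proof (intro equalityI subsetI)
  fix x assume "x \<in> edge_coset e (a \<otimes>\<^bsub>Vt e\<^esub> \<alpha> e c)"
  then obtain d where d: "d \<in> carrier (EG e)" "x = a \<otimes>\<^bsub>Vt e\<^esub> \<alpha> e c \<otimes>\<^bsub>Vt e\<^esub> \<alpha> e d"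
    by (auto simp: edge_coset_def)
  then have "x = a \<otimes>\<^bsub>Vt e\<^esub> \<alpha> e (c \<otimes>\<^bsub>EG e\<^esub> d)" using assms by (simp add: \<alpha>.H.m_assoc)
  then show "x \<in> edge_coset e a" unfolding edge_coset_def using assms d by (intro image_eqI[of _ _ "c \<otimes>\<^bsub>EG e\<^esub> d"]) auto
next
  fix x assume "x \<in> edge_coset e a"
  then obtain d where d: "d \<in> carrier (EG e)" "x = a \<otimes>\<^bsub>Vt e\<^esub> \<alpha> e d"
    by (auto simp: edge_coset_def)
  then have "x = a \<otimes>\<^bsub>Vt e\<^esub> \<alpha> e c \<otimes>\<^bsub>Vt e\<^esub> \<alpha> e (inv\<^bsub>EG e\<^esub> c \<otimes>\<^bsub>EG e\<^esub> d)"
    using assms by (simp add: \<alpha>.H.m_assoc \<alpha>.H.cancel_inv_left)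
  then show "x \<in> edge_coset e (a \<otimes>\<^bsub>Vt e\<^esub> \<alpha> e c)"
    unfolding edge_coset_def using assms d by (intro image_eqI[of _ _ "inv\<^bsub>EG e\<^esub> c \<otimes>\<^bsub>EG e\<^esub> d"]) auto
qed

lemma coset_rep_closed: "a \<in> carrier (Vt e) \<Longrightarrow> coset_rep e a \<in> carrier (Vt e)"
  using coset_rep_in_coset[of a] by (auto simp: edge_coset_def)

lemma coset_rep_mult:
  "a \<in> carrier (Vt e) \<Longrightarrow> c \<in> carrier (EG e) \<Longrightarrow> coset_rep e (a \<otimes>\<^bsub>Vt e\<^esub> \<alpha> e c) = coset_rep e a"
  by (simp add: coset_rep_def edge_coset_mult)

lemma edge_part_prop:
  assumes a: "a \<in> carrier (Vt e)"
  shows "edge_part e a \<in> carrier (EG e)" "coset_rep e a \<otimes>\<^bsub>Vt e\<^esub> \<alpha> e (edge_part e a) = a"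
proof -
  obtain c where c: "c \<in> carrier (EG e)" "coset_rep e a = a \<otimes>\<^bsub>Vt e\<^esub> \<alpha> e c"
    using coset_rep_in_coset[OF a] by (auto simp: edge_coset_def)
  then have "inv\<^bsub>EG e\<^esub> c \<in> carrier (EG e) \<and> a = coset_rep e a \<otimes>\<^bsub>Vt e\<^esub> \<alpha> e (inv\<^bsub>EG e\<^esub> c)"
    using a by (simp add: \<alpha>.H.m_assoc)
  then have "edge_part e a \<in> carrier (EG e) \<and> a = coset_rep e a \<otimes>\<^bsub>Vt e\<^esub> \<alpha> e (edge_part e a)"
    unfolding edge_part_def by (rule someI)
  then show "edge_part e a \<in> carrier (EG e)" "coset_rep e a \<otimes>\<^bsub>Vt e\<^esub> \<alpha> e (edge_part e a) = a" by auto
qed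

lemma edge_part_unique:
  assumes a: "a \<in> carrier (Vt e)" and c: "c \<in> carrier (EG e)" "coset_rep e a \<otimes>\<^bsub>Vt e\<^esub> \<alpha> e c = a"
  shows "edge_part e a = c"
proof -
  have "coset_rep e a \<otimes>\<^bsub>Vt e\<^esub> \<alpha> e (edge_part e a) = coset_rep e a \<otimes>\<^bsub>Vt e\<^esub> \<alpha> e c" using edge_part_prop[OF a] c by simp
  then have "\<alpha> e (edge_part e a) = \<alpha> e c"
    using \<alpha>.H.cancel_inv_left(2)[OF coset_rep_closed[OF a]] edge_part_prop(1)[OF a] c(1) by (metis \<alpha>.hom_closed)
  then show ?thesis using inj_onD[OF \<alpha>_inj[OF e]] edge_part_prop[OF a] c by blast
qed

lemma edge_part_mult:
  assumes a: "a \<in> carrier (Vt e)" and c: "c \<in> carrier (EG e)"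
  shows "edge_part e (a \<otimes>\<^bsub>Vt e\<^esub> \<alpha> e c) = edge_part e a \<otimes>\<^bsub>EG e\<^esub> c"
proof (rule edge_part_unique)
  have "coset_rep e a \<otimes>\<^bsub>Vt e\<^esub> (\<alpha> e (edge_part e a) \<otimes>\<^bsub>Vt e\<^esub> \<alpha> e c) = a \<otimes>\<^bsub>Vt e\<^esub> \<alpha> e c"
    using edge_part_prop[OF a] coset_rep_closed[OF a] c by (simp flip: \<alpha>.H.m_assoc)
  then show "coset_rep e (a \<otimes>\<^bsub>Vt e\<^esub> \<alpha> e c) \<otimes>\<^bsub>Vt e\<^esub> \<alpha> e (edge_part e a \<otimes>\<^bsub>EG e\<^esub> c) = a \<otimes>\<^bsub>Vt e\<^esub> \<alpha> e c"
    using edge_part_prop[OF a] c a by (simp add: coset_rep_mult)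
qed (use a c edge_part_prop[OF a] in auto)

lemma coset_rep_coset_rep: "a \<in> carrier (Vt e) \<Longrightarrow> coset_rep e (coset_rep e a) = coset_rep e a"
  using coset_rep_mult[of "coset_rep e a" "edge_part e a"] edge_part_prop[of a] coset_rep_closed[of a] by simp

lemma coset_rep_mult_fixed:
  assumes "s \<in> carrier (Vt e)" "coset_rep e s = s" "c \<in> carrier (EG e)"
  shows "coset_rep e (s \<otimes>\<^bsub>Vt e\<^esub> \<alpha> e c) = s" "edge_part e (s \<otimes>\<^bsub>Vt e\<^esub> \<alpha> e c) = c"
  using assms by (auto simp: coset_rep_mult intro!: edge_part_unique)

lemma coset_rep_one: "coset_rep e \<one>\<^bsub>Vt e\<^esub> = \<one>\<^bsub>Vt e\<^esub>"
proof -
  have "\<one>\<^bsub>Vt e\<^esub> \<otimes>\<^bsub>Vt e\<^esub> \<alpha> e \<one>\<^bsub>EG e\<^esub> \<in> edge_coset e \<one>\<^bsub>Vt e\<^esub>"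
    unfolding edge_coset_def by (intro imageI) simp
  then show ?thesis by (simp add: coset_rep_def)
qed

lemma coset_rep_\<alpha>:
  assumes "c \<in> carrier (EG e)"
  shows "coset_rep e (\<alpha> e c) = \<one>\<^bsub>Vt e\<^esub>" "edge_part e (\<alpha> e c) = c"
  using coset_rep_mult_fixed[OF _ coset_rep_one assms] assms by simp_all

lemma edge_part_fixed:
  assumes "s \<in> carrier (Vt e)" "coset_rep e s = s"
  shows "edge_part e s = \<one>\<^bsub>EG e\<^esub>"
  using assms by (intro edge_part_unique) auto

end

definition end_vertex :: "('g \<times> 'e) list \<Rightarrow> 'v" where
  "end_vertex L = (case L of [] \<Rightarrow> u0 | (s, e) # _ \<Rightarrow> hd_v e)"

lemma end_vertex_simps [simp]: "end_vertex [] = u0" "end_vertex ((s, e) # L) = hd_v e"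
  by (simp_all add: end_vertex_def)

subsection \<open>Normal forms and states\<close>

text \<open>
Normal forms are stored with the last syllable first: \<open>[(s\<^sub>n, e\<^sub>n), \<dots>, (s\<^sub>1, e\<^sub>1)]\<close> stands for
the path \<open>s\<^sub>1, e\<^sub>1, \<dots>, s\<^sub>n, e\<^sub>n\<close>, whose final vertex group element is left open. So the tail of the list is the
normal form without its last syllable.
\<close>

fun nf :: "('g \<times> 'e) list \<Rightarrow> bool" where
  "nf [] \<longleftrightarrow> True"
| "nf ((s, e) # L) \<longleftrightarrow> nf L \<and> e \<in> arcs (ugraph A) \<and> tl_v e = end_vertex L \<and> s \<in> carrier (Vt e) \<and>
     coset_rep e s = s \<and> \<not> (s = \<one>\<^bsub>Vt e\<^esub> \<and> (\<exists>s' L'. L = (s', bar e) # L'))"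

text \<open>
A state consists of a normal form and the vertex group element that follows it.
\<close>

definition valid :: "('g \<times> 'e) list \<times> 'g \<Rightarrow> 'v \<Rightarrow> bool" where
  "valid st v \<longleftrightarrow> nf (fst st) \<and> end_vertex (fst st) = v \<and> snd st \<in> carrier (V v)"

lemma nf_end_verts: "nf L \<Longrightarrow> end_vertex L \<in> verts (ugraph A)"
  using u0 by (cases L rule: nf.cases) auto

definition state_mult :: "'v \<Rightarrow> ('g \<times> 'e) list \<times> 'g \<Rightarrow> 'g \<Rightarrow> ('g \<times> 'e) list \<times> 'g" where
  "state_mult v st b = (fst st, snd st \<otimes>\<^bsub>V v\<^esub> b)"

text \<open>
Appending the arc \<open>e\<close> to a state: the vertex group element is split as \<open>s \<alpha>\<^sub>e(c)\<close> with a coset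
representative \<open>s\<close>, and \<open>c\<close> is moved across \<open>e\<close>. If \<open>s = 1\<close> and the last syllable ends with the
opposite of \<open>e\<close>, then that syllable cancels.
\<close>

definition traverse :: "'e \<Rightarrow> ('g \<times> 'e) list \<times> 'g \<Rightarrow> ('g \<times> 'e) list \<times> 'g" where
  "traverse e st = (let L = fst st; s = coset_rep e (snd st); b = \<alpha> (bar e) (edge_part e (snd st)) in
     if s = \<one>\<^bsub>Vt e\<^esub> \<and> (\<exists>s' L'. L = (s', bar e) # L')
     then (tl L, fst (hd L) \<otimes>\<^bsub>Vh e\<^esub> b) else ((s, e) # L, b))"

lemma traverse_pop:
  "coset_rep e a = \<one>\<^bsub>Vt e\<^esub> \<Longrightarrow>
   traverse e ((s', bar e) # L, a) = (L, s' \<otimes>\<^bsub>Vh e\<^esub> \<alpha> (bar e) (edge_part e a))"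
  by (simp add: traverse_def)

lemma traverse_cons:
  "\<not> (coset_rep e a = \<one>\<^bsub>Vt e\<^esub> \<and> (\<exists>s' L'. L = (s', bar e) # L')) \<Longrightarrow>
   traverse e (L, a) = ((coset_rep e a, e) # L, \<alpha> (bar e) (edge_part e a))"
  by (auto simp: traverse_def Let_def)

lemma validI: "nf L \<Longrightarrow> end_vertex L = v \<Longrightarrow> a \<in> carrier (V v) \<Longrightarrow> valid (L, a) v"
  by (simp add: valid_def)

lemma valid_verts: "valid st v \<Longrightarrow> v \<in> verts (ugraph A)"
  using nf_end_verts by (auto simp: valid_def)

lemma state_mult_valid: "valid st v \<Longrightarrow> b \<in> carrier (V v) \<Longrightarrow> valid (state_mult v st b) v"
  using valid_verts[of st v] by (auto simp: valid_def state_mult_def)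

lemma state_mult_one: "valid st v \<Longrightarrow> state_mult v st \<one>\<^bsub>V v\<^esub> = st"
  using valid_verts[of st v] by (auto simp: valid_def state_mult_def)

lemma state_mult_state_mult:
  "valid st v \<Longrightarrow> a \<in> carrier (V v) \<Longrightarrow> b \<in> carrier (V v) \<Longrightarrow>
   state_mult v (state_mult v st a) b = state_mult v st (a \<otimes>\<^bsub>V v\<^esub> b)"
  using valid_verts[of st v] by (auto simp: valid_def state_mult_def assoc_V)

lemma traverse_cases [consumes 2, case_names pop cons]:
  assumes "e \<in> arcs (ugraph A)" "valid st (tl_v e)"
    and "\<And>s' L a. \<lbrakk>st = ((s', bar e) # L, a); coset_rep e a = \<one>\<^bsub>Vt e\<^esub>; nf ((s', bar e) # L);
      a \<in> carrier (Vt e); a = \<alpha> e (edge_part e a); edge_part e a \<in> carrier (EG e); end_vertex L = hd_v e;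
      s' \<in> carrier (Vh e); traverse e st = (L, s' \<otimes>\<^bsub>Vh e\<^esub> \<alpha> (bar e) (edge_part e a))\<rbrakk> \<Longrightarrow> thesis"
    and "\<And>L a. \<lbrakk>st = (L, a); \<not> (coset_rep e a = \<one>\<^bsub>Vt e\<^esub> \<and> (\<exists>s' L'. L = (s', bar e) # L')); nf L;
      a \<in> carrier (Vt e); end_vertex L = tl_v e; edge_part e a \<in> carrier (EG e);
      traverse e st = ((coset_rep e a, e) # L, \<alpha> (bar e) (edge_part e a)); nf ((coset_rep e a, e) # L)\<rbrakk> \<Longrightarrow> thesis"
  shows thesis
proof -
  obtain L a where st: "st = (L, a)" by (cases st)
  have v: "nf L" "end_vertex L = tl_v e" "a \<in> carrier (Vt e)" using assms(2) by (auto simp: st valid_def)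
  note d = edge_part_prop[OF assms(1) v(3)]
  show thesis
  proof (cases "coset_rep e a = \<one>\<^bsub>Vt e\<^esub> \<and> (\<exists>s' L'. L = (s', bar e) # L')")
    case True
    then obtain s' L' where L: "L = (s', bar e) # L'" "coset_rep e a = \<one>\<^bsub>Vt e\<^esub>" by blast
    have "a = \<alpha> e (edge_part e a)" using d L(2) assms(1) by simp
    then show thesis
      using assms(1) v L st d traverse_pop[OF L(2)] by (intro assms(3)[of s' L' a]) auto
  next
    case False
    have "nf ((coset_rep e a, e) # L)"
      using v False assms(1) coset_rep_coset_rep[OF assms(1) v(3)] coset_rep_closed[OF assms(1) v(3)] by simp
    then show thesis using v st d False traverse_cons[OF False] by (intro assms(4)[of L a]) auto
  qed
qed

lemma traverse_valid:
  assumes "e \<in> arcs (ugraph A)" "valid st (tl_v e)"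
  shows "valid (traverse e st) (hd_v e)"
  using assms
proof (cases rule: traverse_cases)
  case (pop s' L a)
  then show ?thesis using assms(1) by (auto intro!: validI mult_V)
next
  case (cons L a)
  then show ?thesis using assms(1) by (auto intro!: validI)
qed

text \<open>
After a cancellation, the way back must not cancel a second syllable. It does not, since the list before the
cancellation was reduced.
\<close>

lemma traverse_traverse_bar:
  assumes e: "e \<in> arcs (ugraph A)" "valid st (tl_v e)"
  shows "traverse (bar e) (traverse e st) = st"
  using assms
proof (cases rule: traverse_cases)
  case (pop s' L a)
  have s': "coset_rep (bar e) s' = s'" using pop by simp
  have r: "coset_rep (bar e) (s' \<otimes>\<^bsub>Vh e\<^esub> \<alpha> (bar e) (edge_part e a)) = s'"
    "edge_part (bar e) (s' \<otimes>\<^bsub>Vh e\<^esub> \<alpha> (bar e) (edge_part e a)) = edge_part e a"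
    using coset_rep_mult_fixed[of "bar e" s' "edge_part e a"] e pop s' by auto
  have "traverse (bar e) (L, s' \<otimes>\<^bsub>Vh e\<^esub> \<alpha> (bar e) (edge_part e a)) = ((s', bar e) # L, \<alpha> e (edge_part e a))"
    using pop e by (subst traverse_cons) (auto simp: r)
  then show ?thesis using pop by simp
next
  case (cons L a)
  have "traverse (bar e) ((coset_rep e a, bar (bar e)) # L, \<alpha> (bar e) (edge_part e a)) = (L, coset_rep e a \<otimes>\<^bsub>Vt e\<^esub> \<alpha> e (edge_part e a))"
    using coset_rep_\<alpha>[of "bar e" "edge_part e a"] e cons by (subst traverse_pop) auto
  then show ?thesis using cons edge_part_prop(2)[OF e(1), of a] by simp
qed

lemma traverse_state_mult:
  assumes e: "e \<in> arcs (ugraph A)" "valid st (tl_v e)" and c: "c \<in> carrier (EG e)"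
  shows "traverse e (state_mult (tl_v e) st (\<alpha> e c)) = state_mult (hd_v e) (traverse e st) (\<alpha> (bar e) c)"
  using assms(1,2)
proof (cases rule: traverse_cases)
  case (pop s' L a)
  then show ?thesis
    using e c \<alpha>_mult[of "bar e" "edge_part e a" c]
    by (simp add: state_mult_def traverse_pop coset_rep_mult edge_part_mult assoc_V)
next
  case (cons L a)
  then show ?thesis
    using e c \<alpha>_mult[of "bar e" "edge_part e a" c]
    by (simp add: state_mult_def traverse_cons coset_rep_mult edge_part_mult)
qed

fun run' :: "'v \<Rightarrow> ('g \<times> 'e) list \<times> 'g \<Rightarrow> 'g \<Rightarrow> ('e \<times> 'g) list \<Rightarrow> ('g \<times> 'e) list \<times> 'g" where
  "run' v st a [] = state_mult v st a"
| "run' v st a ((e, b) # es) = run' (hd_v e) (traverse e (state_mult v st a)) b es"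

definition run :: "'v \<Rightarrow> ('g \<times> 'e) list \<times> 'g \<Rightarrow> ('e, 'g) gog_path \<Rightarrow> ('g \<times> 'e) list \<times> 'g" where
  "run v st p = run' v st (fst p) (snd p)"

lemma run_simps [simp]:
  "run v st (a, []) = state_mult v st a"
  "run v st (a, (e, b) # es) = run (hd_v e) (traverse e (state_mult v st a)) (b, es)"
  by (simp_all add: run_def)

lemma run_valid: "ispath u p v \<Longrightarrow> valid st u \<Longrightarrow> valid (run u st p) v"
proof (induction arbitrary: st rule: ispath_induct)
  case (Cons u a e b es)
  then show ?case using traverse_valid[of e "state_mult u st a"] state_mult_valid by simp
qed (auto intro: state_mult_valid)

lemma run_state_mult:
  assumes "ispath u q v" "valid st u" "a \<in> carrier (V u)"
  shows "run u st (a \<otimes>\<^bsub>V u\<^esub> fst q, snd q) = run u (state_mult u st a) q"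
proof -
  obtain b es where q: "q = (b, es)" by (cases q)
  have b: "b \<in> carrier (V u)" using assms(1) ispath_fst q by fastforce
  show ?thesis using state_mult_state_mult[OF assms(2,3) b] by (cases es) (auto simp: q run_def)
qed

lemma run_cmp:
  "ispath u p x \<Longrightarrow> ispath x q v \<Longrightarrow> valid st u \<Longrightarrow> run u st (cmp u p q) = run x (run u st p) q"
proof (induction arbitrary: st rule: ispath_induct)
  case (Nil u a)
  then show ?case using run_state_mult[of u q v st a] by simp
next
  case (Cons u a e b es)
  have v: "valid (traverse e (state_mult u st a)) (hd_v e)"
    using Cons traverse_valid[of e "state_mult u st a"] state_mult_valid by simp
  show ?case using Cons.IH[OF Cons.prems(1) v] by (simp add: Let_def)
qed

text \<open>
The two defining relations hold for the action on states: \<open>traverse_traverse_bar\<close> accounts for backtracking and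
\<open>traverse_state_mult\<close> for sliding.
\<close>

lemma run_step:
  assumes "step u v p q" "valid st u"
  shows "run u st p = run u st q"
  using assms(1)
proof cases
  case (backtrack e x y p' q')
  have m: "ispath x (\<one>\<^bsub>V x\<^esub>, [(e, \<one>\<^bsub>V y\<^esub>), (bar e, \<one>\<^bsub>V x\<^esub>)]) x" using backtrack by simp
  have st: "valid (run u st p') x" using run_valid[OF backtrack(6) assms(2)] .
  have "run x (run u st p') (\<one>\<^bsub>V x\<^esub>, [(e, \<one>\<^bsub>V y\<^esub>), (bar e, \<one>\<^bsub>V x\<^esub>)]) = run u st p'"
    using backtrack(3-5) st traverse_valid[of e "run u st p'"] traverse_traverse_bar[of e "run u st p'"]
    by (simp add: state_mult_one)
  then show ?thesis
    unfolding backtrack(1,2)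
    using run_cmp[OF backtrack(6) ispath_cmp[OF m backtrack(7)] assms(2)] run_cmp[OF m backtrack(7) st]
      run_cmp[OF backtrack(6,7) assms(2)] by simp
next
  case (slide e x y c p' q')
  have m: "ispath x (\<alpha> e c, [(e, \<one>\<^bsub>V y\<^esub>)]) y"
    and n: "ispath x (\<one>\<^bsub>V x\<^esub>, [(e, \<alpha> (bar e) c)]) y"
    using slide by auto
  have st: "valid (run u st p') x" using run_valid[OF slide(7) assms(2)] .
  have "run x (run u st p') (\<alpha> e c, [(e, \<one>\<^bsub>V y\<^esub>)]) = run x (run u st p') (\<one>\<^bsub>V x\<^esub>, [(e, \<alpha> (bar e) c)])"
    using slide(3-6) st traverse_valid[of e "run u st p'"] traverse_state_mult[of e "run u st p'" c]
      state_mult_valid[OF traverse_valid[of e "run u st p'"]]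
    by (simp add: state_mult_one)
  then show ?thesis
    unfolding slide(1,2)
    using run_cmp[OF slide(7) ispath_cmp[OF m slide(8)] assms(2)] run_cmp[OF m slide(8) st]
      run_cmp[OF slide(7) ispath_cmp[OF n slide(8)] assms(2)] run_cmp[OF n slide(8) st] by simp
qed

lemma run_eqv:
  assumes "eqv u v p q" "valid st u"
  shows "run u st p = run u st q"
proof -
  have "equivclp (step u v) p q" using assms(1) by (simp add: gog_path_rel_def)
  then show ?thesis
    by (induction rule: equivclp_induct) (use run_step[OF _ assms(2)] in force)+
qed

text \<open>
The path that a normal form stands for, closed off with the trivial vertex group element.
\<close>

fun spell :: "('g \<times> 'e) list \<Rightarrow> ('e, 'g) gog_path" where
  "spell [] = (\<one>\<^bsub>V u0\<^esub>, [])"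
| "spell ((s, e) # L) = cmp u0 (spell L) (s, [(e, \<one>\<^bsub>Vh e\<^esub>)])"

definition spell_state :: "('g \<times> 'e) list \<times> 'g \<Rightarrow> ('e, 'g) gog_path" where
  "spell_state st = cmp u0 (spell (fst st)) (snd st, [])"

abbreviation start :: "('g \<times> 'e) list \<times> 'g" where "start \<equiv> ([], \<one>\<^bsub>V u0\<^esub>)"

lemma valid_start: "valid start u0"
  using u0 by (simp add: valid_def)

lemma spell_path: "nf L \<Longrightarrow> ispath u0 (spell L) (end_vertex L)"
proof (induction L rule: spell.induct)
  case (2 s e L)
  have te: "tl_v e = end_vertex L" using 2(2) by simp
  have "ispath (end_vertex L) (s, [(e, \<one>\<^bsub>Vh e\<^esub>)]) (hd_v e)"
    using 2(2)[unfolded nf.simps te] te by simp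
  then show ?case using 2 ispath_cmp by (simp del: gog_path_comp.simps)
qed (use u0 in simp)

lemma spell_state_path: "valid st v \<Longrightarrow> ispath u0 (spell_state st) v"
  unfolding spell_state_def valid_def using spell_path[of "fst st"] nf_end_verts[of "fst st"]
  by (intro ispath_cmp[of _ _ "end_vertex (fst st)"]) auto

lemma run_spell: "nf L \<Longrightarrow> run u0 start (spell L) = (L, \<one>\<^bsub>V (end_vertex L)\<^esub>)"
proof (induction L rule: spell.induct)
  case 1
  then show ?case using state_mult_one[OF valid_start] by simp
next
  case (2 s e L)
  have te: "tl_v e = end_vertex L" using 2(2) by simp
  have L: "nf L" "e \<in> arcs (ugraph A)" "tl_v e = end_vertex L" "s \<in> carrier (V (end_vertex L))" "coset_rep e s = s"
    "\<not> (s = \<one>\<^bsub>V (end_vertex L)\<^esub> \<and> (\<exists>s' L'. L = (s', bar e) # L'))"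
    using 2(2)[unfolded nf.simps te] te by blast+
  have p: "ispath (end_vertex L) (s, [(e, \<one>\<^bsub>Vh e\<^esub>)]) (hd_v e)" using L by simp
  have "run u0 start (spell ((s, e) # L)) = run (end_vertex L) (L, \<one>\<^bsub>V (end_vertex L)\<^esub>) (s, [(e, \<one>\<^bsub>Vh e\<^esub>)])"
    using run_cmp[OF spell_path[OF L(1)] p valid_start] 2(1)[OF L(1)] by simp
  also have "\<dots> = state_mult (hd_v e) (traverse e (L, s)) \<one>\<^bsub>Vh e\<^esub>"
    using L nf_end_verts[OF L(1)] by (simp add: state_mult_def)
  also have "traverse e (L, s) = ((s, e) # L, \<one>\<^bsub>Vh e\<^esub>)"
    using L edge_part_fixed[OF L(2)] \<alpha>_one[of "bar e"] by (subst traverse_cons) auto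
  finally show ?case using L by (simp add: state_mult_def)
qed

lemma spell_state_state_mult:
  assumes "valid st v" "a \<in> carrier (V v)"
  shows "cmp u0 (spell_state st) (a, []) = spell_state (state_mult v st a)"
proof -
  have v: "nf (fst st)" "end_vertex (fst st) = v" "snd st \<in> carrier (V v)" "v \<in> verts (ugraph A)"
    using assms(1) valid_verts by (auto simp: valid_def)
  have "cmp u0 (cmp u0 (spell (fst st)) (snd st, [])) (a, []) = cmp u0 (spell (fst st)) (cmp v (snd st, []) (a, []))"
    by (rule cmp_assoc[of _ _ v _ v _ v]) (use v assms spell_path[OF v(1)] in auto)
  then show ?thesis by (simp add: spell_state_def state_mult_def)
qed

text \<open>
Moving \<open>c\<close> across \<open>e\<close> is a slide, and cancelling a syllable is a backtrack.
\<close>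

lemma spell_state_traverse:
  assumes e: "e \<in> arcs (ugraph A)" "valid st (tl_v e)"
  shows "eqv u0 (hd_v e) (cmp u0 (spell_state st) (\<one>\<^bsub>Vt e\<^esub>, [(e, \<one>\<^bsub>Vh e\<^esub>)])) (spell_state (traverse e st))"
proof -
  let ?x = "tl_v e" and ?y = "hd_v e"
  obtain L a where st: "st = (L, a)" by (cases st)
  have v: "nf L" "end_vertex L = ?x" "a \<in> carrier (V ?x)" using e by (auto simp: st valid_def)
  let ?s = "coset_rep e a" and ?c = "edge_part e a"
  have s: "?s \<in> carrier (V ?x)" "?c \<in> carrier (EG e)" "?s \<otimes>\<^bsub>V ?x\<^esub> \<alpha> e ?c = a"
    using coset_rep_closed[OF e(1) v(3)] edge_part_prop[OF e(1) v(3)] by auto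
  have L: "ispath u0 (spell L) ?x" using spell_path[OF v(1)] v by simp
  have sp: "ispath ?x (?s, []) ?x" using s e by simp
  let ?P = "cmp u0 (spell L) (?s, [])"
  have P: "ispath u0 ?P ?x" using ispath_cmp[OF L sp] .
  have one: "ispath ?y (\<one>\<^bsub>V ?y\<^esub>, []) ?y" using e by simp
  have m: "ispath ?x (\<alpha> e ?c, [(e, \<one>\<^bsub>V ?y\<^esub>)]) ?y" "ispath ?x (\<one>\<^bsub>V ?x\<^esub>, [(e, \<alpha> (bar e) ?c)]) ?y"
    using e s by auto
  have "eqv u0 ?y (cmp u0 ?P (cmp ?x (\<alpha> e ?c, [(e, \<one>\<^bsub>V ?y\<^esub>)]) (\<one>\<^bsub>V ?y\<^esub>, [])))
     (cmp u0 ?P (cmp ?x (\<one>\<^bsub>V ?x\<^esub>, [(e, \<alpha> (bar e) ?c)]) (\<one>\<^bsub>V ?y\<^esub>, [])))"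
    by (rule eqv_step[OF gog_path_step.slide[OF e(1) refl refl s(2) P one]])
  then have sl: "eqv u0 ?y (cmp u0 ?P (\<alpha> e ?c, [(e, \<one>\<^bsub>V ?y\<^esub>)])) (cmp u0 ?P (\<one>\<^bsub>V ?x\<^esub>, [(e, \<alpha> (bar e) ?c)]))"
    by (simp only: cmp_one_right[OF m(1)] cmp_one_right[OF m(2)])
  have "cmp u0 ?P (\<alpha> e ?c, [(e, \<one>\<^bsub>V ?y\<^esub>)]) = cmp u0 (spell L) (a, [(e, \<one>\<^bsub>V ?y\<^esub>)])"
    using cmp_assoc[OF L sp m(1)] s by simp
  moreover have "cmp u0 (spell_state st) (\<one>\<^bsub>V ?x\<^esub>, [(e, \<one>\<^bsub>V ?y\<^esub>)]) = cmp u0 (spell L) (a, [(e, \<one>\<^bsub>V ?y\<^esub>)])"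
    using cmp_assoc[OF L, of "(a, [])" ?x "(\<one>\<^bsub>V ?x\<^esub>, [(e, \<one>\<^bsub>V ?y\<^esub>)])" ?y] v e by (simp add: spell_state_def st)
  moreover have "cmp u0 ?P (\<one>\<^bsub>V ?x\<^esub>, [(e, \<alpha> (bar e) ?c)]) = cmp u0 (spell L) (?s, [(e, \<alpha> (bar e) ?c)])"
    using cmp_assoc[OF L sp m(2)] s e by simp
  ultimately have main: "eqv u0 ?y (cmp u0 (spell_state st) (\<one>\<^bsub>V ?x\<^esub>, [(e, \<one>\<^bsub>V ?y\<^esub>)])) (cmp u0 (spell L) (?s, [(e, \<alpha> (bar e) ?c)]))"
    using sl by simp
  have "eqv u0 ?y (cmp u0 (spell L) (?s, [(e, \<alpha> (bar e) ?c)])) (spell_state (traverse e st))"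
    using assms
  proof (cases rule: traverse_cases)
    case (cons L1 a1)
    then have [simp]: "L1 = L" "a1 = a" by (simp_all add: st)
    have p: "ispath ?x (?s, [(e, \<one>\<^bsub>V ?y\<^esub>)]) ?y" "ispath ?y (\<alpha> (bar e) ?c, []) ?y" using e s by auto
    have "spell_state (traverse e st) = cmp u0 (cmp u0 (spell L) (?s, [(e, \<one>\<^bsub>V ?y\<^esub>)])) (\<alpha> (bar e) ?c, [])"
      using cons by (simp add: spell_state_def)
    also have "\<dots> = cmp u0 (spell L) (cmp ?x (?s, [(e, \<one>\<^bsub>V ?y\<^esub>)]) (\<alpha> (bar e) ?c, []))"
      by (rule cmp_assoc[OF L p])
    also have "\<dots> = cmp u0 (spell L) (?s, [(e, \<alpha> (bar e) ?c)])" using e s by (simp add: Let_def)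
    finally show ?thesis using eqv_refl[OF ispath_cmp[OF L]] e s by simp
  next
    case (pop s' L' a1)
    then have [simp]: "a1 = a" and L': "L = (s', bar e) # L'" by (simp_all add: st)
    have nL': "nf L'" "end_vertex L' = ?y" using pop by auto
    have pL': "ispath u0 (spell L') ?y" using spell_path[OF nL'(1)] nL' by simp
    have s1: "?s = \<one>\<^bsub>V ?x\<^esub>" using pop by simp
    have s'y: "s' \<in> carrier (V ?y)" using pop by simp
    have p: "ispath ?y (s', []) ?y" "ispath ?y (s', [(bar e, \<one>\<^bsub>V ?x\<^esub>)]) ?x"
      "ispath ?x (\<one>\<^bsub>V ?x\<^esub>, [(e, \<alpha> (bar e) ?c)]) ?y" "ispath ?y (\<alpha> (bar e) ?c, []) ?y"
      "ispath ?y (\<one>\<^bsub>V ?y\<^esub>, [(bar e, \<one>\<^bsub>V ?x\<^esub>), (e, \<one>\<^bsub>V ?y\<^esub>)]) ?y"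
      using e s s'y by auto
    let ?P' = "cmp u0 (spell L') (s', [])"
    have P': "ispath u0 ?P' ?y" by (rule ispath_cmp[OF pL' p(1)])
    have "cmp u0 (spell L) (?s, [(e, \<alpha> (bar e) ?c)]) =
      cmp u0 (cmp u0 (spell L') (s', [(bar e, \<one>\<^bsub>V ?x\<^esub>)])) (\<one>\<^bsub>V ?x\<^esub>, [(e, \<alpha> (bar e) ?c)])"
      using e by (simp add: L' s1)
    also have "\<dots> = cmp u0 (spell L') (cmp ?y (s', [(bar e, \<one>\<^bsub>V ?x\<^esub>)]) (\<one>\<^bsub>V ?x\<^esub>, [(e, \<alpha> (bar e) ?c)]))"
      by (rule cmp_assoc[OF pL' p(2,3)])
    also have "cmp ?y (s', [(bar e, \<one>\<^bsub>V ?x\<^esub>)]) (\<one>\<^bsub>V ?x\<^esub>, [(e, \<alpha> (bar e) ?c)]) =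
      cmp ?y (s', []) (cmp ?y (\<one>\<^bsub>V ?y\<^esub>, [(bar e, \<one>\<^bsub>V ?x\<^esub>), (e, \<one>\<^bsub>V ?y\<^esub>)]) (\<alpha> (bar e) ?c, []))"
      using e s s'y by (simp add: Let_def)
    also have "cmp u0 (spell L') \<dots> = cmp u0 ?P' (cmp ?y (\<one>\<^bsub>V ?y\<^esub>, [(bar e, \<one>\<^bsub>V ?x\<^esub>), (e, \<one>\<^bsub>V ?y\<^esub>)]) (\<alpha> (bar e) ?c, []))"
      by (rule cmp_assoc[OF pL' p(1) ispath_cmp[OF p(5,4)], symmetric])
    finally have 1: "cmp u0 (spell L) (?s, [(e, \<alpha> (bar e) ?c)]) =
      cmp u0 ?P' (cmp ?y (\<one>\<^bsub>V ?y\<^esub>, [(bar e, \<one>\<^bsub>V ?x\<^esub>), (e, \<one>\<^bsub>V ?y\<^esub>)]) (\<alpha> (bar e) ?c, []))" .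
    have "eqv u0 ?y (cmp u0 ?P' (cmp ?y (\<one>\<^bsub>V ?y\<^esub>, [(bar e, \<one>\<^bsub>V ?x\<^esub>), (bar (bar e), \<one>\<^bsub>V ?y\<^esub>)]) (\<alpha> (bar e) ?c, [])))
       (cmp u0 ?P' (\<alpha> (bar e) ?c, []))"
      using e by (intro eqv_step gog_path_step.backtrack[OF _ _ _ P' p(4)]) simp_all
    moreover have "cmp u0 ?P' (\<alpha> (bar e) ?c, []) = spell_state (traverse e st)"
      using cmp_assoc[OF pL' p(1,4)] pop by (simp add: spell_state_def)
    ultimately show ?thesis unfolding 1 by simp
  qed
  with main show ?thesis by (rule eqv_trans)
qed

lemma spell_state_run:
  "ispath u p v \<Longrightarrow> valid st u \<Longrightarrow> eqv u0 v (cmp u0 (spell_state st) p) (spell_state (run u st p))"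
proof (induction arbitrary: st rule: ispath_induct)
  case (Nil u a)
  then show ?case using spell_state_state_mult[of st u a] spell_state_path[OF state_mult_valid[of st u a]] eqv_refl by simp
next
  case (Cons u a e b es)
  let ?y = "hd_v e" and ?st = "state_mult u st a"
  have st: "valid ?st u" "valid (traverse e ?st) ?y"
    using Cons traverse_valid[of e ?st] state_mult_valid by auto
  have p: "ispath u (a, []) u" "ispath u (\<one>\<^bsub>V u\<^esub>, [(e, \<one>\<^bsub>V ?y\<^esub>)]) ?y" using Cons by auto
  have b: "b \<in> carrier (V ?y)" using Cons(5) ispath_fst by fastforce
  have "(a, (e, b) # es) = cmp u (a, []) (cmp u (\<one>\<^bsub>V u\<^esub>, [(e, \<one>\<^bsub>V ?y\<^esub>)]) (b, es))"
    using Cons b by (simp add: Let_def)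
  then have "cmp u0 (spell_state st) (a, (e, b) # es) =
    cmp u0 (cmp u0 (cmp u0 (spell_state st) (a, [])) (\<one>\<^bsub>V u\<^esub>, [(e, \<one>\<^bsub>V ?y\<^esub>)])) (b, es)"
    using cmp_assoc[OF spell_state_path[OF Cons.prems] p(1) ispath_cmp[OF p(2) Cons(5)]]
      cmp_assoc[OF ispath_cmp[OF spell_state_path[OF Cons.prems] p(1)] p(2) Cons(5)] by simp
  also have "cmp u0 (spell_state st) (a, []) = spell_state ?st" using spell_state_state_mult Cons by simp
  finally have 1: "cmp u0 (spell_state st) (a, (e, b) # es) = cmp u0 (cmp u0 (spell_state ?st) (\<one>\<^bsub>V u\<^esub>, [(e, \<one>\<^bsub>V ?y\<^esub>)])) (b, es)" .
  have "eqv u0 ?y (cmp u0 (spell_state ?st) (\<one>\<^bsub>V u\<^esub>, [(e, \<one>\<^bsub>V ?y\<^esub>)])) (spell_state (traverse e ?st))"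
    using spell_state_traverse[of e ?st] Cons st by simp
  then have "eqv u0 v (cmp u0 (spell_state st) (a, (e, b) # es)) (cmp u0 (spell_state (traverse e ?st)) (b, es))"
    unfolding 1 by (rule rel_cmp[OF _ eqv_refl[OF Cons(5)]])
  then show ?case using Cons.IH[OF st(2)] by (auto intro: eqv_trans)
qed

lemma eqv_spell_state_run:
  assumes "ispath u0 p v"
  shows "eqv u0 v p (spell_state (run u0 start p))"
proof -
  have "cmp u0 (spell_state start) p = p"
    using cmp_one_left[OF assms] u0 by (simp add: spell_state_def)
  then show ?thesis using spell_state_run[OF assms valid_start] by simp
qed

text \<open>
The normal form theorem: states are a complete invariant of the classes of paths from the base vertex.
\<close>

lemma eqv_iff_run:
  assumes "ispath u0 p v" "ispath u0 q v"
  shows "eqv u0 v p q \<longleftrightarrow> run u0 start p = run u0 start q"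
  using run_eqv[OF _ valid_start] eqv_spell_state_run[OF assms(1)] eqv_spell_state_run[OF assms(2)]
  by (metis eqv_sym eqv_trans)

end

section \<open>The Bass--Serre tree\<close>

context based_graph_of_groups
begin

abbreviation "\<pi> \<equiv> fundamental_group A u0"

definition path_class :: "('e, 'g) gog_path \<Rightarrow> ('e, 'g) gog_path set" where
  "path_class p = gog_path_rel A u0 u0 `` {p}"

lemma group_\<pi>: "group \<pi>"
  by (rule group_fundamental_group[OF u0])

lemma path_class_carrier: "ispath u0 p u0 \<Longrightarrow> path_class p \<in> carrier \<pi>"
  by (auto simp: fundamental_group_def path_class_def intro: quotientI)

lemma carrier_path_class:
  assumes "g \<in> carrier \<pi>"
  obtains p where "ispath u0 p u0" "g = path_class p"
  using assms by (auto simp: fundamental_group_def path_class_def quotient_def)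

lemma path_class_eq_iff: "ispath u0 p u0 \<Longrightarrow> ispath u0 q u0 \<Longrightarrow> path_class p = path_class q \<longleftrightarrow> eqv u0 u0 p q"
  unfolding path_class_def using eq_equiv_class_iff[OF equiv_rel[of u0 u0]] by blast

lemma path_class_mult: "ispath u0 p u0 \<Longrightarrow> ispath u0 q u0 \<Longrightarrow> path_class p \<otimes>\<^bsub>\<pi>\<^esub> path_class q = path_class (cmp u0 p q)"
  unfolding path_class_def by (rule fundamental_group_mult)

lemma one_path: "ispath u0 (\<one>\<^bsub>V u0\<^esub>, []) u0"
  using u0 by simp

lemma path_class_one: "\<one>\<^bsub>\<pi>\<^esub> = path_class (\<one>\<^bsub>V u0\<^esub>, [])"
  by (simp add: fundamental_group_def path_class_def)

subsection \<open>Inverse paths and cancellation\<close>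

lemma path_inverse:
  assumes p: "ispath u p v"
  obtains q where "ispath v q u" "eqv v v (cmp v q p) (\<one>\<^bsub>V v\<^esub>, [])" "eqv u u (cmp u p q) (\<one>\<^bsub>V u\<^esub>, [])"
proof -
  obtain q where q: "ispath v q u" "eqv v v (cmp v q p) (\<one>\<^bsub>V v\<^esub>, [])"
    using ispath_left_inverse[OF p] by blast
  obtain t where t: "ispath u t v" "eqv u u (cmp u t q) (\<one>\<^bsub>V u\<^esub>, [])"
    using ispath_left_inverse[OF q(1)] by blast
  have "eqv u v (cmp u t (cmp v q p)) (cmp u t (\<one>\<^bsub>V v\<^esub>, []))" by (rule rel_cmp[OF eqv_refl[OF t(1)] q(2)])
  moreover have "eqv u v (cmp u (cmp u t q) p) (cmp u (\<one>\<^bsub>V u\<^esub>, []) p)" by (rule rel_cmp[OF t(2) eqv_refl[OF p]])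
  ultimately have "eqv u v t p"
    unfolding cmp_one_right[OF t(1)] cmp_one_left[OF p] cmp_assoc[OF t(1) q(1) p]
    using eqv_sym eqv_trans by blast
  then have "eqv u u (cmp u t q) (cmp u p q)" by (rule rel_cmp[OF _ eqv_refl[OF q(1)]])
  then have "eqv u u (cmp u p q) (\<one>\<^bsub>V u\<^esub>, [])" using t(2) eqv_sym eqv_trans by blast
  then show thesis using that q by blast
qed

lemma right_cancel_path:
  assumes p: "ispath u p x" "ispath u q x" and r: "ispath x r v" and pq: "eqv u v (cmp u p r) (cmp u q r)"
  shows "eqv u x p q"
proof -
  obtain r' where r': "ispath v r' x" "eqv x x (cmp x r r') (\<one>\<^bsub>V x\<^esub>, [])" using path_inverse[OF r] by blast
  have *: "eqv u x (cmp u (cmp u p r) r') p" if "ispath u p x" for p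
    using rel_cmp[OF eqv_refl[OF that] r'(2)] cmp_assoc[OF that r r'(1)] cmp_one_right[OF that] by simp
  have "eqv u x (cmp u (cmp u p r) r') (cmp u (cmp u q r) r')" by (rule rel_cmp[OF pq eqv_refl[OF r'(1)]])
  then show ?thesis using *[OF p(1)] *[OF p(2)] by (meson eqv_sym eqv_trans)
qed

text \<open>
For \<open>g = [p]\<close> and a normal form \<open>L\<close> this is the state reached by \<open>p\<close> followed by \<open>L\<close>. Its list is
the image of \<open>L\<close> under \<open>g\<close>. Its vertex group element records how \<open>g\<close> acts beyond \<open>L\<close>; on the stabilizer of
\<open>L\<close> it determines \<open>g\<close>.
\<close>

definition act_state :: "('e, 'g) gog_path set \<Rightarrow> ('g \<times> 'e) list \<Rightarrow> ('g \<times> 'e) list \<times> 'g" where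
  "act_state g L = run u0 start (cmp u0 (SOME p. ispath u0 p u0 \<and> g = path_class p) (spell L))"

definition nf_act :: "('e, 'g) gog_path set \<Rightarrow> ('g \<times> 'e) list \<Rightarrow> ('g \<times> 'e) list" where
  "nf_act g L = fst (act_state g L)"

lemma act_state_path_class:
  assumes p: "ispath u0 p u0" and L: "nf L"
  shows "act_state (path_class p) L = run u0 start (cmp u0 p (spell L))"
proof -
  let ?q = "SOME q. ispath u0 q u0 \<and> path_class p = path_class q"
  have q: "ispath u0 ?q u0 \<and> path_class p = path_class ?q" by (rule someI[of _ p]) (use p in simp)
  then have "eqv u0 u0 ?q p" using path_class_eq_iff[of ?q p] p by simp
  then have "eqv u0 (end_vertex L) (cmp u0 ?q (spell L)) (cmp u0 p (spell L))"
    by (rule rel_cmp[OF _ eqv_refl[OF spell_path[OF L]]])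
  then show ?thesis unfolding act_state_def by (rule run_eqv[OF _ valid_start])
qed

lemma act_state_valid:
  assumes "g \<in> carrier \<pi>" "nf L"
  shows "valid (act_state g L) (end_vertex L)"
proof -
  obtain p where p: "ispath u0 p u0" "g = path_class p" using carrier_path_class[OF assms(1)] by blast
  show ?thesis
    unfolding p(2) act_state_path_class[OF p(1) assms(2)]
    by (rule run_valid[OF ispath_cmp[OF p(1) spell_path[OF assms(2)]] valid_start])
qed

lemma run_path_class:
  assumes p: "ispath u0 p u0" and q: "ispath u0 q v" "run u0 start q = (L, a)"
  shows "run u0 start (cmp u0 p q) = state_mult v (act_state (path_class p) L) a"
proof -
  have st: "valid (L, a) v" using run_valid[OF q(1) valid_start] q(2) by simp
  then have v: "nf L" "end_vertex L = v" "a \<in> carrier (V v)" "v \<in> verts (ugraph A)"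
    using valid_verts[OF st] by (auto simp: valid_def)
  have a: "ispath v (a, []) v" using v by simp
  have L: "ispath u0 (spell L) v" using spell_path[OF v(1)] v(2) by simp
  have "eqv u0 v q (cmp u0 (spell L) (a, []))" using eqv_spell_state_run[OF q(1)] q(2) by (simp add: spell_state_def)
  then have "eqv u0 v (cmp u0 p q) (cmp u0 p (cmp u0 (spell L) (a, [])))"
    by (rule rel_cmp[OF eqv_refl[OF p]])
  then have "eqv u0 v (cmp u0 p q) (cmp u0 (cmp u0 p (spell L)) (a, []))"
    unfolding cmp_assoc[OF p L a] .
  then have "run u0 start (cmp u0 p q) = run u0 start (cmp u0 (cmp u0 p (spell L)) (a, []))"
    by (rule run_eqv[OF _ valid_start])
  also have "\<dots> = state_mult v (act_state (path_class p) L) a"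
    using run_cmp[OF ispath_cmp[OF p L] a valid_start] act_state_path_class[OF p v(1)] by simp
  finally show ?thesis .
qed

lemma act_state_mult:
  assumes "g \<in> carrier \<pi>" "h \<in> carrier \<pi>" "nf L"
  shows "act_state (g \<otimes>\<^bsub>\<pi>\<^esub> h) L = state_mult (end_vertex L) (act_state g (nf_act h L)) (snd (act_state h L))"
proof -
  obtain p where p: "ispath u0 p u0" "g = path_class p" using carrier_path_class[OF assms(1)] by blast
  obtain q where q: "ispath u0 q u0" "h = path_class q" using carrier_path_class[OF assms(2)] by blast
  have "act_state (g \<otimes>\<^bsub>\<pi>\<^esub> h) L = run u0 start (cmp u0 (cmp u0 p q) (spell L))"
    unfolding p(2) q(2) path_class_mult[OF p(1) q(1)] by (rule act_state_path_class[OF ispath_cmp[OF p(1) q(1)] assms(3)])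
  also have "\<dots> = run u0 start (cmp u0 p (cmp u0 q (spell L)))"
    by (simp only: cmp_assoc[OF p(1) q(1) spell_path[OF assms(3)]])
  also have "\<dots> = state_mult (end_vertex L) (act_state g (nf_act h L)) (snd (act_state h L))"
    unfolding p(2) by (rule run_path_class[OF p(1) ispath_cmp[OF q(1) spell_path[OF assms(3)]]])
      (simp add: nf_act_def q(2) act_state_path_class[OF q(1) assms(3)])
  finally show ?thesis .
qed

lemma act_state_one: "nf L \<Longrightarrow> act_state \<one>\<^bsub>\<pi>\<^esub> L = (L, \<one>\<^bsub>V (end_vertex L)\<^esub>)"
  unfolding path_class_one using act_state_path_class[OF one_path] cmp_one_left[OF spell_path] run_spell by simp

lemma act_state_Cons:
  assumes g: "g \<in> carrier \<pi>" and L: "nf ((s, e) # L)"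
  shows "act_state g ((s, e) # L) = traverse e (state_mult (tl_v e) (act_state g L) s)"
proof -
  obtain p where p: "ispath u0 p u0" "g = path_class p" using carrier_path_class[OF g] by blast
  have te: "tl_v e = end_vertex L" using L by simp
  have e: "nf L" "e \<in> arcs (ugraph A)" "s \<in> carrier (Vt e)" using L by auto
  have rL: "ispath u0 (spell L) (tl_v e)" using spell_path[OF e(1)] te by simp
  have se: "ispath (tl_v e) (s, [(e, \<one>\<^bsub>Vh e\<^esub>)]) (hd_v e)" using e by simp
  have v: "valid (act_state g L) (tl_v e)" using act_state_valid[OF g e(1)] te by simp
  have "act_state g ((s, e) # L) = run u0 start (cmp u0 p (cmp u0 (spell L) (s, [(e, \<one>\<^bsub>Vh e\<^esub>)])))"
    unfolding p(2) using act_state_path_class[OF p(1) L] by simp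
  also have "\<dots> = run (tl_v e) (act_state g L) (s, [(e, \<one>\<^bsub>Vh e\<^esub>)])"
    using run_cmp[OF ispath_cmp[OF p(1) rL] se valid_start] cmp_assoc[OF p(1) rL se] act_state_path_class[OF p(1) e(1)] p(2)
    by simp
  also have "\<dots> = traverse e (state_mult (tl_v e) (act_state g L) s)"
    using state_mult_one[OF traverse_valid[OF e(2) state_mult_valid[OF v e(3)]]] by simp
  finally show ?thesis .
qed

subsection \<open>The tree of normal forms\<close>

definition nf_adj :: "('g \<times> 'e) list \<Rightarrow> ('g \<times> 'e) list \<Rightarrow> bool" where
  "nf_adj L M \<longleftrightarrow> nf L \<and> nf M \<and> ((\<exists>x. M = x # L) \<or> (\<exists>x. L = x # M))"

lemma nf_adj_sym: "nf_adj L M \<Longrightarrow> nf_adj M L"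
  by (auto simp: nf_adj_def)

lemma nf_tl: "nf (x # L) \<Longrightarrow> nf L"
  by (cases x) simp

text \<open>
The neighbour of \<open>M\<close> in the direction of \<open>L\<close>: the extension of \<open>M\<close> by one syllable if \<open>L\<close> lies beyond
\<open>M\<close>, and the parent of \<open>M\<close> otherwise. It is constant along edges that avoid \<open>M\<close>, which is what makes the
graph of normal forms acyclic.
\<close>

definition towards :: "('g \<times> 'e) list \<Rightarrow> ('g \<times> 'e) list \<Rightarrow> ('g \<times> 'e) list" where
  "towards M L = (if \<exists>zs x. L = zs @ x # M then drop (length L - Suc (length M)) L else tl M)"

lemma towards_descendant: "towards M (zs @ x # M) = x # M"
  by (auto simp: towards_def)

lemma towards_adj: "nf_adj M L \<Longrightarrow> towards M L = L"
  using towards_descendant[of M "[]"] by (auto simp: nf_adj_def towards_def)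

lemma towards_const:
  assumes "nf_adj K L" "K \<noteq> M" "L \<noteq> M"
  shows "towards M K = towards M L"
proof -
  have *: "towards M (x # K) = towards M K" if "K \<noteq> M" "x # K \<noteq> M" for x K
  proof (cases "\<exists>zs y. K = zs @ y # M")
    case True
    then obtain zs y where "K = zs @ y # M" by blast
    then show ?thesis using towards_descendant[of M zs y] towards_descendant[of M "x # zs" y] by simp
  next
    case False
    have "\<not> (\<exists>zs y. x # K = zs @ y # M)"
    proof
      assume "\<exists>zs y. x # K = zs @ y # M"
      then obtain zs y where "x # K = zs @ y # M" by blast
      then show False using False that by (cases zs) auto
    qed
    then show ?thesis using False by (simp add: towards_def)
  qed
  show ?thesis using assms *[of K] *[of L] by (auto simp: nf_adj_def)
qed

sublocale tree: tree_graph "{L. nf L}" nf_adj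
proof
  show "L \<in> {L. nf L} \<and> M \<in> {L. nf L}" if "nf_adj L M" for L M using that by (simp add: nf_adj_def)
  show "nf_adj M L" if "nf_adj L M" for L M using that by (rule nf_adj_sym)
  show "\<not> nf_adj L L" for L by (simp add: nf_adj_def)
  have root: "joined nf_adj {L. nf L} L []" if "nf L" for L
    using that
  proof (induction L)
    case (Cons x L)
    have "nf L" using nf_tl[OF Cons.prems] .
    then have "joined nf_adj {L. nf L} (x # L) L" using Cons.prems by (intro joined_edge) (auto simp: nf_adj_def)
    then show ?case using Cons.IH[OF \<open>nf L\<close>] by (rule joined_trans)
  qed simp
  show "joined nf_adj {L. nf L} L M" if "L \<in> {L. nf L}" "M \<in> {L. nf L}" for L M
    using root[of L] joined_sym[OF root[of M] nf_adj_sym] that by (auto intro: joined_trans)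
  show "L = M" if "nf_adj K L" "nf_adj K M" "joined nf_adj ({L. nf L} - {K}) L M" for K L M
  proof -
    have "towards K L = towards K M"
      using that(3) unfolding joined_def
      by (induction rule: rtranclp_induct) (auto dest: towards_const)
    then show ?thesis using towards_adj[OF that(1)] towards_adj[OF that(2)] by simp
  qed
qed

lemma traverse_nf_adj:
  assumes "e \<in> arcs (ugraph A)" "valid st (tl_v e)"
  shows "nf_adj (fst st) (fst (traverse e st))"
  using assms
proof (cases rule: traverse_cases)
  case (pop s' L a)
  then show ?thesis using nf_tl[of _ L] by (auto simp: nf_adj_def)
next
  case (cons L a)
  then show ?thesis by (auto simp: nf_adj_def)
qed

sublocale tree: tree_action \<pi> "{L. nf L}" nf_adj nf_act
proof (rule tree_action.intro[OF group_\<pi> tree.tree_graph_axioms], unfold_locales)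
  show "nf_act g L \<in> {L. nf L}" if "g \<in> carrier \<pi>" "L \<in> {L. nf L}" for g L
    using act_state_valid[of g L] that by (simp add: valid_def nf_act_def)
  show "nf_act \<one>\<^bsub>\<pi>\<^esub> L = L" if "L \<in> {L. nf L}" for L
    using act_state_one that by (simp add: nf_act_def)
  show "nf_act (g \<otimes>\<^bsub>\<pi>\<^esub> h) L = nf_act g (nf_act h L)"
    if "g \<in> carrier \<pi>" "h \<in> carrier \<pi>" "L \<in> {L. nf L}" for g h L
    using act_state_mult[of g h L] that by (simp add: nf_act_def state_mult_def)
  have *: "nf_adj (nf_act g L) (nf_act g (x # L))" if g: "g \<in> carrier \<pi>" and L: "nf (x # L)" for g x L
  proof -
    obtain s e where x: "x = (s, e)" by (cases x)
    have te: "tl_v e = end_vertex L" using L by (simp add: x)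
    have e: "nf L" "e \<in> arcs (ugraph A)" "s \<in> carrier (Vt e)" using L by (auto simp: x)
    have v: "valid (state_mult (tl_v e) (act_state g L) s) (tl_v e)"
      using act_state_valid[OF g e(1)] te e(3) by (intro state_mult_valid) auto
    show ?thesis
      using traverse_nf_adj[OF e(2) v] act_state_Cons[OF g L[unfolded x]] by (simp add: nf_act_def x state_mult_def)
  qed
  show "nf_adj (nf_act g L) (nf_act g M)" if g: "g \<in> carrier \<pi>" and LM: "nf_adj L M" for g L M
  proof -
    consider x where "M = x # L" "nf M" | x where "L = x # M" "nf L"
      using LM unfolding nf_adj_def by blast
    then show ?thesis
    proof cases
      case 1
      then show ?thesis using *[OF g, of x L] by simp
    next
      case 2
      then show ?thesis using *[OF g, of x M] nf_adj_sym by simp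
    qed
  qed
qed

text \<open>
With the path \<open>p\<^sub>L\<close> spelled by \<open>L\<close>, an element \<open>g\<close> of the stabilizer of \<open>L\<close> satisfies
\<open>g p\<^sub>L = p\<^sub>L a\<close> for a unique element \<open>a\<close> of the vertex group at the end of \<open>L\<close>; this is its label.
\<close>

definition stab_label :: "('g \<times> 'e) list \<Rightarrow> ('e, 'g) gog_path set \<Rightarrow> 'g" where
  "stab_label L g = snd (act_state g L)"

lemma stab_act_state: "g \<in> tree.stab L \<Longrightarrow> act_state g L = (L, stab_label L g)"
  using tree.stabD(2)[of g L] by (simp add: nf_act_def stab_label_def prod_eq_iff)

lemma stab_label_closed: "g \<in> tree.stab L \<Longrightarrow> nf L \<Longrightarrow> stab_label L g \<in> carrier (V (end_vertex L))"
  using act_state_valid[of g L] tree.stabD(1)[of g L] by (simp add: valid_def stab_label_def)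

lemma stab_label_hom:
  assumes L: "nf L"
  shows "stab_label L \<in> hom (\<pi>\<lparr>carrier := tree.stab L\<rparr>) (V (end_vertex L))"
proof (rule homI)
  show "stab_label L g \<in> carrier (V (end_vertex L))" if "g \<in> carrier (\<pi>\<lparr>carrier := tree.stab L\<rparr>)" for g
    using stab_label_closed that L by simp
  fix g h assume g: "g \<in> carrier (\<pi>\<lparr>carrier := tree.stab L\<rparr>)" and h: "h \<in> carrier (\<pi>\<lparr>carrier := tree.stab L\<rparr>)"
  have "act_state (g \<otimes>\<^bsub>\<pi>\<^esub> h) L = state_mult (end_vertex L) (act_state g L) (stab_label L h)"
    using act_state_mult[OF _ _ L, of g h] g h tree.stabD(1)[of g L] tree.stabD[of h L] by (simp add: stab_label_def)
  then show "stab_label L (g \<otimes>\<^bsub>\<pi>\<lparr>carrier := tree.stab L\<rparr>\<^esub> h) = stab_label L g \<otimes>\<^bsub>V (end_vertex L)\<^esub> stab_label L h"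
    by (simp add: stab_label_def state_mult_def)
qed

lemma stab_label_inj:
  assumes L: "nf L"
  shows "inj_on (stab_label L) (tree.stab L)"
proof (rule inj_onI)
  fix g h assume gh: "g \<in> tree.stab L" "h \<in> tree.stab L" "stab_label L g = stab_label L h"
  obtain p where p: "ispath u0 p u0" "g = path_class p" using carrier_path_class tree.stabD(1)[OF gh(1)] by blast
  obtain q where q: "ispath u0 q u0" "h = path_class q" using carrier_path_class tree.stabD(1)[OF gh(2)] by blast
  note rL = spell_path[OF L]
  have "run u0 start (cmp u0 p (spell L)) = run u0 start (cmp u0 q (spell L))"
    using stab_act_state[OF gh(1)] stab_act_state[OF gh(2)] gh(3) act_state_path_class[OF p(1) L] act_state_path_class[OF q(1) L] p q by simp
  then have "eqv u0 (end_vertex L) (cmp u0 p (spell L)) (cmp u0 q (spell L))"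
    using eqv_iff_run[OF ispath_cmp[OF p(1) rL] ispath_cmp[OF q(1) rL]] by simp
  then have "eqv u0 u0 p q" by (rule right_cancel_path[OF p(1) q(1) rL])
  then show "g = h" using path_class_eq_iff[OF p(1) q(1)] p q by simp
qed

text \<open>
If \<open>g\<close> fixes both ends, its label \<open>a\<close> at \<open>L\<close> satisfies \<open>as = s \<alpha>\<^sub>e(c)\<close> for some \<open>c\<close> in the edge
group. So the stabilizer embeds into a conjugate of the image of the edge group.
\<close>

lemma finite_edge_stab_Cons:
  assumes fin: "\<And>e. e \<in> arcs (ugraph A) \<Longrightarrow> finite (carrier (EG e))" and L: "nf ((s, e) # L)"
  shows "finite (tree.stab L \<inter> tree.stab ((s, e) # L))"
proof -
  have te: "end_vertex L = tl_v e" using L by simp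
  have e: "nf L" "e \<in> arcs (ugraph A)" "s \<in> carrier (Vt e)" using L by auto
  interpret Ve: group "Vt e" using group_V e by simp
  have "stab_label L g \<in> (\<lambda>c. s \<otimes>\<^bsub>Vt e\<^esub> \<alpha> e c \<otimes>\<^bsub>Vt e\<^esub> inv\<^bsub>Vt e\<^esub> s) ` carrier (EG e)"
    if g: "g \<in> tree.stab L" "g \<in> tree.stab ((s, e) # L)" for g
  proof -
    have a: "stab_label L g \<in> carrier (Vt e)" using stab_label_closed[OF g(1) e(1)] te by simp
    let ?a = "stab_label L g \<otimes>\<^bsub>Vt e\<^esub> s"
    have v: "valid (L, ?a) (tl_v e)" using a e te by (intro validI) auto
    have fp: "fst (traverse e (L, ?a)) = (s, e) # L"
    proof -
      have "traverse e (L, ?a) = act_state g ((s, e) # L)"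
        using act_state_Cons[OF tree.stabD(1)[OF g(1)] L] stab_act_state[OF g(1)] by (simp add: state_mult_def)
      also have "\<dots> = ((s, e) # L, stab_label ((s, e) # L) g)" by (rule stab_act_state[OF g(2)])
      finally show ?thesis by simp
    qed
    have "coset_rep e ?a = s"
      using e(2) v
    proof (cases rule: traverse_cases)
      case (pop s' L' a')
      then have "length L' = length ((s, e) # L)" using fp by simp
      then show ?thesis using pop by simp
    next
      case (cons L' a')
      then show ?thesis using fp by auto
    qed
    then have "?a = s \<otimes>\<^bsub>Vt e\<^esub> \<alpha> e (edge_part e ?a)" "edge_part e ?a \<in> carrier (EG e)"
      using edge_part_prop[OF e(2), of ?a] a e by auto
    then have "stab_label L g = s \<otimes>\<^bsub>Vt e\<^esub> \<alpha> e (edge_part e ?a) \<otimes>\<^bsub>Vt e\<^esub> inv\<^bsub>Vt e\<^esub> s"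
      using a e by (intro Ve.inv_solve_right[THEN iffD2]) auto
    then show ?thesis using \<open>edge_part e ?a \<in> carrier (EG e)\<close> by blast
  qed
  then have "stab_label L ` (tree.stab L \<inter> tree.stab ((s, e) # L)) \<subseteq>
    (\<lambda>c. s \<otimes>\<^bsub>Vt e\<^esub> \<alpha> e c \<otimes>\<^bsub>Vt e\<^esub> inv\<^bsub>Vt e\<^esub> s) ` carrier (EG e)" by blast
  then have "finite (stab_label L ` (tree.stab L \<inter> tree.stab ((s, e) # L)))"
    using fin[OF e(2)] finite_subset by blast
  then show ?thesis using finite_imageD inj_on_subset[OF stab_label_inj[OF e(1)]] by blast
qed

text \<open>
With the paths \<open>p\<^sub>L\<close> and \<open>p\<^sub>M\<close> spelled by \<open>L\<close> and \<open>M\<close>, the class of \<open>p\<^sub>L st\<^sup>-\<^sup>1 p\<^sub>M\<^sup>-\<^sup>1\<close>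
carries one edge to the other.
\<close>

lemma same_arc_same_orbit:
  assumes L: "nf ((s, e) # L)" and M: "nf ((t, e) # M)"
  shows "\<exists>g\<in>carrier \<pi>. nf_act g M = L \<and> nf_act g ((t, e) # M) = (s, e) # L"
proof -
  let ?x = "tl_v e"
  have te: "end_vertex L = ?x" "end_vertex M = ?x" using L M by simp_all
  have e: "nf L" "nf M" "e \<in> arcs (ugraph A)" "s \<in> carrier (V ?x)" "t \<in> carrier (V ?x)" using L M by auto
  interpret Ve: group "V ?x" using group_V e by simp
  have rL: "ispath u0 (spell L) ?x" "ispath u0 (spell M) ?x" using spell_path e te by metis+
  obtain r where r: "ispath ?x r u0" "eqv ?x ?x (cmp ?x r (spell M)) (\<one>\<^bsub>V ?x\<^esub>, [])"
    using path_inverse[OF rL(2)] by blast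
  define a where "a = s \<otimes>\<^bsub>V ?x\<^esub> inv\<^bsub>V ?x\<^esub> t"
  have a: "a \<in> carrier (V ?x)" "ispath ?x (a, []) ?x" using e by (auto simp: a_def)
  let ?q = "cmp u0 (spell L) (a, [])"
  have q: "ispath u0 ?q ?x" by (rule ispath_cmp[OF rL(1) a(2)])
  let ?p = "cmp u0 ?q r"
  have p: "ispath u0 ?p u0" by (rule ispath_cmp[OF q r(1)])
  have "eqv u0 ?x (cmp u0 ?q (cmp ?x r (spell M))) (cmp u0 ?q (\<one>\<^bsub>V ?x\<^esub>, []))"
    by (rule rel_cmp[OF eqv_refl[OF q] r(2)])
  then have "eqv u0 ?x (cmp u0 ?p (spell M)) ?q"
    unfolding cmp_one_right[OF q] cmp_assoc[OF q r(1) rL(2)] .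
  then have "act_state (path_class ?p) M = run u0 start ?q"
    using act_state_path_class[OF p e(2)] run_eqv[OF _ valid_start] by simp
  also have "\<dots> = (L, a)"
    using run_cmp[OF rL(1) a(2) valid_start] run_spell[OF e(1)] a te e by (simp add: state_mult_def)
  finally have M1: "act_state (path_class ?p) M = (L, a)" .
  have "a \<otimes>\<^bsub>V ?x\<^esub> t = s" using e by (simp add: a_def Ve.m_assoc)
  then have "act_state (path_class ?p) ((t, e) # M) = traverse e (L, s)"
    using act_state_Cons[OF path_class_carrier[OF p] M] M1 by (simp add: state_mult_def)
  also have "\<dots> = act_state \<one>\<^bsub>\<pi>\<^esub> ((s, e) # L)"
    using act_state_Cons[OF _ L, of "\<one>\<^bsub>\<pi>\<^esub>"] act_state_one[OF e(1)] group.is_monoid[OF group_\<pi>] monoid.one_closed te e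
    by (simp add: state_mult_def)
  also have "\<dots> = ((s, e) # L, \<one>\<^bsub>Vh e\<^esub>)" using act_state_one[OF L] by simp
  finally show ?thesis using M1 path_class_carrier[OF p] by (intro bexI[of _ "path_class ?p"]) (auto simp: nf_act_def)
qed

lemma finite_edge_representatives:
  assumes fin: "finite (arcs (ugraph A))"
  shows "\<exists>R. finite R \<and> (\<forall>(L, M)\<in>R. nf_adj L M) \<and>
    (\<forall>K N. nf_adj K N \<longrightarrow> (\<exists>g\<in>carrier \<pi>. \<exists>(L, M)\<in>R. K = nf_act g L \<and> N = nf_act g M))"
proof -
  define P where "P = {(L, M). nf_adj L M}"
  define \<rho> where "\<rho> = (\<lambda>(L, M) (e, up). if up then \<exists>s. M = (s, e) # L else \<exists>s. L = (s :: 'g, e :: 'e) # M)"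
  have "\<exists>i\<in>arcs (ugraph A) \<times> UNIV. \<rho> p i" if p: "p \<in> P" for p
  proof -
    obtain L M where LM: "p = (L, M)" "nf_adj L M" using p by (auto simp: P_def)
    then consider s e where "M = (s, e) # L" "e \<in> arcs (ugraph A)" | s e where "L = (s, e) # M" "e \<in> arcs (ugraph A)"
      unfolding nf_adj_def by (metis nf.simps(2) surj_pair)
    then show ?thesis
    proof cases
      case 1
      then have "\<rho> p (e, True)" by (simp add: \<rho>_def LM)
      then show ?thesis using 1 by blast
    next
      case 2
      then have "\<rho> p (e, False)" by (simp add: \<rho>_def LM)
      then show ?thesis using 2 by blast
    qed
  qed
  then obtain R where R: "finite R" "R \<subseteq> P" "\<And>p. p \<in> P \<Longrightarrow> \<exists>r\<in>R. \<exists>i\<in>arcs (ugraph A) \<times> UNIV. \<rho> p i \<and> \<rho> r i"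
    using finite_representatives[of "arcs (ugraph A) \<times> UNIV" P \<rho>] fin by auto
  show ?thesis
  proof (intro exI[of _ R] conjI allI impI)
    show "finite R" by fact
    show "\<forall>(L, M)\<in>R. nf_adj L M" using R(2) by (auto simp: P_def)
    fix K N assume KN: "nf_adj K N"
    then have "(K, N) \<in> P" by (simp add: P_def)
    then obtain r i where r: "r \<in> R" "\<rho> (K, N) i" "\<rho> r i" using R(3) by blast
    obtain L M where LM: "r = (L, M)" by (cases r)
    obtain e up where i: "i = (e, up)" by (cases i)
    have adj: "nf_adj L M" using R(2) r(1) by (auto simp: P_def LM)
    have "\<exists>g\<in>carrier \<pi>. nf_act g L = K \<and> nf_act g M = N"
    proof (cases up)
      case True
      then obtain s t where "N = (s, e) # K" "M = (t, e) # L" using r by (auto simp: \<rho>_def LM i)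
      then show ?thesis using same_arc_same_orbit[of s e K t L] KN adj by (auto simp: nf_adj_def)
    next
      case False
      then obtain s t where "K = (s, e) # N" "L = (t, e) # M" using r by (auto simp: \<rho>_def LM i)
      then show ?thesis using same_arc_same_orbit[of s e N t M] KN adj by (auto simp: nf_adj_def)
    qed
    then show "\<exists>g\<in>carrier \<pi>. \<exists>(L, M)\<in>R. K = nf_act g L \<and> N = nf_act g M" using r(1) LM by blast
  qed
qed

text \<open>
The embedding is \<open>a \<mapsto> rar\<^sup>-\<^sup>1\<close>. It is injective because appending \<open>a\<close> to \<open>r\<close> multiplies the vertex group element
of the resulting state by \<open>a\<close>.
\<close>

lemma vertex_group_embeds:
  assumes r: "ispath u0 r v"
  shows "\<exists>f. f \<in> hom (V v) \<pi> \<and> inj_on f (carrier (V v))"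
proof -
  have v: "v \<in> verts (ugraph A)" using ispath_ends[OF r] by simp
  obtain r' where r': "ispath v r' u0" "eqv v v (cmp v r' r) (\<one>\<^bsub>V v\<^esub>, [])" using path_inverse[OF r] by blast
  define q where "q a = cmp u0 r (a, [])" for a
  have a_path: "ispath v (a, []) v" if "a \<in> carrier (V v)" for a using that v by simp
  have q: "ispath u0 (q a) v" if "a \<in> carrier (V v)" for a
    unfolding q_def by (rule ispath_cmp[OF r a_path[OF that]])
  define p where "p a = cmp u0 (q a) r'" for a
  have p: "ispath u0 (p a) u0" if "a \<in> carrier (V v)" for a
    unfolding p_def by (rule ispath_cmp[OF q[OF that] r'(1)])
  have hom: "path_class (p (a \<otimes>\<^bsub>V v\<^esub> b)) = path_class (p a) \<otimes>\<^bsub>\<pi>\<^esub> path_class (p b)"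
    if a: "a \<in> carrier (V v)" and b: "b \<in> carrier (V v)" for a b
  proof -
    have ab: "a \<otimes>\<^bsub>V v\<^esub> b \<in> carrier (V v)" using a b v by simp
    have "eqv v v (cmp v (cmp v r' r) (b, [])) (b, [])"
      using rel_cmp[OF r'(2) eqv_refl[OF a_path[OF b]]] cmp_one_left[OF a_path[OF b]] by simp
    then have "eqv u0 v (cmp u0 (q a) (cmp v (cmp v r' r) (b, []))) (cmp u0 (q a) (b, []))"
      by (rule rel_cmp[OF eqv_refl[OF q[OF a]]])
    moreover have "cmp u0 (q a) (cmp v (cmp v r' r) (b, [])) = cmp u0 (p a) (q b)"
      unfolding p_def q_def[of b] cmp_assoc[OF r'(1) r a_path[OF b]]
        cmp_assoc[OF q[OF a] r'(1) ispath_cmp[OF r a_path[OF b]]] ..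
    moreover have "cmp u0 (q a) (b, []) = q (a \<otimes>\<^bsub>V v\<^esub> b)"
      unfolding q_def cmp_assoc[OF r a_path[OF a] a_path[OF b]] by simp
    ultimately have "eqv u0 v (cmp u0 (p a) (q b)) (q (a \<otimes>\<^bsub>V v\<^esub> b))" by simp
    then have "eqv u0 u0 (cmp u0 (cmp u0 (p a) (q b)) r') (p (a \<otimes>\<^bsub>V v\<^esub> b))"
      unfolding p_def[of "a \<otimes>\<^bsub>V v\<^esub> b"] by (rule rel_cmp[OF _ eqv_refl[OF r'(1)]])
    then have "eqv u0 u0 (cmp u0 (p a) (p b)) (p (a \<otimes>\<^bsub>V v\<^esub> b))"
      unfolding cmp_assoc[OF p[OF a] q[OF b] r'(1)] p_def[of b] .
    then show ?thesis
      unfolding path_class_mult[OF p[OF a] p[OF b]]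
      using path_class_eq_iff[OF ispath_cmp[OF p[OF a] p[OF b]] p[OF ab]] by simp
  qed
  have inj: "a = b" if a: "a \<in> carrier (V v)" and b: "b \<in> carrier (V v)" and eq: "path_class (p a) = path_class (p b)" for a b
  proof -
    interpret Vv: group "V v" using group_V v by simp
    have "eqv u0 u0 (cmp u0 (q a) r') (cmp u0 (q b) r')"
      using path_class_eq_iff[OF p[OF a] p[OF b]] eq by (simp add: p_def)
    then have "eqv u0 v (q a) (q b)" by (rule right_cancel_path[OF q[OF a] q[OF b] r'(1)])
    then have "run u0 start (q a) = run u0 start (q b)" by (rule run_eqv[OF _ valid_start])
    then have "state_mult v (run u0 start r) a = state_mult v (run u0 start r) b"
      unfolding q_def using run_cmp[OF r a_path[OF a] valid_start] run_cmp[OF r a_path[OF b] valid_start] by simp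
    moreover have "snd (run u0 start r) \<in> carrier (V v)" using run_valid[OF r valid_start] by (simp add: valid_def)
    ultimately show ?thesis
      using a b Vv.cancel_inv_left(2)[of "snd (run u0 start r)"] by (metis state_mult_def snd_conv)
  qed
  have "(\<lambda>a. path_class (p a)) \<in> hom (V v) \<pi>" using hom p path_class_carrier by (intro homI) auto
  moreover have "inj_on (\<lambda>a. path_class (p a)) (carrier (V v))" using inj by (intro inj_onI) blast
  ultimately show ?thesis by blast
qed

lemma path_exists:
  assumes "Digraph_Component.connected (ugraph A)" "v \<in> verts (ugraph A)"
  shows "\<exists>p. ispath u0 p v"
proof -
  interpret B: bidirected_digraph "ugraph A" "arc_rev A" by (rule bidirected)
  have "(u0, v) \<in> rtrancl_on (verts (ugraph A)) (parcs (mk_symmetric (ugraph A)))"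
    using assms u0 unfolding connected_def strongly_connected_def by (auto simp: reachable_def)
  then show ?thesis
  proof (induction rule: rtrancl_on_induct)
    case base
    then show ?case using one_path by blast
  next
    case (step y z)
    then obtain p where p: "ispath u0 p y" by blast
    obtain e where e: "e \<in> arcs (ugraph A)" "tl_v e = y" "hd_v e = z"
      using step(2) bar_arcs tl_v_bar hd_v_bar unfolding parcs_mk_symmetric by blast
    then have "ispath y (\<one>\<^bsub>V y\<^esub>, [(e, \<one>\<^bsub>V z\<^esub>)]) z" using step(3,4) by simp
    then show ?case using ispath_cmp[OF p] by blast
  qed
qed

end

section \<open>Characterisation of the s.f.g.i.p. for fundamental groups\<close>

theorem theoremE:
  fixes A :: "('v, 'e, 'g, 'h) pre_graph_of_groups" and u0 :: 'v
  assumes "graph_of_groups A"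
    and "Digraph_Component.connected (ugraph A)"
    and "fin_digraph (ugraph A)"
    and "\<And>e. e \<in> arcs (ugraph A) \<Longrightarrow> finite (carrier (edge_group A e))"
    and "u0 \<in> verts (ugraph A)"
  shows "sfgip (fundamental_group A u0) \<longleftrightarrow>
    (\<forall>v \<in> verts (ugraph A). sfgip (vertex_group A v)) \<and>
    \<not> (\<exists>k::nat. k \<ge> 2 \<and> (\<exists>H. subgroup H (fundamental_group A u0) \<and>
          (fundamental_group A u0)\<lparr>carrier := H\<rparr> \<cong> integer_mod_group k \<times>\<times> integer_group))"
proof -
  interpret based_graph_of_groups A u0
    using assms(1,5) by (simp add: based_graph_of_groups_def based_graph_of_groups_axioms_def)
  show ?thesis
  proof (intro iffI conjI ballI)
    assume sf: "sfgip \<pi>"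
    show "sfgip (vertex_group A v)" if v: "v \<in> verts (ugraph A)" for v
    proof -
      obtain r where "ispath u0 r v" using path_exists[OF assms(2) v] by blast
      then obtain f where "f \<in> hom (V v) \<pi>" "inj_on f (carrier (V v))" using vertex_group_embeds by blast
      then show ?thesis by (rule sfgip_inj_hom[OF group_V[OF v] group_\<pi> _ _ sf])
    qed
    show "\<not> (\<exists>k::nat. k \<ge> 2 \<and> (\<exists>H. subgroup H \<pi> \<and>
          \<pi>\<lparr>carrier := H\<rparr> \<cong> integer_mod_group k \<times>\<times> integer_group))"
    proof clarify
      fix k :: nat and H assume k: "k \<ge> 2" and H: "subgroup H \<pi>"
        and iso: "\<pi>\<lparr>carrier := H\<rparr> \<cong> integer_mod_group k \<times>\<times> integer_group"
      have gH: "group (\<pi>\<lparr>carrier := H\<rparr>)" by (rule tree.subgroup_imp_group[OF H])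
      have "integer_mod_group k \<times>\<times> integer_group \<cong> \<pi>\<lparr>carrier := H\<rparr>"
        by (rule group.iso_sym[OF gH iso])
      then obtain f where f: "f \<in> iso (integer_mod_group k \<times>\<times> integer_group) (\<pi>\<lparr>carrier := H\<rparr>)"
        by (auto simp: is_iso_def)
      have "f \<in> hom (integer_mod_group k \<times>\<times> integer_group) \<pi>"
        using f subgroup.subset[OF H] by (auto simp: iso_def hom_def)
      moreover have "inj_on f (carrier (integer_mod_group k \<times>\<times> integer_group))"
        using f by (auto simp: iso_def bij_betw_def)
      ultimately have "sfgip (integer_mod_group k \<times>\<times> integer_group)"
        by (intro sfgip_inj_hom[OF _ group_\<pi> _ _ sf]) (simp_all add: DirProd_group)
      then show False using not_sfgip_finite_cyclic_times_Z[OF k] by contradiction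
    qed
  next
    assume 2: "(\<forall>v \<in> verts (ugraph A). sfgip (vertex_group A v)) \<and>
      \<not> (\<exists>k::nat. k \<ge> 2 \<and> (\<exists>H. subgroup H \<pi> \<and> \<pi>\<lparr>carrier := H\<rparr> \<cong> integer_mod_group k \<times>\<times> integer_group))"
    have "finite (arcs (ugraph A))" using assms(3) by (rule fin_digraph.finite_arcs)
    then obtain R where R: "finite R" "\<forall>(L, M)\<in>R. nf_adj L M"
      "\<forall>K N. nf_adj K N \<longrightarrow> (\<exists>g\<in>carrier \<pi>. \<exists>(L, M)\<in>R. K = nf_act g L \<and> N = nf_act g M)"
      using finite_edge_representatives by blast
    interpret T: tree_action_sfgip \<pi> "{L. nf L}" nf_adj nf_act R
    proof unfold_locales
      show "finite (tree.stab L \<inter> tree.stab M)" if "nf_adj L M" for L M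
        using that finite_edge_stab_Cons[OF assms(4)] unfolding nf_adj_def by (auto simp: Int_commute)
      show "sfgip (\<pi>\<lparr>carrier := tree.stab L\<rparr>)" if "L \<in> {L. nf L}" for L
      proof -
        have L: "nf L" using that by simp
        show ?thesis
        proof (rule sfgip_inj_hom[OF _ group_V[OF nf_end_verts[OF L]] stab_label_hom[OF L]])
          show "group (\<pi>\<lparr>carrier := tree.stab L\<rparr>)"
            by (rule tree.subgroup_imp_group[OF tree.subgroup_stab[OF that]])
          show "inj_on (stab_label L) (carrier (\<pi>\<lparr>carrier := tree.stab L\<rparr>))" using stab_label_inj[OF L] by simp
          show "sfgip (V (end_vertex L))" using 2 nf_end_verts[OF L] by blast
        qed
      qed
    qed (use R 2 in blast)+
    show "sfgip \<pi>" by (rule T.sfgip_of_tree_action[of "[]"]) simp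
  qed
qed

end
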